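(* In the AR observation model described in the context, let $\hat r^{b}(k)$ and $\hat r^{u}(k)$, $k=1-T,\ldots,T-1$, be the biased and unbiased estimates of $r(k)$. For $p\in\{1,\ldots,T\}$ let $\mathbf R_p=\mathcal T(r(1-p),\ldots,r(p-1))$ and $$\widehat{\mathbf R}^{b}_p=\mathcal T\left(\hat r^{b}(1-p),\ldots,\hat r^{b}(p-1)\right),\qquad \widehat{\mathbf R}^{u}_p=\mathcal T\left(\hat r^{u}(1-p),\ldots,\hat r^{u}(p-1)\right).$$ Then there are positive quantities $C$ and $C'$, bounded as $T\to\infty$, such that for every $\epsilon>0$ and every $p\in\{1,\ldots,T\}$, $$\mathbb P\left[\left\|\widehat{\mathbf R}^{b}_p-\mathbf R_p\right\|>\epsilon\right]\le\exp\left(-cT\left(\frac{\epsilon}{C}-\log\left(1+\frac{\epsilon}{C}\right)+o(1)\right)\right),$$ $$\mathbb P\left[\left\|\widehat{\mathbf R}^{u}_p-\mathbf R_p\right\|>\epsilon\right]\le\exp\left(-\frac{C'T\epsilon^2}{\log T}\,(1+o(1))\right),$$ where $c=\lim N_r/T>0$, the terms $o(1)$ are with respect to $T\to\infty$ and may depend on $\epsilon$, and $\|\cdot\|$ is the spectral norm.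
   Context: Model. Fix an AR order $q\ge 1$, real coefficients $a_1,\ldots,a_q$, and known variances $\sigma_x^2>0$ and $\sigma_w^2\geq 0$, none of which depend on $N_r$ or $T$. For $n=0,\ldots,N_r-1$, the processes $(h_n(t))_{t\in\mathbb Z}$ are independent and identically distributed in $n$. Each is a zero-mean stationary circular complex Gaussian process satisfying the (causal) AR equation $$h_n(t)=a_1h_n(t-1)+\cdots+a_qh_n(t-q)+x_n(t),$$ where the $x_n(t)\sim\mathcal{CN}(0,\sigma_x^2)$ are i.i.d. in $n$ and $t$ and $x_n(t)$ is independent of the past $(h_n(s))_{s<t}$. The observations are $$\hat h_n(t)=h_n(t)+w_n(t),\qquad 0\le n\le N_r-1,\ 0\le t\le T-1,$$ where the $w_n(t)\sim\mathcal{CN}(0,\sigma_w^2)$ are i.i.d. and independent of all $h_n$. Here $\mathcal{CN}(0,\sigma^2)$ is the circular complex Gaussian law with mean $0$ and variance $\sigma^2$. Covariances. $r(k)=\sigma_x^{-2}\,\mathbb E[h_n(t)h_n(t-k)^*]$ (real and even in $k$). It is assumed that $\sum_{k=1-T}^{T-1}|r(k)|\le K$ with $K$ a fixed constant independent of $T,N_r$. For a finite sequence $d(1-m),\ldots,d(m-1)$, $\mathcal T(d(1-m),\ldots,d(m-1))$ denotes the $m\times m$ Toeplitz matrix with $(i,j)$ entry $d(i-j)$. Asymptotic regime. $N_r=N_r(T)$ and $T$ tend to infinity with $N_r/T\to c$ for some $c\in(0,\infty)$. Estimates. $$\hat r^{b}(0)=\hat r^{u}(0)=\frac{1}{\sigma_x^2N_rT}\sum_{n=0}^{N_r-1}\sum_{t=0}^{T-1}|\hat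 h_n(t)|^2-\frac{\sigma_w^2}{\sigma_x^2},$$ and for $1\le|k|\le T-1$, $$\hat r^{b}(k)=\frac{1}{\sigma_x^2N_rT}\sum_{n=0}^{N_r-1}\sum_{t}\hat h_n(t+k)\hat h_n(t)^*,\qquad \hat r^{u}(k)=\frac{1}{\sigma_x^2N_r(T-|k|)}\sum_{n=0}^{N_r-1}\sum_{t}\hat h_n(t+k)\hat h_n(t)^*,$$ where the sums over $t$ run over $0\le t\le T-1$ with $0\le t+k\le T-1$. *)

theory Defs
  imports "HOL-Probability.Probability" "Jordan_Normal_Form.Matrix"
begin

abbreviation std_normal :: "real measure" where
  "std_normal \<equiv> density lborel (\<lambda>x. ennreal (std_normal_density x))"

(* The law of m + s X with X standard normal; s = 0 gives the point mass at m. *)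
definition real_gaussian :: "real \<Rightarrow> real \<Rightarrow> real measure" where
  "real_gaussian m s = distr std_normal borel (\<lambda>x. m + s * x)"

(* CN(0, v): the law of sqrt(v/2) (X + iY) with X, Y independent standard normal, so that
   E|Z|^2 = v; v = 0 gives the point mass at 0. *)
definition complex_gaussian :: "real \<Rightarrow> complex measure" where
  "complex_gaussian v =
     distr (std_normal \<Otimes>\<^sub>M std_normal) borel
       (\<lambda>(x, y). complex_of_real (sqrt (v / 2)) * Complex x y)"

definition process_law :: "'a measure \<Rightarrow> (int \<Rightarrow> 'a \<Rightarrow> complex) \<Rightarrow> (int \<Rightarrow> complex) measure" where
  "process_law M X = distr M (\<Pi>\<^sub>M t\<in>UNIV. borel) (\<lambda>\<omega> t. X t \<omega>)"

(* With g t = alpha t - i beta t, the real part below is the general real linear combination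
   of the alpha t Re (X t) + beta t Im (X t), so gaussian means that the real and imaginary parts
   are jointly (possibly degenerate) Gaussian. *)
locale stationary_circular_gaussian_process = prob_space M
  for M :: "'a measure" +
  fixes X :: "int \<Rightarrow> 'a \<Rightarrow> complex"
  assumes measurable [measurable]: "\<And>t. X t \<in> borel_measurable M"
    and gaussian: "\<And>(F :: int set) (g :: int \<Rightarrow> complex). finite F \<Longrightarrow>
      \<exists>m s. distr M borel (\<lambda>\<omega>. Re (\<Sum>t\<in>F. g t * X t \<omega>)) = real_gaussian m s"
    and zero_mean: "\<And>t. expectation (X t) = 0"
    and circular: "\<And>\<theta>. process_law M (\<lambda>t \<omega>. cis \<theta> * X t \<omega>) = process_law M X"
    and stationary: "\<And>s. process_law M (\<lambda>t. X (t + s)) = process_law M X"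

(* indep_var without the requirement that X and Y take values in the same type. *)
definition (in prob_space) indep_rv ::
    "'b measure \<Rightarrow> ('a \<Rightarrow> 'b) \<Rightarrow> 'c measure \<Rightarrow> ('a \<Rightarrow> 'c) \<Rightarrow> bool" where
  "indep_rv A X B Y \<longleftrightarrow> random_variable A X \<and> random_variable B Y \<and>
     indep_set {X -` S \<inter> space M | S. S \<in> sets A} {Y -` S \<inter> space M | S. S \<in> sets B}"

(* N sensors, observation times 0, ..., T - 1; vx and vw are the variances of the innovations x and
   of the noise w. *)
locale ar_observation_model = prob_space M
  for M :: "'a measure" +
  fixes N T q :: nat
    and a :: "nat \<Rightarrow> real"
    and vx vw :: real
    and h x w :: "nat \<Rightarrow> int \<Rightarrow> 'a \<Rightarrow> complex"
  assumes process: "\<And>n. n < N \<Longrightarrow> stationary_circular_gaussian_process M (h n)"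
    and h_indep:
      "indep_vars (\<lambda>n. \<Pi>\<^sub>M t\<in>(UNIV :: int set). borel) (\<lambda>n \<omega> t. h n t \<omega>) {..<N}"
    and h_identical:
      "\<And>m n. m < N \<Longrightarrow> n < N \<Longrightarrow> process_law M (h m) = process_law M (h n)"
    and ar_equation: "\<And>n t. n < N \<Longrightarrow>
      AE \<omega> in M. h n t \<omega> = (\<Sum>j=1..q. complex_of_real (a j) * h n (t - int j) \<omega>) + x n t \<omega>"
    and x_law: "\<And>n t. n < N \<Longrightarrow> distr M borel (x n t) = complex_gaussian vx"
    and x_indep: "indep_vars (\<lambda>_. borel) (\<lambda>(n, t). x n t) ({..<N} \<times> UNIV)"
    and x_indep_past: "\<And>n t. n < N \<Longrightarrow>
      indep_rv borel (x n t) (\<Pi>\<^sub>M s\<in>{..<t}. borel) (\<lambda>\<omega>. \<lambda>s\<in>{..<t}. h n s \<omega>)"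
    and w_law: "\<And>n t. n < N \<Longrightarrow> t \<in> {0..<int T} \<Longrightarrow>
      distr M borel (w n t) = complex_gaussian vw"
    and w_indep: "indep_vars (\<lambda>_. borel) (\<lambda>(n, t). w n t) ({..<N} \<times> {0..<int T})"
    and w_indep_h: "indep_var
      (\<Pi>\<^sub>M i\<in>{..<N} \<times> {0..<int T}. borel)
        (\<lambda>\<omega>. \<lambda>i\<in>{..<N} \<times> {0..<int T}. w (fst i) (snd i) \<omega>)
      (\<Pi>\<^sub>M i\<in>{..<N} \<times> (UNIV :: int set). borel)
        (\<lambda>\<omega>. \<lambda>i\<in>{..<N} \<times> (UNIV :: int set). h (fst i) (snd i) \<omega>)"

(* Estimators as functions of the observed array y n t, n < N, 0 <= t < T. *)
definition lag_sum :: "nat \<Rightarrow> nat \<Rightarrow> (nat \<Rightarrow> int \<Rightarrow> complex) \<Rightarrow> int \<Rightarrow> complex" where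
  "lag_sum N T y k =
     (\<Sum>n<N. \<Sum>t | t \<in> {0..<int T} \<and> t + k \<in> {0..<int T}. y n (t + k) * cnj (y n t))"

definition cov_est_zero :: "real \<Rightarrow> real \<Rightarrow> nat \<Rightarrow> nat \<Rightarrow> (nat \<Rightarrow> int \<Rightarrow> complex) \<Rightarrow> complex" where
  "cov_est_zero vx vw N T y = complex_of_real
     (1 / (vx * real N * real T) * (\<Sum>n<N. \<Sum>t\<in>{0..<int T}. (cmod (y n t))\<^sup>2) - vw / vx)"

definition cov_est_biased ::
    "real \<Rightarrow> real \<Rightarrow> nat \<Rightarrow> nat \<Rightarrow> (nat \<Rightarrow> int \<Rightarrow> complex) \<Rightarrow> int \<Rightarrow> complex" where
  "cov_est_biased vx vw N T y k =
     (if k = 0 then cov_est_zero vx vw N T y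
      else complex_of_real (1 / (vx * real N * real T)) * lag_sum N T y k)"

definition cov_est_unbiased ::
    "real \<Rightarrow> real \<Rightarrow> nat \<Rightarrow> nat \<Rightarrow> (nat \<Rightarrow> int \<Rightarrow> complex) \<Rightarrow> int \<Rightarrow> complex" where
  "cov_est_unbiased vx vw N T y k =
     (if k = 0 then cov_est_zero vx vw N T y
      else complex_of_real (1 / (vx * real N * (real T - \<bar>real_of_int k\<bar>))) * lag_sum N T y k)"

definition toeplitz :: "nat \<Rightarrow> (int \<Rightarrow> complex) \<Rightarrow> complex mat" where
  "toeplitz m d = mat m m (\<lambda>(i, j). d (int i - int j))"

definition l2_norm_vec :: "complex vec \<Rightarrow> real" where
  "l2_norm_vec v = L2_set (\<lambda>i. cmod (vec_index v i)) {..<dim_vec v}"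

(* Operator norm for the Euclidean norms; only meaningful when A has at least one column. *)
definition spectral_norm :: "complex mat \<Rightarrow> real" where
  "spectral_norm A =
     (SUP v\<in>{v \<in> carrier_vec (dim_col A). l2_norm_vec v = 1}. l2_norm_vec (mult_mat_vec A v))"

end

theory Submission
  imports Defs "HOL-Real_Asymp.Real_Asymp"
begin

text \<open>The symbol of the estimated Toeplitz matrix at a frequency is a Hermitian quadratic form in the
  observations, averaged over the sensors, and by circulant embedding the error in spectral norm is
  at most the largest error of the symbol on a grid of \<open>2 T\<close> frequencies. Fix one frequency and let
  \<open>A\<close> be the matrix of the form and \<open>k\<close> a bound for the covariance matrix. To bound the exponential
  moments of the centred form \<open>Q\<close>, replace it by \<open>Q(y) - Q(y')\<close> with an independent copy \<open>y'\<close>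
  (Jensen), rotate \<open>(y, y')\<close> by 45 degrees to get a bilinear form, integrate one argument out, and
  linearise the resulting square with auxiliary i.i.d. Gaussian variables before integrating out the
  other. What remains involves only the i.i.d. variables, so it factorises over the sensors, and it is
  at most \<open>exp (2 s\<^sup>2 k\<^sup>2 |A|\<^sup>2)\<close> per sensor (Frobenius norm) as long as \<open>s\<^sup>2 k\<^sup>2 |A|\<^sup>2 \<le> 1/2\<close>.
  The squared Frobenius norm is bounded for the biased weights and of order \<open>log T\<close> for the
  unbiased ones. Chernoff's bound and a union bound over the grid finish the proof: the factor \<open>4 T\<close>
  and the bias go into the \<open>o(1)\<close> terms.\<close>

text \<open>No density of the array is used: its law is known through the characteristic functions
  of its linear combinations, and a uniqueness theorem for finite families carries the rotation
  invariance over to exponential moments. After symmetrisation the form is bilinear in independent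
  arguments, so its log-moment starts at order \<open>s\<^sup>2\<close>; once one argument is
  integrated out, the covariance enters only through a variance, and the inequality with
  \<open>k\<close> replaces any diagonalisation. With \<open>vx\<close> scaled to 1,
  \<open>\<sigma> = s * k\<close> and \<open>L\<close> a bound for \<open>|A|\<^sup>2\<close>,
  Chernoff's exponent per sensor is
  \<open>2 * \<sigma>\<^sup>2 * L - \<sigma> * \<epsilon> / k\<close>. For the biased weights
  \<open>L\<close> is constant and the restriction on \<open>\<sigma>\<close> binds for large
  \<open>\<epsilon>\<close>: the rate is quadratic near 0 and linear at infinity, like
  \<open>x - log (1 + x)\<close>. For the unbiased weights \<open>L\<close> grows like
  \<open>log T\<close>, the optimal \<open>\<sigma>\<close> of order \<open>\<epsilon> / L\<close>
  is eventually admissible, and the rate is quadratic for every \<open>\<epsilon>\<close>. The grid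
  depends on \<open>T\<close> alone, which makes the bounds uniform in \<open>p\<close>.\<close>

section \<open>Joint characteristic functions\<close>

text \<open>A finite measure with density \<open>W\<close> is determined along \<open>X\<close> by its characteristic
  function, because after normalisation it becomes a probability measure.\<close>

lemma weighted_char_unique:
  fixes X W :: "'a \<Rightarrow> real" and X' W' :: "'b \<Rightarrow> real"
  assumes "prob_space P" "prob_space P'"
    and [measurable]: "X \<in> borel_measurable P" "W \<in> borel_measurable P"
      "X' \<in> borel_measurable P'" "W' \<in> borel_measurable P'"
    and W: "\<And>\<omega>. 0 \<le> W \<omega>" "\<And>\<omega>. W \<omega> \<le> C" and W': "\<And>\<omega>. 0 \<le> W' \<omega>" "\<And>\<omega>. W' \<omega> \<le> C"
    and eq: "\<And>t. (\<integral>\<omega>. complex_of_real (W \<omega>) * iexp (t * X \<omega>) \<partial>P) =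
      (\<integral>\<omega>. complex_of_real (W' \<omega>) * iexp (t * X' \<omega>) \<partial>P')"
    and B[measurable]: "B \<in> sets borel"
  shows "(\<integral>\<omega>. W \<omega> * indicator B (X \<omega>) \<partial>P) = (\<integral>\<omega>. W' \<omega> * indicator B (X' \<omega>) \<partial>P')"
proof -
  interpret P: prob_space P by fact
  interpret P': prob_space P' by fact
  have iW: "integrable P W" by (rule P.integrable_const_bound[of _ C]) (use W in auto)
  have iW': "integrable P' W'" by (rule P'.integrable_const_bound[of _ C]) (use W' in auto)
  define m where "m = (\<integral>\<omega>. W \<omega> \<partial>P)"
  \<comment> \<open>At 0 the characteristic functions are the total masses, so one constant
    normalises both measures.\<close>
  have m': "m = (\<integral>\<omega>. W' \<omega> \<partial>P')"
    using eq[of 0] by (simp add: m_def)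
  have m0: "m \<ge> 0" unfolding m_def using W by simp
  show ?thesis
  proof (cases "m = 0")
    case True
    have "AE \<omega> in P. W \<omega> = 0"
      using integral_nonneg_eq_0_iff_AE[OF iW] W True m_def by auto
    then have "(\<integral>\<omega>. W \<omega> * indicator B (X \<omega>) \<partial>P) = (\<integral>\<omega>. 0 \<partial>P)"
      by (intro integral_cong_AE) auto
    moreover have "AE \<omega> in P'. W' \<omega> = 0"
      using integral_nonneg_eq_0_iff_AE[OF iW'] W' True m' by auto
    then have "(\<integral>\<omega>. W' \<omega> * indicator B (X' \<omega>) \<partial>P') = (\<integral>\<omega>. 0 \<partial>P')"
      by (intro integral_cong_AE) auto
    ultimately show ?thesis by simp
  next
    case False
    with m0 have m: "m > 0" by simp
    define Q where "Q = distr (density P (\<lambda>\<omega>. W \<omega> / m)) borel X"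
    define Q' where "Q' = distr (density P' (\<lambda>\<omega>. W' \<omega> / m)) borel X'"
    have d: "prob_space (density P (\<lambda>\<omega>. W \<omega> / m))"
    proof
      have "(\<integral>\<^sup>+ \<omega>. ennreal (W \<omega> / m) \<partial>P) = ennreal (\<integral>\<omega>. W \<omega> / m \<partial>P)"
        using iW W m by (intro nn_integral_eq_integral) auto
      also have "\<dots> = 1" using m by (simp add: m_def)
      finally show "emeasure (density P (\<lambda>\<omega>. W \<omega> / m)) (space (density P (\<lambda>\<omega>. W \<omega> / m))) = 1"
        by (simp add: emeasure_density cong: nn_integral_cong)
    qed
    have d': "prob_space (density P' (\<lambda>\<omega>. W' \<omega> / m))"
    proof
      have "(\<integral>\<^sup>+ \<omega>. ennreal (W' \<omega> / m) \<partial>P') = ennreal (\<integral>\<omega>. W' \<omega> / m \<partial>P')"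
        using iW' W' m by (intro nn_integral_eq_integral) auto
      also have "\<dots> = 1" using m by (simp add: m')
      finally show "emeasure (density P' (\<lambda>\<omega>. W' \<omega> / m)) (space (density P' (\<lambda>\<omega>. W' \<omega> / m))) = 1"
        by (simp add: emeasure_density cong: nn_integral_cong)
    qed
    have Q: "real_distribution Q" unfolding Q_def
      by (rule prob_space.real_distribution_distr[OF d]) simp
    have Q': "real_distribution Q'" unfolding Q'_def
      by (rule prob_space.real_distribution_distr[OF d']) simp
    have cQ: "char Q t = (\<integral>\<omega>. complex_of_real (W \<omega>) * iexp (t * X \<omega>) \<partial>P) / m" for t
    proof -
      have "char Q t = (\<integral>\<omega>. iexp (t * X \<omega>) \<partial>density P (\<lambda>\<omega>. W \<omega> / m))"
        unfolding char_def Q_def by (subst integral_distr) auto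
      also have "\<dots> = (\<integral>\<omega>. (W \<omega> / m) *\<^sub>R iexp (t * X \<omega>) \<partial>P)"
        using W m by (subst integral_density) auto
      also have "\<dots> = (\<integral>\<omega>. complex_of_real (W \<omega>) * iexp (t * X \<omega>) / m \<partial>P)"
        by (intro Bochner_Integration.integral_cong) (auto simp: scaleR_conv_of_real)
      finally show ?thesis by simp
    qed
    have cQ': "char Q' t = (\<integral>\<omega>. complex_of_real (W' \<omega>) * iexp (t * X' \<omega>) \<partial>P') / m" for t
    proof -
      have "char Q' t = (\<integral>\<omega>. iexp (t * X' \<omega>) \<partial>density P' (\<lambda>\<omega>. W' \<omega> / m))"
        unfolding char_def Q'_def by (subst integral_distr) auto
      also have "\<dots> = (\<integral>\<omega>. (W' \<omega> / m) *\<^sub>R iexp (t * X' \<omega>) \<partial>P')"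
        using W' m by (subst integral_density) auto
      also have "\<dots> = (\<integral>\<omega>. complex_of_real (W' \<omega>) * iexp (t * X' \<omega>) / m \<partial>P')"
        by (intro Bochner_Integration.integral_cong) (auto simp: scaleR_conv_of_real)
      finally show ?thesis by simp
    qed
    have "char Q = char Q'" by (rule ext) (simp only: cQ cQ' eq)
    from Levy_uniqueness[OF Q Q' this] have "measure Q B = measure Q' B" by simp
    moreover have "measure Q B = (\<integral>\<omega>. W \<omega> * indicator B (X \<omega>) \<partial>P) / m"
    proof -
      have "measure Q B = (\<integral>x. indicator B x \<partial>Q)" unfolding Q_def by simp
      also have "\<dots> = (\<integral>\<omega>. indicator B (X \<omega>) \<partial>density P (\<lambda>\<omega>. W \<omega> / m))"
        unfolding Q_def by (subst integral_distr) auto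
      also have "\<dots> = (\<integral>\<omega>. (W \<omega> / m) *\<^sub>R indicator B (X \<omega>) \<partial>P)"
        using W m by (subst integral_density) auto
      also have "\<dots> = (\<integral>\<omega>. W \<omega> * indicator B (X \<omega>) / m \<partial>P)"
        by (intro Bochner_Integration.integral_cong) auto
      finally show ?thesis by simp
    qed
    moreover have "measure Q' B = (\<integral>\<omega>. W' \<omega> * indicator B (X' \<omega>) \<partial>P') / m"
    proof -
      have "measure Q' B = (\<integral>x. indicator B x \<partial>Q')" unfolding Q'_def by simp
      also have "\<dots> = (\<integral>\<omega>. indicator B (X' \<omega>) \<partial>density P' (\<lambda>\<omega>. W' \<omega> / m))"
        unfolding Q'_def by (subst integral_distr) auto
      also have "\<dots> = (\<integral>\<omega>. (W' \<omega> / m) *\<^sub>R indicator B (X' \<omega>) \<partial>P')"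
        using W' m by (subst integral_density) auto
      also have "\<dots> = (\<integral>\<omega>. W' \<omega> * indicator B (X' \<omega>) / m \<partial>P')"
        by (intro Bochner_Integration.integral_cong) auto
      finally show ?thesis by simp
    qed
    ultimately show ?thesis using m by simp
  qed
qed

definition joint_char :: "'a measure \<Rightarrow> 'i set \<Rightarrow> ('i \<Rightarrow> 'a \<Rightarrow> real) \<Rightarrow> ('i \<Rightarrow> real) \<Rightarrow> complex" where
  "joint_char P I X g = (\<integral>\<omega>. iexp (\<Sum>i\<in>I. g i * X i \<omega>) \<partial>P)"

text \<open>The indicators are introduced one coordinate at a time. The induction step applies the
  one-dimensional uniqueness theorem to the nonnegative weights \<open>D * (1 + cos (S + \<theta>))\<close>, since the
  weight \<open>D * iexp S\<close> of interest is not a positive density.\<close>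

lemma joint_char_indicator_eq:
  fixes X :: "'i \<Rightarrow> 'a \<Rightarrow> real" and X' :: "'i \<Rightarrow> 'b \<Rightarrow> real"
  assumes P: "prob_space P" and P': "prob_space P'" and I: "finite I"
    and [measurable]: "\<And>i. X i \<in> borel_measurable P" "\<And>i. X' i \<in> borel_measurable P'"
    and eq: "\<And>g. joint_char P I X g = joint_char P' I X' g"
    and B[measurable]: "\<And>i. B i \<in> sets borel"
    and J: "finite J" "J \<subseteq> I"
  shows "(\<integral>\<omega>. complex_of_real (\<Prod>j\<in>J. indicator (B j) (X j \<omega>)) * iexp (\<Sum>i\<in>I. g i * X i \<omega>) \<partial>P) =
    (\<integral>\<omega>. complex_of_real (\<Prod>j\<in>J. indicator (B j) (X' j \<omega>)) * iexp (\<Sum>i\<in>I. g i * X' i \<omega>) \<partial>P')"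
  using J
proof (induction J arbitrary: g rule: finite_induct)
  case empty
  then show ?case using eq[of g] by (simp add: joint_char_def)
next
  case (insert j J)
  interpret P: prob_space P by fact
  interpret P': prob_space P' by fact
  define D where "D \<omega> = (\<Prod>j\<in>J. indicator (B j) (X j \<omega>) :: real)" for \<omega>
  define D' where "D' \<omega> = (\<Prod>j\<in>J. indicator (B j) (X' j \<omega>) :: real)" for \<omega>
  define S where "S g \<omega> = (\<Sum>i\<in>I. g i * X i \<omega>)" for g \<omega>
  define S' where "S' g \<omega> = (\<Sum>i\<in>I. g i * X' i \<omega>)" for g \<omega>
  have [measurable]: "D \<in> borel_measurable P" "D' \<in> borel_measurable P'"
    "S g \<in> borel_measurable P" "S' g \<in> borel_measurable P'" for g
    unfolding D_def D'_def S_def S'_def by measurable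
  have D01: "0 \<le> D \<omega>" "D \<omega> \<le> 1" for \<omega> unfolding D_def by (auto intro!: prod_nonneg prod_le_1)
  have D'01: "0 \<le> D' \<omega>" "D' \<omega> \<le> 1" for \<omega> unfolding D'_def by (auto intro!: prod_nonneg prod_le_1)
  have IH: "(\<integral>\<omega>. complex_of_real (D \<omega>) * iexp (S g \<omega>) \<partial>P) =
      (\<integral>\<omega>. complex_of_real (D' \<omega>) * iexp (S' g \<omega>) \<partial>P')" for g
    using insert unfolding D_def D'_def S_def S'_def by auto
  have int: "integrable P (\<lambda>\<omega>. complex_of_real (D \<omega>) * iexp (S g \<omega>))" for g
    by (rule P.integrable_const_bound[of _ 1]) (use D01 in \<open>auto simp: norm_mult\<close>)
  have int': "integrable P' (\<lambda>\<omega>. complex_of_real (D' \<omega>) * iexp (S' g \<omega>))" for g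
    by (rule P'.integrable_const_bound[of _ 1]) (use D'01 in \<open>auto simp: norm_mult\<close>)
  have jI: "j \<in> I" using insert by auto
  \<comment> \<open>The frequencies met when the cosine is expanded: next to
    \<open>iexp (t * X j)\<close> the terms 1, \<open>iexp S\<close> and \<open>iexp (- S)\<close>
    give characteristic functions at \<open>G 0 t\<close>, \<open>G 1 t\<close> and
    \<open>G (-1) t\<close>, and the induction hypothesis covers all three.\<close>
  define G where "G u t = (\<lambda>i. u * g i + (if i = j then t else 0))" for u t :: real
  have SG: "S (G u t) \<omega> = u * S g \<omega> + t * X j \<omega>"
    and S'G: "S' (G u t) \<omega>' = u * S' g \<omega>' + t * X' j \<omega>'" for u t \<omega> \<omega>'
    unfolding S_def S'_def G_def using jI I
    by (simp_all add: algebra_simps sum.distrib sum_distrib_left if_distrib[of "\<lambda>z. _ * z"] cong: if_cong)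
  have expand: "complex_of_real (d * (1 + cos (s + \<theta>))) * iexp y =
      of_real d * iexp y + (iexp \<theta> / 2) * (of_real d * iexp (s + y)) + (iexp (-\<theta>) / 2) * (of_real d * iexp (- s + y))"
    for d s \<theta> y :: real
  proof -
    have "complex_of_real (cos (s + \<theta>)) = (iexp (s + \<theta>) + iexp (-(s + \<theta>))) / 2"
      by (simp add: cos_of_real [symmetric] cos_exp_eq algebra_simps)
    then show ?thesis
      by (simp add: algebra_simps exp_add exp_diff exp_minus add_divide_distrib)
  qed
  have W: "(\<integral>\<omega>. (D \<omega> * (1 + cos (S g \<omega> + \<theta>))) * indicator (B j) (X j \<omega>) \<partial>P) =
     (\<integral>\<omega>. (D' \<omega> * (1 + cos (S' g \<omega> + \<theta>))) * indicator (B j) (X' j \<omega>) \<partial>P')" for \<theta>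
  proof (rule weighted_char_unique[OF P P', where C = 2])
    fix t
    have "(\<integral>\<omega>. complex_of_real (D \<omega> * (1 + cos (S g \<omega> + \<theta>))) * iexp (t * X j \<omega>) \<partial>P) =
      (\<integral>\<omega>. complex_of_real (D \<omega>) * iexp (S (G 0 t) \<omega>) + (iexp \<theta> / 2) * (of_real (D \<omega>) * iexp (S (G 1 t) \<omega>))
        + (iexp (-\<theta>) / 2) * (of_real (D \<omega>) * iexp (S (G (-1) t) \<omega>)) \<partial>P)"
      unfolding expand SG by simp
    also have "\<dots> = (\<integral>\<omega>. complex_of_real (D \<omega>) * iexp (S (G 0 t) \<omega>) \<partial>P)
        + (iexp \<theta> / 2) * (\<integral>\<omega>. complex_of_real (D \<omega>) * iexp (S (G 1 t) \<omega>) \<partial>P)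
        + (iexp (-\<theta>) / 2) * (\<integral>\<omega>. complex_of_real (D \<omega>) * iexp (S (G (-1) t) \<omega>) \<partial>P)"
      by (simp only: Bochner_Integration.integral_add Bochner_Integration.integrable_add
          integrable_mult_right integral_mult_right_zero int)
    also have "\<dots> = (\<integral>\<omega>. complex_of_real (D' \<omega>) * iexp (S' (G 0 t) \<omega>) \<partial>P')
        + (iexp \<theta> / 2) * (\<integral>\<omega>. complex_of_real (D' \<omega>) * iexp (S' (G 1 t) \<omega>) \<partial>P')
        + (iexp (-\<theta>) / 2) * (\<integral>\<omega>. complex_of_real (D' \<omega>) * iexp (S' (G (-1) t) \<omega>) \<partial>P')"
      by (simp only: IH)
    also have "\<dots> = (\<integral>\<omega>. complex_of_real (D' \<omega>) * iexp (S' (G 0 t) \<omega>) + (iexp \<theta> / 2) * (of_real (D' \<omega>) * iexp (S' (G 1 t) \<omega>))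
        + (iexp (-\<theta>) / 2) * (of_real (D' \<omega>) * iexp (S' (G (-1) t) \<omega>)) \<partial>P')"
      by (simp only: Bochner_Integration.integral_add Bochner_Integration.integrable_add
          integrable_mult_right integral_mult_right_zero int')
    also have "\<dots> = (\<integral>\<omega>. complex_of_real (D' \<omega> * (1 + cos (S' g \<omega> + \<theta>))) * iexp (t * X' j \<omega>) \<partial>P')"
      unfolding expand S'G by simp
    finally show "(\<integral>\<omega>. complex_of_real (D \<omega> * (1 + cos (S g \<omega> + \<theta>))) * iexp (t * X j \<omega>) \<partial>P) =
      (\<integral>\<omega>. complex_of_real (D' \<omega> * (1 + cos (S' g \<omega> + \<theta>))) * iexp (t * X' j \<omega>) \<partial>P')" .
  next
    have c: "0 \<le> 1 + cos z" "1 + cos z \<le> 2" for z :: real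
      using cos_ge_minus_one[of z] cos_le_one[of z] by linarith+
    show "0 \<le> D \<omega> * (1 + cos (S g \<omega> + \<theta>))" "D \<omega> * (1 + cos (S g \<omega> + \<theta>)) \<le> 2" for \<omega>
      using D01[of \<omega>] c[of "S g \<omega> + \<theta>"] mult_mono[of "D \<omega>" 1 "1 + cos (S g \<omega> + \<theta>)" 2] by auto
    show "0 \<le> D' \<omega> * (1 + cos (S' g \<omega> + \<theta>))" "D' \<omega> * (1 + cos (S' g \<omega> + \<theta>)) \<le> 2" for \<omega>
      using D'01[of \<omega>] c[of "S' g \<omega> + \<theta>"] mult_mono[of "D' \<omega>" 1 "1 + cos (S' g \<omega> + \<theta>)" 2] by auto
  qed simp_all
  \<comment> \<open>The summand 1 made the weight nonnegative. Its own contribution is identified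
    here, so that \<open>cosE\<close> can subtract it.\<close>
  have W0: "(\<integral>\<omega>. D \<omega> * indicator (B j) (X j \<omega>) \<partial>P) = (\<integral>\<omega>. D' \<omega> * indicator (B j) (X' j \<omega>) \<partial>P')"
  proof (rule weighted_char_unique[OF P P', where C = 1])
    show "(\<integral>\<omega>. complex_of_real (D \<omega>) * iexp (t * X j \<omega>) \<partial>P) =
      (\<integral>\<omega>. complex_of_real (D' \<omega>) * iexp (t * X' j \<omega>) \<partial>P')" for t
      using IH[of "G 0 t"] by (simp add: SG S'G)
  qed (use D01 D'01 in simp_all)
  define E where "E \<omega> = D \<omega> * indicator (B j) (X j \<omega>)" for \<omega>
  define E' where "E' \<omega> = D' \<omega> * indicator (B j) (X' j \<omega>)" for \<omega>
  have [measurable]: "E \<in> borel_measurable P" "E' \<in> borel_measurable P'"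
    unfolding E_def E'_def by measurable
  have E01: "0 \<le> E \<omega>" "E \<omega> \<le> 1" for \<omega>
    using D01[of \<omega>] by (auto simp: E_def indicator_def)
  have E'01: "0 \<le> E' \<omega>" "E' \<omega> \<le> 1" for \<omega>
    using D'01[of \<omega>] by (auto simp: E'_def indicator_def)
  have bnd: "\<bar>e * c\<bar> \<le> 1" if "0 \<le> e" "e \<le> 1" "\<bar>c\<bar> \<le> 1" for e c :: real
    using that by (simp add: abs_mult mult_le_one)
  have iE: "integrable P (\<lambda>\<omega>. E \<omega> * cos (S g \<omega> + \<theta>))" "integrable P E" for \<theta>
    by (rule P.integrable_const_bound[of _ 1]; use E01 bnd in auto)+
  have iE': "integrable P' (\<lambda>\<omega>. E' \<omega> * cos (S' g \<omega> + \<theta>))" "integrable P' E'" for \<theta>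
    by (rule P'.integrable_const_bound[of _ 1]; use E'01 bnd in auto)+
  have cosE: "(\<integral>\<omega>. E \<omega> * cos (S g \<omega> + \<theta>) \<partial>P) = (\<integral>\<omega>. E' \<omega> * cos (S' g \<omega> + \<theta>) \<partial>P')" for \<theta>
  proof -
    have "(\<integral>\<omega>. E \<omega> + E \<omega> * cos (S g \<omega> + \<theta>) \<partial>P) = (\<integral>\<omega>. E' \<omega> + E' \<omega> * cos (S' g \<omega> + \<theta>) \<partial>P')"
      using W[of \<theta>] by (simp add: E_def E'_def algebra_simps)
    then show ?thesis using W0 iE iE' by (simp add: E_def[symmetric] E'_def[symmetric])
  qed
  \<comment> \<open>The free phase pays off: \<open>\<theta> = 0\<close> gives the real part of
    \<open>iexp S\<close> and \<open>\<theta> = - pi / 2\<close> the imaginary part.\<close>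
  have sinE: "(\<integral>\<omega>. E \<omega> * sin (S g \<omega>) \<partial>P) = (\<integral>\<omega>. E' \<omega> * sin (S' g \<omega>) \<partial>P')"
    using cosE[of "- pi / 2"] by (simp add: cos_diff)
  have isE: "integrable P (\<lambda>\<omega>. E \<omega> * sin (S g \<omega>))" "integrable P' (\<lambda>\<omega>. E' \<omega> * sin (S' g \<omega>))"
    using iE(1)[of "- pi / 2"] iE'(1)[of "- pi / 2"] by (simp_all add: cos_diff)
  have split: "complex_of_real e * iexp y = of_real (e * cos y) + \<i> * of_real (e * sin y)" for e y :: real
    by (simp add: exp_Euler cos_of_real sin_of_real algebra_simps)
  have "(\<integral>\<omega>. complex_of_real (E \<omega>) * iexp (S g \<omega>) \<partial>P) =
      of_real (\<integral>\<omega>. E \<omega> * cos (S g \<omega>) \<partial>P) + \<i> * of_real (\<integral>\<omega>. E \<omega> * sin (S g \<omega>) \<partial>P)"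
    unfolding split using iE(1)[of 0] isE
    by (subst Bochner_Integration.integral_add) (auto simp del: of_real_mult)
  moreover have "(\<integral>\<omega>. complex_of_real (E' \<omega>) * iexp (S' g \<omega>) \<partial>P') =
      of_real (\<integral>\<omega>. E' \<omega> * cos (S' g \<omega>) \<partial>P') + \<i> * of_real (\<integral>\<omega>. E' \<omega> * sin (S' g \<omega>) \<partial>P')"
    unfolding split using iE'(1)[of 0] isE
    by (subst Bochner_Integration.integral_add) (auto simp del: of_real_mult)
  ultimately have "(\<integral>\<omega>. complex_of_real (E \<omega>) * iexp (S g \<omega>) \<partial>P) =
      (\<integral>\<omega>. complex_of_real (E' \<omega>) * iexp (S' g \<omega>) \<partial>P')"
    using cosE[of 0] sinE by simp
  then show ?case
    using insert by (simp add: E_def E'_def D_def D'_def S_def S'_def mult.commute)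
qed

text \<open>With \<open>J = I\<close> and \<open>g = 0\<close> the indicator identity says that both
  laws agree on boxes, which generate the product sigma-algebra and are closed under
  intersection.\<close>

theorem joint_char_unique:
  fixes X :: "'i \<Rightarrow> 'a \<Rightarrow> real" and X' :: "'i \<Rightarrow> 'b \<Rightarrow> real"
  assumes P: "prob_space P" and P': "prob_space P'" and I: "finite I"
    and [measurable]: "\<And>i. X i \<in> borel_measurable P" "\<And>i. X' i \<in> borel_measurable P'"
    and eq: "\<And>g. joint_char P I X g = joint_char P' I X' g"
  shows "distr P (\<Pi>\<^sub>M i\<in>I. borel) (\<lambda>\<omega>. \<lambda>i\<in>I. X i \<omega>) = distr P' (\<Pi>\<^sub>M i\<in>I. borel) (\<lambda>\<omega>. \<lambda>i\<in>I. X' i \<omega>)"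
    (is "?D = ?D'")
proof (rule measure_eqI_PiM_finite[OF I])
  interpret P: prob_space P by fact
  interpret P': prob_space P' by fact
  fix A :: "'i \<Rightarrow> real set" assume A: "\<And>i. i \<in> I \<Longrightarrow> A i \<in> sets borel"
  \<comment> \<open>The sets off \<open>I\<close> are arbitrary, whereas the indicator identity asks
    for measurable sets at every index.\<close>
  define B where "B i = (if i \<in> I then A i else {})" for i
  have B[measurable]: "B i \<in> sets borel" for i using A by (auto simp: B_def)
  have AB: "Pi\<^sub>E I A = Pi\<^sub>E I B" by (rule PiE_cong) (auto simp: B_def)
  have ind: "(\<integral>\<omega>. (\<Prod>j\<in>I. indicator (B j) (X j \<omega>)) \<partial>P) = (\<integral>\<omega>. (\<Prod>j\<in>I. indicator (B j) (X' j \<omega>) :: real) \<partial>P')"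
    using joint_char_indicator_eq[OF P P' I assms(4,5) eq B I order_refl, where g = "\<lambda>_. 0"]
    by (simp del: of_real_prod)
  have [measurable]: "Pi\<^sub>E I B \<in> sets (\<Pi>\<^sub>M i\<in>I. borel)" using I by (intro sets_PiM_I_finite) auto
  have m: "measure ?D (Pi\<^sub>E I B) = (\<integral>\<omega>. (\<Prod>j\<in>I. indicator (B j) (X j \<omega>)) \<partial>P)"
  proof -
    have "measure ?D (Pi\<^sub>E I B) = (\<integral>x. indicator (Pi\<^sub>E I B) x \<partial>?D)" by simp
    also have "\<dots> = (\<integral>\<omega>. indicator (Pi\<^sub>E I B) (\<lambda>i\<in>I. X i \<omega>) \<partial>P)"
      by (subst integral_distr) auto
    also have "\<dots> = (\<integral>\<omega>. (\<Prod>j\<in>I. indicator (B j) (X j \<omega>)) \<partial>P)"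
      by (intro Bochner_Integration.integral_cong refl) (auto simp: indicator_def I PiE_iff)
    finally show ?thesis .
  qed
  have m': "measure ?D' (Pi\<^sub>E I B) = (\<integral>\<omega>. (\<Prod>j\<in>I. indicator (B j) (X' j \<omega>)) \<partial>P')"
  proof -
    have "measure ?D' (Pi\<^sub>E I B) = (\<integral>x. indicator (Pi\<^sub>E I B) x \<partial>?D')" by simp
    also have "\<dots> = (\<integral>\<omega>. indicator (Pi\<^sub>E I B) (\<lambda>i\<in>I. X' i \<omega>) \<partial>P')"
      by (subst integral_distr) auto
    also have "\<dots> = (\<integral>\<omega>. (\<Prod>j\<in>I. indicator (B j) (X' j \<omega>)) \<partial>P')"
      by (intro Bochner_Integration.integral_cong refl) (auto simp: indicator_def I PiE_iff)
    finally show ?thesis .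
  qed
  interpret D: prob_space ?D by (rule P.prob_space_distr) measurable
  interpret D': prob_space ?D' by (rule P'.prob_space_distr) measurable
  show "emeasure ?D (Pi\<^sub>E I A) = emeasure ?D' (Pi\<^sub>E I A)"
    unfolding AB by (simp only: D.emeasure_eq_measure D'.emeasure_eq_measure m m' ind)
next
  interpret P: prob_space P by fact
  interpret D: prob_space ?D by (rule P.prob_space_distr) measurable
  show "range (\<lambda>_::nat. \<Pi>\<^sub>E i\<in>I. UNIV) \<subseteq> prod_algebra I (\<lambda>i. borel :: real measure)"
    using I by (auto intro!: prod_algebraI_finite)
  show "\<And>i::nat. emeasure ?D (\<Pi>\<^sub>E i\<in>I. UNIV) \<noteq> \<infinity>" by simp
qed (auto simp: space_PiM)

text \<open>Real and imaginary parts form a real family over the doubled index set, and a real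
  combination of them is \<open>Re (\<Sum> g i * Z i)\<close> with the imaginary parts of the
  coefficients negated. The conclusion concerns nonnegative integrals because exponential moments
  are compared before they are known to be finite.\<close>

lemma nn_integral_joint_char_unique:
  fixes Z :: "'i \<Rightarrow> 'a \<Rightarrow> complex" and Z' :: "'i \<Rightarrow> 'b \<Rightarrow> complex"
  assumes P: "prob_space P" and P': "prob_space P'" and I: "finite I"
    and [measurable]: "\<And>i. Z i \<in> borel_measurable P" "\<And>i. Z' i \<in> borel_measurable P'"
    and eq: "\<And>g. (\<integral>\<omega>. iexp (Re (\<Sum>i\<in>I. g i * Z i \<omega>)) \<partial>P) = (\<integral>\<omega>. iexp (Re (\<Sum>i\<in>I. g i * Z' i \<omega>)) \<partial>P')"
    and f[measurable]: "f \<in> borel_measurable (\<Pi>\<^sub>M i\<in>I. borel)"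
  shows "(\<integral>\<^sup>+\<omega>. f (\<lambda>i\<in>I. Z i \<omega>) \<partial>P) = (\<integral>\<^sup>+\<omega>. f (\<lambda>i\<in>I. Z' i \<omega>) \<partial>P')"
proof -
  define K where "K = I \<times> (UNIV :: bool set)"
  define X where "X = (\<lambda>(i, b) \<omega>. if b then Re (Z i \<omega>) else Im (Z i \<omega>))"
  define X' where "X' = (\<lambda>(i, b) \<omega>. if b then Re (Z' i \<omega>) else Im (Z' i \<omega>))"
  have K: "finite K" using I by (simp add: K_def)
  have [measurable]: "X j \<in> borel_measurable P" "X' j \<in> borel_measurable P'" for j
    by (cases j; simp add: X_def X'_def)+
  have lin: "(\<Sum>j\<in>K. g j * X j \<omega>) = Re (\<Sum>i\<in>I. Complex (g (i, True)) (- g (i, False)) * Z i \<omega>)"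
    and lin': "(\<Sum>j\<in>K. g j * X' j \<omega>') = Re (\<Sum>i\<in>I. Complex (g (i, True)) (- g (i, False)) * Z' i \<omega>')"
    for g \<omega> \<omega>'
    unfolding K_def UNIV_bool
    by (subst sum.cartesian_product'; simp add: X_def X'_def add.commute)+
  have jc: "joint_char P K X g = joint_char P' K X' g" for g
    unfolding joint_char_def lin lin' by (rule eq)
  define F where "F x = f (\<lambda>i\<in>I. Complex (x (i, True)) (x (i, False)))" for x :: "'i \<times> bool \<Rightarrow> real"
  have "(\<lambda>x. \<lambda>i\<in>I. complex_of_real (x (i, True)) + \<i> * complex_of_real (x (i, False)))
      \<in> measurable (\<Pi>\<^sub>M j\<in>K. borel) (\<Pi>\<^sub>M i\<in>I. borel)"
    by (intro measurable_restrict borel_measurable_add borel_measurable_times borel_measurable_const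
        borel_measurable_of_real measurable_component_singleton) (auto simp: K_def)
  then have F[measurable]: "F \<in> borel_measurable (\<Pi>\<^sub>M j\<in>K. borel)"
    unfolding F_def by (intro measurable_compose[OF _ f]) (simp add: Complex_eq)
  have "(\<integral>\<^sup>+\<omega>. f (\<lambda>i\<in>I. Z i \<omega>) \<partial>P) = (\<integral>\<^sup>+\<omega>. F (\<lambda>j\<in>K. X j \<omega>) \<partial>P)"
    by (intro nn_integral_cong) (auto simp: F_def K_def X_def intro!: arg_cong[of _ _ f])
  also have "\<dots> = (\<integral>\<^sup>+x. F x \<partial>distr P (\<Pi>\<^sub>M i\<in>K. borel) (\<lambda>\<omega>. \<lambda>i\<in>K. X i \<omega>))"
    by (subst nn_integral_distr) auto
  also have "\<dots> = (\<integral>\<^sup>+x. F x \<partial>distr P' (\<Pi>\<^sub>M i\<in>K. borel) (\<lambda>\<omega>. \<lambda>i\<in>K. X' i \<omega>))"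
    by (subst joint_char_unique[OF P P' K _ _ jc]) auto
  also have "\<dots> = (\<integral>\<^sup>+\<omega>. F (\<lambda>j\<in>K. X' j \<omega>) \<partial>P')"
    by (subst nn_integral_distr) auto
  also have "\<dots> = (\<integral>\<^sup>+\<omega>. f (\<lambda>i\<in>I. Z' i \<omega>) \<partial>P')"
    by (intro nn_integral_cong) (auto simp: F_def K_def X'_def intro!: arg_cong[of _ _ f])
  finally show ?thesis .
qed

section \<open>Gaussian exponential moments\<close>

lemma nn_integral_normal_density:
  assumes "0 < \<sigma>"
  shows "(\<integral>\<^sup>+x. ennreal (normal_density \<mu> \<sigma> x) \<partial>lborel) = 1"
proof -
  interpret prob_space "density lborel (\<lambda>x. ennreal (normal_density \<mu> \<sigma> x))"
    by (rule prob_space_normal_density[OF assms])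
  show ?thesis using emeasure_space_1 by (simp add: emeasure_density cong: nn_integral_cong)
qed

lemma std_normal_mgf: "(\<integral>\<^sup>+x. ennreal (exp (c * x)) \<partial>std_normal) = ennreal (exp (c\<^sup>2 / 2))"
proof -
  have "std_normal_density x * exp (c * x) = exp (c\<^sup>2 / 2) * normal_density c 1 x" for x
  proof -
    have "exp (- x\<^sup>2 / 2) * exp (c * x) = exp (c\<^sup>2 / 2) * exp (- (x - c)\<^sup>2 / 2)"
      by (simp add: exp_add[symmetric] power2_eq_square field_simps)
    then show ?thesis by (simp add: normal_density_def)
  qed
  then have "(\<integral>\<^sup>+x. ennreal (exp (c * x)) \<partial>std_normal) =
      (\<integral>\<^sup>+x. ennreal (exp (c\<^sup>2 / 2)) * ennreal (normal_density c 1 x) \<partial>lborel)"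
    by (subst nn_integral_density) (auto simp: ennreal_mult'[symmetric])
  also have "\<dots> = ennreal (exp (c\<^sup>2 / 2))"
    by (subst nn_integral_cmult) (auto simp: nn_integral_normal_density)
  finally show ?thesis .
qed

lemma std_normal_exp_square:
  assumes "b < 1 / 2"
  shows "(\<integral>\<^sup>+x. ennreal (exp (b * x\<^sup>2)) \<partial>std_normal) = ennreal (1 / sqrt (1 - 2 * b))"
proof -
  \<comment> \<open>The standard deviation of the normal density proportional to
    \<open>exp (- (1 - 2 * b) * x\<^sup>2 / 2)\<close>.\<close>
  define \<tau> where "\<tau> = 1 / sqrt (1 - 2 * b)"
  have \<tau>: "\<tau> > 0" "\<tau>\<^sup>2 = 1 / (1 - 2 * b)" using assms by (simp_all add: \<tau>_def power_divide)
  have "std_normal_density x * exp (b * x\<^sup>2) = \<tau> * normal_density 0 \<tau> x" for x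
  proof -
    have "exp (- x\<^sup>2 / 2) * exp (b * x\<^sup>2) = exp (- x\<^sup>2 / (2 * \<tau>\<^sup>2))"
      unfolding \<tau>(2) exp_add[symmetric] using assms by (simp add: field_simps)
    moreover have "sqrt (2 * pi * \<tau>\<^sup>2) = sqrt (2 * pi) * \<tau>" using \<tau>(1) by (simp only: real_sqrt_mult real_sqrt_abs abs_of_pos)
    ultimately show ?thesis using \<tau>(1) by (simp add: normal_density_def)
  qed
  then have "(\<integral>\<^sup>+x. ennreal (exp (b * x\<^sup>2)) \<partial>std_normal) =
      (\<integral>\<^sup>+x. ennreal \<tau> * ennreal (normal_density 0 \<tau> x) \<partial>lborel)"
    using \<tau> by (subst nn_integral_density) (auto simp: ennreal_mult'[symmetric])
  also have "\<dots> = ennreal \<tau>"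
    by (subst nn_integral_cmult) (auto simp: nn_integral_normal_density \<tau>)
  finally show ?thesis by (simp add: \<tau>_def)
qed

lemma prob_space_std_normal: "prob_space std_normal"
  by (rule prob_space_normal_density) simp

lemma nn_integral_complex_gaussian:
  assumes [measurable]: "f \<in> borel_measurable borel"
  shows "(\<integral>\<^sup>+z. f z \<partial>complex_gaussian v) =
    (\<integral>\<^sup>+x. \<integral>\<^sup>+y. f (complex_of_real (sqrt (v / 2)) * Complex x y) \<partial>std_normal \<partial>std_normal)"
proof -
  interpret prob_space std_normal by (rule prob_space_std_normal)
  have [measurable]: "(\<lambda>p. complex_of_real (sqrt (v / 2)) * Complex (fst p) (snd p))
      \<in> borel_measurable (std_normal \<Otimes>\<^sub>M std_normal)"
    unfolding Complex_eq by measurable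
  show ?thesis unfolding complex_gaussian_def case_prod_beta
    by (subst nn_integral_distr) (auto simp: nn_integral_fst[symmetric])
qed

lemma prob_space_complex_gaussian: "prob_space (complex_gaussian v)"
proof -
  interpret prob_space std_normal by (rule prob_space_std_normal)
  interpret p: pair_prob_space std_normal std_normal ..
  show ?thesis unfolding complex_gaussian_def case_prod_beta Complex_eq
    by (rule p.prob_space_distr) measurable
qed

lemma sets_complex_gaussian [measurable_cong]: "sets (complex_gaussian v) = sets borel"
  by (simp add: complex_gaussian_def)

text \<open>Real and imaginary parts each have variance \<open>v / 2\<close>, so
  \<open>Re (a * z)\<close> has variance \<open>v * (cmod a)\<^sup>2 / 2\<close>. This is the origin
  of the 4 in all later exponents.\<close>

lemma complex_gaussian_mgf:
  assumes "v \<ge> 0"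
  shows "(\<integral>\<^sup>+z. ennreal (exp (Re (a * z))) \<partial>complex_gaussian v) = ennreal (exp (v * (cmod a)\<^sup>2 / 4))"
proof -
  define s where "s = sqrt (v / 2)"
  have s: "s\<^sup>2 = v / 2" using assms by (simp add: s_def)
  have "ennreal (exp (Re (a * (complex_of_real s * Complex x y)))) =
      ennreal (exp ((s * Re a) * x)) * ennreal (exp ((- s * Im a) * y))" for x y
    by (subst ennreal_mult[symmetric]) (auto simp: exp_add[symmetric] algebra_simps)
  then have "(\<integral>\<^sup>+z. ennreal (exp (Re (a * z))) \<partial>complex_gaussian v) =
     (\<integral>\<^sup>+x. \<integral>\<^sup>+y. ennreal (exp ((s * Re a) * x)) * ennreal (exp ((- s * Im a) * y)) \<partial>std_normal \<partial>std_normal)"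
    by (subst nn_integral_complex_gaussian) (auto simp: s_def)
  also have "\<dots> = ennreal (exp ((s * Re a)\<^sup>2 / 2)) * ennreal (exp ((- s * Im a)\<^sup>2 / 2))"
    by (subst nn_integral_cmult, simp, subst nn_integral_multc, simp) (simp only: std_normal_mgf)
  also have "\<dots> = ennreal (exp (v * (cmod a)\<^sup>2 / 4))"
    by (subst ennreal_mult[symmetric]) (auto simp: exp_add[symmetric] power_mult_distrib s cmod_power2 algebra_simps add_divide_distrib)
  finally show ?thesis .
qed

text \<open>The squared modulus is exponentially distributed with mean 1.\<close>

lemma complex_gaussian_exp_square:
  assumes "b < 1"
  shows "(\<integral>\<^sup>+z. ennreal (exp (b * (cmod z)\<^sup>2)) \<partial>complex_gaussian 1) = ennreal (1 / (1 - b))"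
proof -
  have "ennreal (exp (b * (cmod (complex_of_real (sqrt (1 / 2)) * Complex x y))\<^sup>2)) =
      ennreal (exp (b / 2 * x\<^sup>2)) * ennreal (exp (b / 2 * y\<^sup>2))" for x y
    by (subst ennreal_mult[symmetric])
      (auto simp: exp_add[symmetric] norm_mult power_mult_distrib cmod_power2 power_divide algebra_simps add_divide_distrib)
  then have "(\<integral>\<^sup>+z. ennreal (exp (b * (cmod z)\<^sup>2)) \<partial>complex_gaussian 1) =
     (\<integral>\<^sup>+x. \<integral>\<^sup>+y. ennreal (exp (b / 2 * x\<^sup>2)) * ennreal (exp (b / 2 * y\<^sup>2)) \<partial>std_normal \<partial>std_normal)"
    by (subst nn_integral_complex_gaussian) auto
  also have "\<dots> = ennreal (1 / sqrt (1 - b)) * ennreal (1 / sqrt (1 - b))"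
    using assms std_normal_exp_square[of "b / 2"]
    by (subst nn_integral_cmult, simp, subst nn_integral_multc, simp) simp
  also have "\<dots> = ennreal (1 / (1 - b))"
    using assms by (subst ennreal_mult[symmetric]) auto
  finally show ?thesis .
qed

lemma std_normal_char: "(\<integral>x. iexp (t * x) \<partial>std_normal) = complex_of_real (exp (- t\<^sup>2 / 2))"
  using fun_cong[OF char_std_normal_distribution, of t] by (simp add: char_def)

lemma complex_gaussian_char:
  assumes "v \<ge> 0"
  shows "(\<integral>z. iexp (Re (a * z)) \<partial>complex_gaussian v) = complex_of_real (exp (- v * (cmod a)\<^sup>2 / 4))"
proof -
  interpret prob_space std_normal by (rule prob_space_std_normal)
  interpret p: pair_prob_space std_normal std_normal ..
  define s where "s = sqrt (v / 2)"
  have s: "s\<^sup>2 = v / 2" using assms by (simp add: s_def)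
  have e: "iexp (Re (a * (complex_of_real s * Complex x y))) =
      iexp ((s * Re a) * x) * iexp ((- s * Im a) * y)" for x y
    by (simp add: exp_add[symmetric] algebra_simps)
  have [measurable]: "(\<lambda>p. complex_of_real s * Complex (fst p) (snd p))
      \<in> borel_measurable (std_normal \<Otimes>\<^sub>M std_normal)"
    unfolding Complex_eq by measurable
  have "(\<integral>z. iexp (Re (a * z)) \<partial>complex_gaussian v) =
     (\<integral>p. iexp ((s * Re a) * fst p) * iexp ((- s * Im a) * snd p) \<partial>(std_normal \<Otimes>\<^sub>M std_normal))"
    unfolding complex_gaussian_def case_prod_beta s_def[symmetric]
    by (subst integral_distr) (simp_all only: e, measurable)
  also have "\<dots> = (\<integral>x. iexp ((s * Re a) * x) \<partial>std_normal) * (\<integral>y. iexp ((- s * Im a) * y) \<partial>std_normal)"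
  proof (subst p.integral_fst'[symmetric])
    show "integrable (std_normal \<Otimes>\<^sub>M std_normal) (\<lambda>p. iexp ((s * Re a) * fst p) * iexp ((- s * Im a) * snd p))"
      by (rule p.integrable_const_bound[of _ 1]) (auto simp: norm_mult)
  qed simp
  also have "\<dots> = complex_of_real (exp (- v * (cmod a)\<^sup>2 / 4))"
    unfolding std_normal_char of_real_mult[symmetric]
    by (auto simp: exp_add[symmetric] power_mult_distrib s cmod_power2 algebra_simps add_divide_distrib)
  finally show ?thesis .
qed

lemma real_gaussian_char:
  "(\<integral>x. iexp (t * x) \<partial>real_gaussian m s) = iexp (t * m) * complex_of_real (exp (- (s * t)\<^sup>2 / 2))"
proof -
  have "(\<integral>x. iexp (t * x) \<partial>real_gaussian m s) = (\<integral>x. iexp (t * m) * iexp ((s * t) * x) \<partial>std_normal)"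
    unfolding real_gaussian_def
    by (subst integral_distr) (auto simp: exp_add[symmetric] algebra_simps)
  then show ?thesis by (simp only: integral_mult_right_zero std_normal_char)
qed

lemma real_gaussian_mgf:
  "(\<integral>\<^sup>+x. ennreal (exp x) \<partial>real_gaussian 0 s) = ennreal (exp (s\<^sup>2 / 2))"
  unfolding real_gaussian_def by (subst nn_integral_distr) (auto simp: std_normal_mgf)

lemma real_gaussian_moments:
  "integrable (real_gaussian m s) (\<lambda>x. x)" "(\<integral>x. x \<partial>real_gaussian m s) = m"
  "integrable (real_gaussian m s) (\<lambda>x. x\<^sup>2)" "(\<integral>x. x\<^sup>2 \<partial>real_gaussian m s) = m\<^sup>2 + s\<^sup>2"
proof -
  interpret prob_space std_normal by (rule prob_space_std_normal)
  have i1: "integrable std_normal (\<lambda>x. x)" and e1: "(\<integral>x. x \<partial>std_normal) = 0"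
    using integrable_std_normal_distribution_moment[of 1] integral_std_normal_distribution_moment_odd[of 1] by simp_all
  have i2: "integrable std_normal (\<lambda>x. x\<^sup>2)" and e2: "(\<integral>x. x\<^sup>2 \<partial>std_normal) = 1"
    using integrable_std_normal_distribution_moment[of 2] std_normal_distribution_even_moments[of 1] by (simp_all add: fact_numeral)
  have sq: "(m + s * x)\<^sup>2 = m\<^sup>2 + (2 * m * s) * x + s\<^sup>2 * x\<^sup>2" for x
    by (simp add: power2_eq_square algebra_simps)
  show "integrable (real_gaussian m s) (\<lambda>x. x)"
    unfolding real_gaussian_def by (subst integrable_distr_eq) (auto intro!: i1)
  show "(\<integral>x. x \<partial>real_gaussian m s) = m"
    unfolding real_gaussian_def by (subst integral_distr) (auto simp: i1 e1 prob_space[simplified])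
  show "integrable (real_gaussian m s) (\<lambda>x. x\<^sup>2)"
    unfolding real_gaussian_def by (subst integrable_distr_eq) (auto simp: sq intro!: Bochner_Integration.integrable_add integrable_mult_right i1 i2)
  show "(\<integral>x. x\<^sup>2 \<partial>real_gaussian m s) = m\<^sup>2 + s\<^sup>2"
    unfolding real_gaussian_def by (subst integral_distr) (auto simp: sq i1 i2 e1 e2 prob_space[simplified])
qed

section \<open>Exponential moments of independent standard complex Gaussian variables\<close>

abbreviation iid_complex_gaussian :: "'j set \<Rightarrow> ('j \<Rightarrow> complex) measure" where
  "iid_complex_gaussian J \<equiv> \<Pi>\<^sub>M s\<in>J. complex_gaussian 1"

lemma prod_ennreal_exp:
  assumes "finite A"
  shows "(\<Prod>i\<in>A. ennreal (exp (f i))) = ennreal (exp (\<Sum>i\<in>A. f i))"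
  using assms by (simp add: exp_sum prod_ennreal)

lemma product_prob_space_complex_gaussian: "product_prob_space (\<lambda>_. complex_gaussian 1)"
  by (intro product_prob_spaceI prob_space_complex_gaussian)

lemma prob_space_iid_complex_gaussian: "prob_space (iid_complex_gaussian J)"
  by (intro prob_space_PiM prob_space_complex_gaussian)

lemma borel_measurable_cnj_comp [measurable (raw)]:
  "f \<in> borel_measurable M \<Longrightarrow> (\<lambda>x. cnj (f x)) \<in> borel_measurable M"
  by (rule measurable_compose[OF _ borel_measurable_continuous_onI[OF continuous_on_cnj[OF continuous_on_id]]])

lemma iid_complex_gaussian_mgf:
  assumes J: "finite J"
  shows "(\<integral>\<^sup>+x. ennreal (exp (Re (\<Sum>s\<in>J. a s * x s))) \<partial>iid_complex_gaussian J) =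
    ennreal (exp ((\<Sum>s\<in>J. (cmod (a s))\<^sup>2) / 4))"
proof -
  interpret product_prob_space "\<lambda>_. complex_gaussian 1" by (rule product_prob_space_complex_gaussian)
  have "(\<integral>\<^sup>+x. ennreal (exp (Re (\<Sum>s\<in>J. a s * x s))) \<partial>iid_complex_gaussian J) =
      (\<integral>\<^sup>+x. (\<Prod>s\<in>J. ennreal (exp (Re (a s * x s)))) \<partial>iid_complex_gaussian J)"
    using J by (simp add: prod_ennreal_exp)
  also have "\<dots> = (\<Prod>s\<in>J. \<integral>\<^sup>+z. ennreal (exp (Re (a s * z))) \<partial>complex_gaussian 1)"
    using J by (intro product_nn_integral_prod) auto
  also have "\<dots> = ennreal (exp ((\<Sum>s\<in>J. (cmod (a s))\<^sup>2) / 4))"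
    using J by (simp add: complex_gaussian_mgf prod_ennreal_exp sum_divide_distrib del: times_complex.sel)
  finally show ?thesis .
qed

text \<open>The square in the exponent is linearised by an auxiliary Gaussian variable
  (Hubbard--Stratonovich), so that only linear exponential moments are integrated.\<close>

lemma iid_complex_gaussian_exp_square:
  assumes J: "finite J" and c: "0 \<le> c" "c * (\<Sum>s\<in>J. (cmod (b s))\<^sup>2) < 1"
  shows "(\<integral>\<^sup>+x. ennreal (exp (c * (cmod (\<Sum>s\<in>J. b s * x s))\<^sup>2)) \<partial>iid_complex_gaussian J) =
    ennreal (1 / (1 - c * (\<Sum>s\<in>J. (cmod (b s))\<^sup>2)))"
proof -
  interpret P: prob_space "iid_complex_gaussian J" by (rule prob_space_iid_complex_gaussian)
  interpret C: prob_space "complex_gaussian 1" by (rule prob_space_complex_gaussian)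
  interpret pair_sigma_finite "iid_complex_gaussian J" "complex_gaussian 1" ..
  \<comment> \<open>The factor \<open>2 * sqrt c\<close> cancels the 4 of the moment formula.
    Conjugation leaves the real part unchanged and shows the exponent as linear in \<open>x\<close>
    with coefficients depending on \<open>z\<close>.\<close>
  have lin: "Re ((complex_of_real (2 * sqrt c) * cnj (\<Sum>s\<in>J. b s * x s)) * z) =
      Re (\<Sum>s\<in>J. (complex_of_real (2 * sqrt c) * cnj z * b s) * x s)" for x z
  proof -
    have "(\<Sum>s\<in>J. (complex_of_real (2 * sqrt c) * cnj z * b s) * x s) =
        cnj ((complex_of_real (2 * sqrt c) * cnj (\<Sum>s\<in>J. b s * x s)) * z)"
      by (simp add: sum_distrib_left mult_ac)
    then show ?thesis by (simp only: cnj.sel)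
  qed
  have [measurable]: "(\<lambda>(x, z). ennreal (exp (Re ((complex_of_real (2 * sqrt c) * cnj (\<Sum>s\<in>J. b s * x s)) * z))))
     \<in> borel_measurable (iid_complex_gaussian J \<Otimes>\<^sub>M complex_gaussian 1)"
    by measurable
  have "(\<integral>\<^sup>+x. ennreal (exp (c * (cmod (\<Sum>s\<in>J. b s * x s))\<^sup>2)) \<partial>iid_complex_gaussian J) =
    (\<integral>\<^sup>+x. \<integral>\<^sup>+z. ennreal (exp (Re ((complex_of_real (2 * sqrt c) * cnj (\<Sum>s\<in>J. b s * x s)) * z)))
       \<partial>complex_gaussian 1 \<partial>iid_complex_gaussian J)"
    using c by (subst complex_gaussian_mgf)
      (simp_all add: norm_mult power_mult_distrib del: cnj_sum complex_cnj_mult)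
  also have "\<dots> = (\<integral>\<^sup>+z. \<integral>\<^sup>+x. ennreal (exp (Re ((complex_of_real (2 * sqrt c) * cnj (\<Sum>s\<in>J. b s * x s)) * z)))
       \<partial>iid_complex_gaussian J \<partial>complex_gaussian 1)"
    by (rule Fubini'[symmetric]) measurable
  also have "\<dots> = (\<integral>\<^sup>+z. ennreal (exp ((c * (\<Sum>s\<in>J. (cmod (b s))\<^sup>2)) * (cmod z)\<^sup>2)) \<partial>complex_gaussian 1)"
    unfolding lin using c
    by (subst iid_complex_gaussian_mgf[OF J])
      (simp add: norm_mult power_mult_distrib sum_distrib_left[symmetric] mult_ac)
  also have "\<dots> = ennreal (1 / (1 - c * (\<Sum>s\<in>J. (cmod (b s))\<^sup>2)))"
    using c by (intro complex_gaussian_exp_square)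
  finally show ?thesis .
qed

text \<open>\<open>(1 + 2 * x) * (1 - x) = 1 + x * (1 - 2 * x)\<close> is at least 1 on this
  interval. The factor 2 and the limit 1/2 in the bounds for exponential moments come from
  here.\<close>

lemma inverse_one_minus_le_exp:
  fixes x :: real
  assumes "0 \<le> x" "x \<le> 1 / 2"
  shows "1 / (1 - x) \<le> exp (2 * x)"
proof -
  have "1 \<le> (1 + 2 * x) * (1 - x)" using assms by (simp add: algebra_simps) (use mult_mono[of x "1/2" x x] in linarith)
  also have "\<dots> \<le> exp (2 * x) * (1 - x)"
    using assms by (intro mult_right_mono exp_ge_add_one_self) auto
  finally show ?thesis using assms by (simp add: divide_simps)
qed

text \<open>The linear forms for different \<open>t\<close> are correlated, so the exponential does
  not factorise over \<open>t\<close>; the exact value involves a determinant. Convexity reduces the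
  sum to one form at a time and leaves only the trace, that is, the squared Frobenius norm of
  \<open>B\<close>.\<close>

lemma iid_complex_gaussian_exp_sum_squares_le:
  fixes B :: "'j \<Rightarrow> 'j \<Rightarrow> complex"
  assumes J: "finite J" and c: "0 \<le> c" "c * (\<Sum>t\<in>J. \<Sum>s\<in>J. (cmod (B s t))\<^sup>2) \<le> 1 / 2"
  shows "(\<integral>\<^sup>+x. ennreal (exp (c * (\<Sum>t\<in>J. (cmod (\<Sum>s\<in>J. B s t * x s))\<^sup>2))) \<partial>iid_complex_gaussian J)
    \<le> ennreal (exp (2 * (c * (\<Sum>t\<in>J. \<Sum>s\<in>J. (cmod (B s t))\<^sup>2))))"
proof -
  interpret P: prob_space "iid_complex_gaussian J" by (rule prob_space_iid_complex_gaussian)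
  define F where "F t = (\<Sum>s\<in>J. (cmod (B s t))\<^sup>2)" for t
  define G where "G = (\<Sum>t\<in>J. F t)"
  have F0: "F t \<ge> 0" for t by (auto simp: F_def intro: sum_nonneg)
  have G0: "G \<ge> 0" unfolding G_def by (intro sum_nonneg F0)
  have cG: "c * G \<le> 1 / 2" using c by (simp add: G_def F_def)
  \<comment> \<open>Covers the weights that are 0 below: there \<open>c / w t\<close> is a division
    by zero, harmless because the form itself vanishes.\<close>
  have Z0: "(\<Sum>s\<in>J. B s t * x s) = 0" if "F t = 0" for t and x :: "'j \<Rightarrow> complex"
  proof -
    have "\<forall>s\<in>J. B s t = 0"
      using that J by (simp add: F_def sum_nonneg_eq_0_iff)
    then show ?thesis by simp
  qed
  show ?thesis
  proof (cases "G = 0")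
    case True
    then have Ft: "\<forall>t\<in>J. F t = 0" using J F0 by (simp add: G_def sum_nonneg_eq_0_iff)
    have "(\<integral>\<^sup>+x. ennreal (exp (c * (\<Sum>t\<in>J. (cmod (\<Sum>s\<in>J. B s t * x s))\<^sup>2))) \<partial>iid_complex_gaussian J) =
       (\<integral>\<^sup>+x. 1 \<partial>iid_complex_gaussian J)"
      using Z0 Ft by (intro nn_integral_cong) simp
    also have "\<dots> \<le> ennreal (exp (2 * (c * G)))"
      using c G0 by (simp add: P.emeasure_space_1)
    finally show ?thesis by (simp add: G_def F_def)
  next
    case False
    with G0 have G: "G > 0" by simp
    define w where "w t = F t / G" for t
    have w0: "w t \<ge> 0" for t using F0 G by (simp add: w_def)
    have w1: "(\<Sum>t\<in>J. w t) = 1" using G by (simp add: w_def G_def[symmetric] flip: sum_divide_distrib)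
    \<comment> \<open>Jensen with weights proportional to the variances makes all summands have the same
      exponential moment, whatever their joint law.\<close>
    have "exp (c * (\<Sum>t\<in>J. (cmod (\<Sum>s\<in>J. B s t * x s))\<^sup>2)) \<le>
      (\<Sum>t\<in>J. w t * exp (c / w t * (cmod (\<Sum>s\<in>J. B s t * x s))\<^sup>2))" for x
    proof -
      have "c * (\<Sum>t\<in>J. (cmod (\<Sum>s\<in>J. B s t * x s))\<^sup>2) =
          (\<Sum>t\<in>J. w t *\<^sub>R (c / w t * (cmod (\<Sum>s\<in>J. B s t * x s))\<^sup>2))"
        unfolding sum_distrib_left
      proof (intro sum.cong refl)
        fix t assume "t \<in> J"
        show "c * (cmod (\<Sum>s\<in>J. B s t * x s))\<^sup>2 = w t *\<^sub>R (c / w t * (cmod (\<Sum>s\<in>J. B s t * x s))\<^sup>2)"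
          using Z0[of t] G by (cases "F t = 0") (auto simp: w_def)
      qed
      also have "exp \<dots> \<le> (\<Sum>t\<in>J. w t * exp (c / w t * (cmod (\<Sum>s\<in>J. B s t * x s))\<^sup>2))"
        using J w0 w1 False
        by (intro convex_on_sum[OF _ _ exp_convex]) (auto simp: G_def)
      finally show ?thesis .
    qed
    then have "(\<integral>\<^sup>+x. ennreal (exp (c * (\<Sum>t\<in>J. (cmod (\<Sum>s\<in>J. B s t * x s))\<^sup>2))) \<partial>iid_complex_gaussian J)
      \<le> (\<integral>\<^sup>+x. (\<Sum>t\<in>J. ennreal (w t) * ennreal (exp (c / w t * (cmod (\<Sum>s\<in>J. B s t * x s))\<^sup>2))) \<partial>iid_complex_gaussian J)"
      using w0 by (intro nn_integral_mono) (simp add: ennreal_mult'[symmetric] ennreal_leI)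
    also have "\<dots> = (\<Sum>t\<in>J. ennreal (w t) * (\<integral>\<^sup>+x. ennreal (exp (c / w t * (cmod (\<Sum>s\<in>J. B s t * x s))\<^sup>2)) \<partial>iid_complex_gaussian J))"
      by (subst nn_integral_sum) (auto simp: nn_integral_cmult)
    also have "\<dots> \<le> (\<Sum>t\<in>J. ennreal (w t) * ennreal (1 / (1 - c * G)))"
    proof (rule sum_mono)
      fix t assume t: "t \<in> J"
      show "ennreal (w t) * (\<integral>\<^sup>+x. ennreal (exp (c / w t * (cmod (\<Sum>s\<in>J. B s t * x s))\<^sup>2)) \<partial>iid_complex_gaussian J)
        \<le> ennreal (w t) * ennreal (1 / (1 - c * G))"
      proof (cases "F t = 0")
        case True
        then show ?thesis by (simp add: w_def)
      next
        case Fn: False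
        have "c / w t * F t = c * G" using Fn G by (simp add: w_def)
        then have "(\<integral>\<^sup>+x. ennreal (exp (c / w t * (cmod (\<Sum>s\<in>J. B s t * x s))\<^sup>2)) \<partial>iid_complex_gaussian J)
          = ennreal (1 / (1 - c * G))"
          using iid_complex_gaussian_exp_square[OF J, of "c / w t" "\<lambda>s. B s t"] c w0[of t] cG
          by (simp add: F_def)
        then show ?thesis by simp
      qed
    qed
    also have "\<dots> = ennreal (1 / (1 - c * G))"
      using w0 w1 by (simp add: sum_distrib_right[symmetric])
    also have "\<dots> \<le> ennreal (exp (2 * (c * G)))"
      using c cG G0 by (intro ennreal_leI inverse_one_minus_le_exp) auto
    finally show ?thesis by (simp add: G_def F_def)
  qed
qed

section \<open>Quadratic forms in circular Gaussian arrays\<close>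

text \<open>The variance \<open>E |\<Sum> g t * Y t|\<^sup>2\<close> when \<open>S s t\<close> is
  the covariance \<open>E (Y s * cnj (Y t))\<close>. The sum is real for Hermitian \<open>S\<close>;
  \<open>Re\<close> only fixes the type.\<close>

definition cov_form :: "'j set \<Rightarrow> ('j \<Rightarrow> 'j \<Rightarrow> complex) \<Rightarrow> ('j \<Rightarrow> complex) \<Rightarrow> real" where
  "cov_form J S g = Re (\<Sum>s\<in>J. \<Sum>t\<in>J. g s * cnj (g t) * S s t)"

lemma Re_of_real_mult: "Re (complex_of_real c * z) = c * Re z"
  by simp

lemma cov_form_scale: "cov_form J S (\<lambda>t. c * g t) = (cmod c)\<^sup>2 * cov_form J S g"
proof -
  have "c * g s * cnj (c * g t) * S s t = complex_of_real ((cmod c)\<^sup>2) * (g s * cnj (g t) * S s t)" for s t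
    by (simp only: complex_norm_square complex_cnj_mult mult_ac)
  then show ?thesis
    unfolding cov_form_def by (simp only: sum_distrib_left[symmetric] Re_of_real_mult)
qed

text \<open>The parallelogram law of a sesquilinear form. It says that rotating a pair of
  independent copies by 45 degrees preserves the exponent of their joint characteristic
  function.\<close>

lemma cov_form_parallelogram:
  "cov_form J S (\<lambda>t. (g t + g' t) / complex_of_real (sqrt 2)) +
    cov_form J S (\<lambda>t. (g t - g' t) / complex_of_real (sqrt 2)) = cov_form J S g + cov_form J S g'"
proof -
  have r: "complex_of_real (sqrt 2) * complex_of_real (sqrt 2) = 2"
    by (simp flip: of_real_mult)
  have p: "((a + b) / complex_of_real (sqrt 2)) * cnj ((c + d) / complex_of_real (sqrt 2)) * e
    + ((a - b) / complex_of_real (sqrt 2)) * cnj ((c - d) / complex_of_real (sqrt 2)) * e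
    = a * cnj c * e + b * cnj d * e" for a b c d e
    by (simp add: times_divide_times_eq r add_divide_distrib[symmetric] algebra_simps)
  show ?thesis
    unfolding cov_form_def plus_complex.sel(1)[symmetric] sum.distrib[symmetric] p ..
qed

text \<open>\<open>char_eq\<close> encodes several facts at once: joint Gaussianity with mean 0,
  independence over \<open>n\<close> (the exponents add up), and circularity (the coefficients enter
  only through a sesquilinear form). The number \<open>k\<close> bounds the largest eigenvalue of
  the covariance matrix of one sensor.\<close>

locale circular_gaussian_array = prob_space M
  for M :: "'a measure" +
  fixes N :: nat and J :: "'j set" and Y :: "nat \<Rightarrow> 'j \<Rightarrow> 'a \<Rightarrow> complex"
    and S :: "'j \<Rightarrow> 'j \<Rightarrow> complex" and k :: real
  assumes finite_J: "finite J"
    and Y_measurable [measurable]: "\<And>n t. Y n t \<in> borel_measurable M"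
    and S_herm: "\<And>s t. S t s = cnj (S s t)"
    and char_eq: "\<And>g. expectation (\<lambda>\<omega>. iexp (Re (\<Sum>n<N. \<Sum>t\<in>J. g n t * Y n t \<omega>))) =
      complex_of_real (exp (- (\<Sum>n<N. cov_form J S (g n)) / 4))"
    and cov_form_le: "\<And>g. cov_form J S g \<le> k * (\<Sum>t\<in>J. (cmod (g t))\<^sup>2)"
begin

section \<open>Laws of linear combinations and second moments of an array\<close>

definition lin :: "(nat \<Rightarrow> 'j \<Rightarrow> complex) \<Rightarrow> 'a \<Rightarrow> complex" where
  "lin g \<omega> = (\<Sum>n<N. \<Sum>t\<in>J. g n t * Y n t \<omega>)"

lemma lin_measurable [measurable]: "lin g \<in> borel_measurable M"
  unfolding lin_def by measurable

lemma lin_scale: "lin (\<lambda>n t. c * g n t) \<omega> = c * lin g \<omega>"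
  by (simp add: lin_def sum_distrib_left mult_ac)

definition var :: "(nat \<Rightarrow> 'j \<Rightarrow> complex) \<Rightarrow> real" where
  "var g = (\<Sum>n<N. cov_form J S (g n))"

lemma var_scale: "var (\<lambda>n t. c * g n t) = (cmod c)\<^sup>2 * var g"
  by (simp add: var_def cov_form_scale sum_distrib_left)

lemma char_lin: "expectation (\<lambda>\<omega>. iexp (Re (lin g \<omega>))) = complex_of_real (exp (- var g / 4))"
  unfolding lin_def var_def by (rule char_eq)

lemma var_nonneg: "var g \<ge> 0"
proof -
  have "cmod (expectation (\<lambda>\<omega>. iexp (Re (lin g \<omega>)))) \<le> expectation (\<lambda>\<omega>. cmod (iexp (Re (lin g \<omega>))))"
    by (rule integral_norm_bound)
  then show ?thesis unfolding char_lin by (simp add: prob_space)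
qed

text \<open>Scaling the coefficients by a real \<open>t\<close> gives the characteristic function of
  \<open>Re (lin g)\<close> at every \<open>t\<close>. The real part carries half of the variance
  \<open>var g\<close>.\<close>

lemma distr_lin: "distr M borel (\<lambda>\<omega>. Re (lin g \<omega>)) = real_gaussian 0 (sqrt (var g / 2))"
proof (rule Levy_uniqueness)
  show "real_distribution (distr M borel (\<lambda>\<omega>. Re (lin g \<omega>)))"
    by (rule real_distribution_distr) measurable
  interpret P: prob_space std_normal by (rule prob_space_std_normal)
  show "real_distribution (real_gaussian 0 (sqrt (var g / 2)))"
    unfolding real_gaussian_def by (rule P.real_distribution_distr) measurable
  show "char (distr M borel (\<lambda>\<omega>. Re (lin g \<omega>))) = char (real_gaussian 0 (sqrt (var g / 2)))"
  proof
    fix t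
    have "char (distr M borel (\<lambda>\<omega>. Re (lin g \<omega>))) t = expectation (\<lambda>\<omega>. iexp (t * Re (lin g \<omega>)))"
      unfolding char_def by (subst integral_distr) auto
    also have "\<dots> = expectation (\<lambda>\<omega>. iexp (Re (lin (\<lambda>n s. complex_of_real t * g n s) \<omega>)))"
      by (simp only: lin_scale Re_of_real_mult)
    also have "\<dots> = complex_of_real (exp (- (t\<^sup>2 * var g) / 4))"
      unfolding char_lin by (simp only: var_scale norm_of_real power2_abs)
    also have "\<dots> = char (real_gaussian 0 (sqrt (var g / 2))) t"
      unfolding char_def real_gaussian_char using var_nonneg[of g]
      by (simp add: power_mult_distrib mult.commute)
    finally show "char (distr M borel (\<lambda>\<omega>. Re (lin g \<omega>))) t = char (real_gaussian 0 (sqrt (var g / 2))) t" .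
  qed
qed

lemma mgf_lin: "(\<integral>\<^sup>+\<omega>. ennreal (exp (Re (lin g \<omega>))) \<partial>M) = ennreal (exp (var g / 4))"
proof -
  have "(\<integral>\<^sup>+\<omega>. ennreal (exp (Re (lin g \<omega>))) \<partial>M) = (\<integral>\<^sup>+x. ennreal (exp x) \<partial>distr M borel (\<lambda>\<omega>. Re (lin g \<omega>)))"
    by (subst nn_integral_distr) auto
  also have "\<dots> = ennreal (exp (var g / 4))"
    unfolding distr_lin real_gaussian_mgf using var_nonneg[of g] by simp
  finally show ?thesis .
qed

lemma Re_lin_square: "integrable M (\<lambda>\<omega>. (Re (lin g \<omega>))\<^sup>2)" "expectation (\<lambda>\<omega>. (Re (lin g \<omega>))\<^sup>2) = var g / 2"
proof -
  have "integrable (distr M borel (\<lambda>\<omega>. Re (lin g \<omega>))) (\<lambda>x. x\<^sup>2)"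
    unfolding distr_lin by (rule real_gaussian_moments)
  then show "integrable M (\<lambda>\<omega>. (Re (lin g \<omega>))\<^sup>2)"
    by (subst (asm) integrable_distr_eq) auto
  have "expectation (\<lambda>\<omega>. (Re (lin g \<omega>))\<^sup>2) = (\<integral>x. x\<^sup>2 \<partial>distr M borel (\<lambda>\<omega>. Re (lin g \<omega>)))"
    by (subst integral_distr) auto
  then show "expectation (\<lambda>\<omega>. (Re (lin g \<omega>))\<^sup>2) = var g / 2"
    unfolding distr_lin real_gaussian_moments using var_nonneg[of g] by simp
qed

text \<open>The imaginary part is the real part of the combination with coefficients
  \<open>- \<i> * g n t\<close>, whose variance is the same.\<close>

lemma cmod_lin_square: "integrable M (\<lambda>\<omega>. (cmod (lin g \<omega>))\<^sup>2)" "expectation (\<lambda>\<omega>. (cmod (lin g \<omega>))\<^sup>2) = var g"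
proof -
  have "(cmod z)\<^sup>2 = (Re z)\<^sup>2 + (Re (- \<i> * z))\<^sup>2" for z by (simp add: cmod_power2)
  then have e: "(cmod (lin g \<omega>))\<^sup>2 = (Re (lin g \<omega>))\<^sup>2 + (Re (lin (\<lambda>n t. - \<i> * g n t) \<omega>))\<^sup>2" for \<omega>
    unfolding lin_scale by blast
  show "integrable M (\<lambda>\<omega>. (cmod (lin g \<omega>))\<^sup>2)"
    unfolding e by (intro Bochner_Integration.integrable_add Re_lin_square)
  show "expectation (\<lambda>\<omega>. (cmod (lin g \<omega>))\<^sup>2) = var g"
    unfolding e using var_scale[of "- \<i>" g]
    by (subst Bochner_Integration.integral_add) (simp_all add: Re_lin_square)
qed

lemma lin_polarization:
  fixes f g :: "nat \<Rightarrow> 'j \<Rightarrow> complex"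
  shows "integrable M (\<lambda>\<omega>. lin f \<omega> * cnj (lin g \<omega>))"
    "expectation (\<lambda>\<omega>. lin f \<omega> * cnj (lin g \<omega>)) =
      (of_real (var (\<lambda>n t. f n t + g n t)) - of_real (var (\<lambda>n t. f n t - g n t))
       + \<i> * of_real (var (\<lambda>n t. f n t + \<i> * g n t)) - \<i> * of_real (var (\<lambda>n t. f n t - \<i> * g n t))) / 4"
proof -
  have pol: "z * cnj w = (of_real ((cmod (z + w))\<^sup>2) - of_real ((cmod (z - w))\<^sup>2)
    + \<i> * of_real ((cmod (z + \<i> * w))\<^sup>2) - \<i> * of_real ((cmod (z - \<i> * w))\<^sup>2)) / 4" for z w
    unfolding cmod_power2 by (simp add: complex_eq_iff power2_eq_square algebra_simps)
  have l: "lin f \<omega> + lin g \<omega> = lin (\<lambda>n t. f n t + g n t) \<omega>"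
    "lin f \<omega> - lin g \<omega> = lin (\<lambda>n t. f n t - g n t) \<omega>"
    "lin f \<omega> + \<i> * lin g \<omega> = lin (\<lambda>n t. f n t + \<i> * g n t) \<omega>"
    "lin f \<omega> - \<i> * lin g \<omega> = lin (\<lambda>n t. f n t - \<i> * g n t) \<omega>" for \<omega>
    by (simp_all add: lin_def sum.distrib sum_subtractf algebra_simps sum_distrib_left)
  show "integrable M (\<lambda>\<omega>. lin f \<omega> * cnj (lin g \<omega>))"
    unfolding pol l
    by (intro integrable_divide_zero Bochner_Integration.integrable_add Bochner_Integration.integrable_diff
        integrable_mult_right integrable_of_real cmod_lin_square)
  show "expectation (\<lambda>\<omega>. lin f \<omega> * cnj (lin g \<omega>)) =
      (of_real (var (\<lambda>n t. f n t + g n t)) - of_real (var (\<lambda>n t. f n t - g n t))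
       + \<i> * of_real (var (\<lambda>n t. f n t + \<i> * g n t)) - \<i> * of_real (var (\<lambda>n t. f n t - \<i> * g n t))) / 4"
    unfolding pol l
    by (simp only: integral_divide_zero Bochner_Integration.integral_add Bochner_Integration.integral_diff
        integral_mult_right_zero integral_complex_of_real cmod_lin_square
        Bochner_Integration.integrable_add Bochner_Integration.integrable_diff
        integrable_mult_right integrable_of_real)
qed

definition unit :: "nat \<Rightarrow> 'j \<Rightarrow> nat \<Rightarrow> 'j \<Rightarrow> complex" where
  "unit n s = (\<lambda>m u. if m = n \<and> u = s then 1 else 0)"

lemma lin_unit: "n < N \<Longrightarrow> s \<in> J \<Longrightarrow> lin (unit n s) \<omega> = Y n s \<omega>"
proof -
  assume n: "n < N" and s: "s \<in> J"
  have "lin (unit n s) \<omega> = (\<Sum>m<N. if m = n then (\<Sum>t\<in>J. if t = s then Y n s \<omega> else 0) else 0)"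
    unfolding lin_def unit_def by (intro sum.cong refl) (auto intro!: sum.cong sum.neutral)
  then show ?thesis using n s finite_J by simp
qed

lemma var_unit_add:
  assumes n: "n < N" and st: "s \<in> J" "t \<in> J"
  shows "var (\<lambda>m u. unit n s m u + c * unit n t m u) =
    Re (S s s + c * S t s + cnj c * S s t + c * cnj c * S t t)"
proof -
  have "var (\<lambda>m u. unit n s m u + c * unit n t m u) =
      (\<Sum>m<N. if m = n then cov_form J S (\<lambda>u. (if u = s then 1 else 0) + c * (if u = t then 1 else 0)) else 0)"
    unfolding var_def unit_def by (intro sum.cong refl) (auto simp: cov_form_def)
  also have "\<dots> = cov_form J S (\<lambda>u. (if u = s then 1 else 0) + c * (if u = t then 1 else 0))"
    using n by simp
  also have "\<dots> = Re (\<Sum>u\<in>J. \<Sum>v\<in>J. (if u = s then if v = s then S s s else 0 else 0)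
      + (if u = t then if v = s then c * S t s else 0 else 0)
      + (if u = s then if v = t then cnj c * S s t else 0 else 0)
      + (if u = t then if v = t then c * cnj c * S t t else 0 else 0))"
    unfolding cov_form_def by (intro arg_cong[of _ _ Re] sum.cong refl) (auto simp: algebra_simps)
  also have "\<dots> = Re (S s s + c * S t s + cnj c * S s t + c * cnj c * S t t)"
  proof -
    have "(\<Sum>u\<in>J. \<Sum>v\<in>J. (if u = a then if v = b then d else 0 else 0)) = d" if "a \<in> J" "b \<in> J" for a b and d :: complex
    proof -
      have "(\<Sum>v\<in>J. (if u = a then if v = b then d else 0 else 0)) = (if u = a then d else 0)" for u
        using that finite_J by simp
      then show ?thesis using that finite_J by simp
    qed
    then show ?thesis using st by (simp only: sum.distrib)
  qed
  finally show ?thesis .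
qed

text \<open>That \<open>S\<close> is the covariance is not assumed by the locale. It is recovered
  from the variances by polarisation at two unit coefficients; the Hermitian symmetry of
  \<open>S\<close> recombines the four terms.\<close>

lemma second_moment:
  assumes n: "n < N" and st: "s \<in> J" "t \<in> J"
  shows "integrable M (\<lambda>\<omega>. Y n s \<omega> * cnj (Y n t \<omega>))" "expectation (\<lambda>\<omega>. Y n s \<omega> * cnj (Y n t \<omega>)) = S s t"
proof -
  note l = lin_unit[OF n st(1)] lin_unit[OF n st(2)]
  show "integrable M (\<lambda>\<omega>. Y n s \<omega> * cnj (Y n t \<omega>))"
    using lin_polarization(1)[of "unit n s" "unit n t"] by (simp only: l)
  \<comment> \<open>The factors 1 and -1 are written out so that each variance is an instance of
    \<open>var_unit_add\<close>.\<close>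
  have "expectation (\<lambda>\<omega>. Y n s \<omega> * cnj (Y n t \<omega>)) =
      (of_real (var (\<lambda>m u. unit n s m u + 1 * unit n t m u)) - of_real (var (\<lambda>m u. unit n s m u + (-1) * unit n t m u))
       + \<i> * of_real (var (\<lambda>m u. unit n s m u + \<i> * unit n t m u)) - \<i> * of_real (var (\<lambda>m u. unit n s m u + (-\<i>) * unit n t m u))) / 4"
    using lin_polarization(2)[of "unit n s" "unit n t"] unfolding l by simp
  also have "\<dots> = S s t"
    unfolding var_unit_add[OF n st] by (simp add: S_herm[of s t] complex_eq_iff)
  finally show "expectation (\<lambda>\<omega>. Y n s \<omega> * cnj (Y n t \<omega>)) = S s t" .
qed

definition qform :: "('j \<Rightarrow> 'j \<Rightarrow> complex) \<Rightarrow> 'a \<Rightarrow> complex" where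
  "qform A \<omega> = (\<Sum>n<N. \<Sum>s\<in>J. \<Sum>t\<in>J. A s t * (Y n s \<omega> * cnj (Y n t \<omega>)))"

lemma qform_measurable [measurable]: "qform A \<in> borel_measurable M"
  unfolding qform_def by measurable

lemma qform_expectation:
  "integrable M (qform A)" "expectation (qform A) = of_nat N * (\<Sum>s\<in>J. \<Sum>t\<in>J. A s t * S s t)"
proof -
  show "integrable M (qform A)" unfolding qform_def[abs_def]
    by (intro Bochner_Integration.integrable_sum integrable_mult_right second_moment) auto
  have "expectation (qform A) = (\<Sum>n<N. \<Sum>s\<in>J. \<Sum>t\<in>J. A s t * expectation (\<lambda>\<omega>. Y n s \<omega> * cnj (Y n t \<omega>)))"
    unfolding qform_def[abs_def]
    by (subst Bochner_Integration.integral_sum, (intro Bochner_Integration.integrable_sum integrable_mult_right second_moment; simp),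
        rule sum.cong[OF refl],
        subst Bochner_Integration.integral_sum, (intro Bochner_Integration.integrable_sum integrable_mult_right second_moment; simp),
        rule sum.cong[OF refl],
        subst Bochner_Integration.integral_sum, (intro Bochner_Integration.integrable_sum integrable_mult_right second_moment; simp))
      simp
  also have "\<dots> = (\<Sum>n<N. \<Sum>s\<in>J. \<Sum>t\<in>J. A s t * S s t)"
    by (intro sum.cong refl) (simp add: second_moment)
  finally show "expectation (qform A) = of_nat N * (\<Sum>s\<in>J. \<Sum>t\<in>J. A s t * S s t)" by simp
qed

end

section \<open>Symmetrisation, decoupling and tail bounds for quadratic forms\<close>

definition sesq :: "'j set \<Rightarrow> ('j \<Rightarrow> 'j \<Rightarrow> complex) \<Rightarrow> ('j \<Rightarrow> complex) \<Rightarrow> ('j \<Rightarrow> complex) \<Rightarrow> complex" where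
  "sesq J A f g = (\<Sum>s\<in>J. \<Sum>t\<in>J. A s t * (f s * cnj (g t)))"

lemma sesq_herm:
  assumes "\<And>s t. A t s = cnj (A s t)"
  shows "sesq J A g f = cnj (sesq J A f g)"
proof -
  have "sesq J A g f = (\<Sum>t\<in>J. \<Sum>s\<in>J. A s t * (g s * cnj (f t)))"
    unfolding sesq_def by (rule sum.swap)
  also have "\<dots> = cnj (sesq J A f g)"
    unfolding sesq_def cnj_sum by (intro sum.cong refl) (simp add: assms[symmetric] mult_ac)
  finally show ?thesis .
qed

text \<open>The mixed terms combine to \<open>z - cnj z\<close> because \<open>A\<close> is
  Hermitian, and this is purely imaginary.\<close>

lemma sesq_rotation:
  assumes A: "\<And>s t. A t s = cnj (A s t)"
  shows "Re (2 * sesq J A (\<lambda>s. (y s - y' s) / complex_of_real (sqrt 2)) (\<lambda>s. (y s + y' s) / complex_of_real (sqrt 2)))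
    = Re (sesq J A y y - sesq J A y' y')"
proof -
  have r: "complex_of_real (sqrt 2) * complex_of_real (sqrt 2) = 2"
    by (simp flip: of_real_mult)
  have p: "2 * (a * ((b / complex_of_real (sqrt 2)) * cnj (c / complex_of_real (sqrt 2)))) = a * (b * cnj c)" for a b c
    by (simp add: times_divide_times_eq r)
  have "2 * sesq J A (\<lambda>s. (y s - y' s) / complex_of_real (sqrt 2)) (\<lambda>s. (y s + y' s) / complex_of_real (sqrt 2))
    = (\<Sum>s\<in>J. \<Sum>t\<in>J. A s t * ((y s - y' s) * cnj (y t + y' t)))"
    unfolding sesq_def sum_distrib_left p ..
  also have "\<dots> = sesq J A y y - sesq J A y' y' + (sesq J A y y' - sesq J A y' y)"
    by (simp add: sesq_def sum.distrib sum_subtractf algebra_simps)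
  also have "sesq J A y' y = cnj (sesq J A y y')" by (rule sesq_herm[OF A])
  finally show ?thesis by simp
qed

context circular_gaussian_array
begin

text \<open>The pairs \<open>(y, y')\<close> and \<open>((y + y') / sqrt 2, (y - y') / sqrt 2)\<close> have the same law when
  \<open>y'\<close> is an independent copy of \<open>y\<close>; this turns a difference of quadratic forms into a
  bilinear form in two independent arrays.\<close>

lemma decoupling:
  fixes c :: real
  assumes A: "\<And>s t. A t s = cnj (A s t)"
  shows "(\<integral>\<^sup>+\<omega>. \<integral>\<^sup>+\<omega>'. ennreal (exp (c * Re (qform A \<omega> - qform A \<omega>'))) \<partial>M \<partial>M) =
    (\<integral>\<^sup>+\<omega>. \<integral>\<^sup>+\<omega>'. ennreal (exp (c * Re (\<Sum>n<N. 2 * sesq J A (\<lambda>s. Y n s \<omega>') (\<lambda>t. Y n t \<omega>)))) \<partial>M \<partial>M)"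
proof -
  interpret p: pair_prob_space M M ..
  define I where "I = ({..<N} \<times> J) \<times> (UNIV :: bool set)"
  \<comment> \<open>\<open>True\<close> marks the first array of the pair and \<open>False\<close>
    the second; \<open>Z\<close> is the rotated pair and \<open>Z'\<close> the pair itself. The same
    function \<open>f\<close> yields the difference of quadratic forms on \<open>Z\<close> and the
    bilinear form on \<open>Z'\<close>.\<close>
  define Z where "Z = (\<lambda>((n, t), b) p. if b then (Y n t (fst p) + Y n t (snd p)) / complex_of_real (sqrt 2)
    else (Y n t (fst p) - Y n t (snd p)) / complex_of_real (sqrt 2))"
  define Z' where "Z' = (\<lambda>((n, t), b) p. if b then Y n t (fst p) else Y n t (snd p))"
  define f where "f x = ennreal (exp (c * Re (\<Sum>n<N. 2 * (\<Sum>s\<in>J. \<Sum>t\<in>J. A s t * (x ((n, s), False) * cnj (x ((n, t), True)))))))"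
    for x :: "(nat \<times> 'j) \<times> bool \<Rightarrow> complex"
  have I: "finite I" using finite_J by (simp add: I_def)
  have Zm: "Z i \<in> borel_measurable (M \<Otimes>\<^sub>M M)" "Z' i \<in> borel_measurable (M \<Otimes>\<^sub>M M)" for i
    by (cases i; cases "fst i"; cases "snd i"; simp add: Z_def Z'_def)+
  have comp: "(\<lambda>x. x ((n, s), b)) \<in> borel_measurable (\<Pi>\<^sub>M i\<in>I. borel)" if "n \<in> {..<N}" "s \<in> J" for n s b
    using that by (intro measurable_component_singleton) (auto simp: I_def)
  have [measurable]: "(\<lambda>x. \<Sum>n<N. 2 * (\<Sum>s\<in>J. \<Sum>t\<in>J. A s t * (x ((n, s), False) * cnj (x ((n, t), True)))))
      \<in> borel_measurable (\<Pi>\<^sub>M i\<in>I. borel)"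
    by (intro borel_measurable_times borel_measurable_const borel_measurable_sum borel_measurable_cnj_comp comp)
  have fm: "f \<in> borel_measurable (\<Pi>\<^sub>M i\<in>I. borel)"
    unfolding f_def by measurable
  have lr: "iexp (Re (lin a \<omega>)) * iexp (Re (lin b \<omega>')) = iexp (Re (lin a \<omega> + lin b \<omega>'))" for a b \<omega> \<omega>'
    by (simp add: exp_add[symmetric] algebra_simps)
  have fub: "(\<integral>p. iexp (Re (lin a (fst p) + lin b (snd p))) \<partial>(M \<Otimes>\<^sub>M M)) =
      complex_of_real (exp (- var a / 4)) * complex_of_real (exp (- var b / 4))" for a b
    unfolding lr[symmetric]
  proof (subst p.integral_fst'[symmetric])
    show "integrable (M \<Otimes>\<^sub>M M) (\<lambda>p. iexp (Re (lin a (fst p))) * iexp (Re (lin b (snd p))))"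
      by (rule p.integrable_const_bound[of _ 1]) (auto simp: norm_mult)
  qed (simp add: char_lin)
  have sumI: "(\<Sum>i\<in>I. h i) = (\<Sum>n<N. \<Sum>t\<in>J. h ((n, t), True) + h ((n, t), False))" for h :: "_ \<Rightarrow> complex"
    unfolding I_def UNIV_bool by (simp add: sum.cartesian_product' add.commute)
  have eq: "(\<integral>p. iexp (Re (\<Sum>i\<in>I. g i * Z i p)) \<partial>(M \<Otimes>\<^sub>M M)) = (\<integral>p. iexp (Re (\<Sum>i\<in>I. g i * Z' i p)) \<partial>(M \<Otimes>\<^sub>M M))" for g
  proof -
    define a where "a n t = g ((n, t), True)" for n t
    define b where "b n t = g ((n, t), False)" for n t
    have Z': "(\<Sum>i\<in>I. g i * Z' i p) = lin a (fst p) + lin b (snd p)" for p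
      unfolding sumI by (simp add: Z'_def lin_def sum.distrib a_def b_def)
    have Z: "(\<Sum>i\<in>I. g i * Z i p) = lin (\<lambda>n t. (a n t + b n t) / complex_of_real (sqrt 2)) (fst p)
        + lin (\<lambda>n t. (a n t - b n t) / complex_of_real (sqrt 2)) (snd p)" for p
      unfolding sumI lin_def sum.distrib[symmetric]
      by (intro sum.cong refl) (simp add: Z_def a_def b_def algebra_simps add_divide_distrib diff_divide_distrib)
    have v: "var (\<lambda>n t. (a n t + b n t) / complex_of_real (sqrt 2))
        + var (\<lambda>n t. (a n t - b n t) / complex_of_real (sqrt 2)) = var a + var b"
      unfolding var_def sum.distrib[symmetric] by (simp only: cov_form_parallelogram)
    have e: "complex_of_real (exp (- x / 4)) * complex_of_real (exp (- y / 4)) = complex_of_real (exp (- (x + y) / 4))"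
      for x y
      unfolding of_real_mult[symmetric] exp_add[symmetric] by (simp add: add_divide_distrib)
    show ?thesis unfolding Z Z' fub e v ..
  qed
  have fZ: "f (\<lambda>i\<in>I. Z i p) = ennreal (exp (c * Re (qform A (fst p) - qform A (snd p))))" for p
  proof -
    have "f (\<lambda>i\<in>I. Z i p) = ennreal (exp (c * Re (\<Sum>n<N. 2 * sesq J A
        (\<lambda>s. (Y n s (fst p) - Y n s (snd p)) / complex_of_real (sqrt 2))
        (\<lambda>s. (Y n s (fst p) + Y n s (snd p)) / complex_of_real (sqrt 2)))))"
      unfolding f_def sesq_def
      by (intro arg_cong[of _ _ ennreal] arg_cong[of _ _ exp] arg_cong[of _ _ Re] arg_cong[of _ _ "times c"]
          arg_cong[of _ _ "times 2"] sum.cong refl) (simp add: I_def Z_def)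
    also have "\<dots> = ennreal (exp (c * (\<Sum>n<N. Re (sesq J A (\<lambda>s. Y n s (fst p)) (\<lambda>s. Y n s (fst p))
        - sesq J A (\<lambda>s. Y n s (snd p)) (\<lambda>s. Y n s (snd p))))))"
      unfolding Re_sum sesq_rotation[OF A] ..
    also have "\<dots> = ennreal (exp (c * Re (qform A (fst p) - qform A (snd p))))"
      by (simp add: qform_def sesq_def sum_subtractf)
    finally show ?thesis .
  qed
  have fZ': "f (\<lambda>i\<in>I. Z' i p) = ennreal (exp (c * Re (\<Sum>n<N. 2 * sesq J A (\<lambda>s. Y n s (snd p)) (\<lambda>t. Y n t (fst p)))))" for p
    unfolding f_def sesq_def
    by (intro arg_cong[of _ _ ennreal] arg_cong[of _ _ exp] arg_cong[of _ _ Re] arg_cong[of _ _ "times c"]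
        arg_cong[of _ _ "times 2"] sum.cong refl) (simp add: I_def Z'_def)
  have "(\<integral>\<^sup>+p. f (\<lambda>i\<in>I. Z i p) \<partial>(M \<Otimes>\<^sub>M M)) = (\<integral>\<^sup>+p. f (\<lambda>i\<in>I. Z' i p) \<partial>(M \<Otimes>\<^sub>M M))"
    by (rule nn_integral_joint_char_unique[OF p.prob_space_axioms p.prob_space_axioms I Zm eq fm])
  then show ?thesis
    unfolding fZ fZ' by (subst (asm) (1 2) nn_integral_fst[symmetric]) (auto simp: sesq_def)
qed

text \<open>The double integral factorises by independence, and the factor of the copy is at least
  1, since \<open>exp y \<ge> 1 + y\<close> and the copy is centred. Finiteness of the other factor
  is not known at this stage, hence nonnegative integrals.\<close>

lemma centred_le_symmetrised:
  fixes c :: real and A :: "'j \<Rightarrow> 'j \<Rightarrow> complex"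
  defines "m \<equiv> Re (expectation (qform A))"
  shows "(\<integral>\<^sup>+\<omega>. ennreal (exp (c * (Re (qform A \<omega>) - m))) \<partial>M) \<le>
    (\<integral>\<^sup>+\<omega>. \<integral>\<^sup>+\<omega>'. ennreal (exp (c * Re (qform A \<omega> - qform A \<omega>'))) \<partial>M \<partial>M)"
proof -
  have i: "integrable M (\<lambda>\<omega>. Re (qform A \<omega>))" by (intro integrable_Re qform_expectation)
  have e: "expectation (\<lambda>\<omega>. Re (qform A \<omega>)) = m" unfolding m_def by (intro integral_Re qform_expectation)
  have one: "1 \<le> (\<integral>\<^sup>+\<omega>. ennreal (exp (- c * (Re (qform A \<omega>) - m))) \<partial>M)"
  proof -
    have i1: "integrable M (\<lambda>\<omega>. 1 + - c * (Re (qform A \<omega>) - m))" using i by auto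
    have "1 = ennreal (expectation (\<lambda>\<omega>. 1 + - c * (Re (qform A \<omega>) - m)))"
      using i by (simp add: e prob_space)
    also have "\<dots> \<le> (\<integral>\<^sup>+\<omega>. ennreal (1 + - c * (Re (qform A \<omega>) - m)) \<partial>M)"
    proof -
      \<comment> \<open>\<open>ennreal\<close> cuts the integrand off at 0, so the comparison passes
        through its positive part.\<close>
      have "ennreal (expectation (\<lambda>\<omega>. 1 + - c * (Re (qform A \<omega>) - m)))
        \<le> ennreal (expectation (\<lambda>\<omega>. max 0 (1 + - c * (Re (qform A \<omega>) - m))))"
        using i1 by (intro ennreal_leI integral_mono integrable_max) auto
      also have "\<dots> = (\<integral>\<^sup>+\<omega>. ennreal (max 0 (1 + - c * (Re (qform A \<omega>) - m))) \<partial>M)"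
        using i1 by (intro nn_integral_eq_integral[symmetric] integrable_max) auto
      also have "\<dots> = (\<integral>\<^sup>+\<omega>. ennreal (1 + - c * (Re (qform A \<omega>) - m)) \<partial>M)"
        by (intro nn_integral_cong) (auto simp: max_def ennreal_neg)
      finally show ?thesis .
    qed
    also have "\<dots> \<le> (\<integral>\<^sup>+\<omega>. ennreal (exp (- c * (Re (qform A \<omega>) - m))) \<partial>M)"
      by (intro nn_integral_mono ennreal_leI exp_ge_add_one_self)
    finally show ?thesis .
  qed
  have sp: "ennreal (exp (c * Re (qform A \<omega> - qform A \<omega>'))) =
      ennreal (exp (c * (Re (qform A \<omega>) - m))) * ennreal (exp (- c * (Re (qform A \<omega>') - m)))" for \<omega> \<omega>'
    by (simp add: ennreal_mult[symmetric] exp_add[symmetric] algebra_simps)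
  have "(\<integral>\<^sup>+\<omega>. \<integral>\<^sup>+\<omega>'. ennreal (exp (c * Re (qform A \<omega> - qform A \<omega>'))) \<partial>M \<partial>M) =
      (\<integral>\<^sup>+\<omega>. ennreal (exp (c * (Re (qform A \<omega>) - m))) \<partial>M) * (\<integral>\<^sup>+\<omega>. ennreal (exp (- c * (Re (qform A \<omega>) - m))) \<partial>M)"
    unfolding sp by (subst nn_integral_cmult, measurable, subst nn_integral_multc) auto
  then show ?thesis
    using mult_left_mono[OF one, of "\<integral>\<^sup>+\<omega>. ennreal (exp (c * (Re (qform A \<omega>) - m))) \<partial>M"] by simp
qed

lemma var_le: "var g \<le> k * (\<Sum>n<N. \<Sum>t\<in>J. (cmod (g n t))\<^sup>2)"
  unfolding var_def sum_distrib_left by (intro sum_mono order_trans[OF cov_form_le]) (simp add: sum_distrib_left)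

text \<open>Each of the two arguments of the bilinear form is integrated out once, and each time its
  covariance is replaced by \<open>k\<close> times the identity; this produces
  \<open>k\<^sup>2\<close>. The bounded variance always sits in an exponent with a positive sign, so
  an inequality is enough.\<close>

lemma qform_mgf_le:
  fixes c :: real
  assumes A: "\<And>s t. A t s = cnj (A s t)" and k: "k \<ge> 0"
    and F: "c\<^sup>2 * k\<^sup>2 * (\<Sum>t\<in>J. \<Sum>s\<in>J. (cmod (A s t))\<^sup>2) \<le> 1 / 2"
  shows "(\<integral>\<^sup>+\<omega>. ennreal (exp (c * (Re (qform A \<omega>) - Re (expectation (qform A))))) \<partial>M) \<le>
    ennreal (exp (real N * (2 * (c\<^sup>2 * k\<^sup>2 * (\<Sum>t\<in>J. \<Sum>s\<in>J. (cmod (A s t))\<^sup>2)))))"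
proof -
  define G where "G = (\<Pi>\<^sub>M n\<in>{..<N}. iid_complex_gaussian J)"
  have pG: "product_prob_space (\<lambda>_::nat. iid_complex_gaussian J)"
    by (intro product_prob_spaceI prob_space_iid_complex_gaussian)
  interpret pG: product_prob_space "\<lambda>_::nat. iid_complex_gaussian J" by (rule pG)
  interpret G: prob_space G unfolding G_def by (intro prob_space_PiM prob_space_iid_complex_gaussian)
  interpret MG: pair_sigma_finite M G ..
  have Gm: "(\<lambda>x. x n s) \<in> borel_measurable G" if "n \<in> {..<N}" "s \<in> J" for n s
  proof -
    have "(\<lambda>x. x n) \<in> measurable G (iid_complex_gaussian J)"
      unfolding G_def by (rule measurable_component_singleton[OF that(1)])
    moreover have "(\<lambda>y. y s) \<in> measurable (iid_complex_gaussian J) (complex_gaussian 1)"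
      by (rule measurable_component_singleton[OF that(2)])
    ultimately have "(\<lambda>x. x n s) \<in> measurable G (complex_gaussian 1)"
      by (rule measurable_compose)
    then show ?thesis by (simp only: measurable_cong_sets[OF refl sets_complex_gaussian])
  qed
  have mgfG: "(\<integral>\<^sup>+x. ennreal (exp (Re (\<Sum>n<N. \<Sum>s\<in>J. a n s * x n s))) \<partial>G) =
      ennreal (exp ((\<Sum>n<N. \<Sum>s\<in>J. (cmod (a n s))\<^sup>2) / 4))" for a
  proof -
    have "(\<integral>\<^sup>+x. ennreal (exp (Re (\<Sum>n<N. \<Sum>s\<in>J. a n s * x n s))) \<partial>G) =
        (\<integral>\<^sup>+x. (\<Prod>n<N. ennreal (exp (Re (\<Sum>s\<in>J. a n s * x n s)))) \<partial>G)"
      by (simp only: Re_sum prod_ennreal_exp[OF finite_lessThan])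
    also have "\<dots> = (\<Prod>n<N. \<integral>\<^sup>+y. ennreal (exp (Re (\<Sum>s\<in>J. a n s * y s))) \<partial>iid_complex_gaussian J)"
      unfolding G_def by (intro pG.product_nn_integral_prod) auto
    also have "\<dots> = ennreal (exp ((\<Sum>n<N. \<Sum>s\<in>J. (cmod (a n s))\<^sup>2) / 4))"
      by (simp only: iid_complex_gaussian_mgf[OF finite_J] prod_ennreal_exp[OF finite_lessThan] sum_divide_distrib)
    finally show ?thesis .
  qed
  \<comment> \<open>Chosen so that
    \<open>k * (cmod (a n s))\<^sup>2 = (cmod (b n s \<omega>))\<^sup>2\<close> below. The bound for
    the inner exponential moment is then itself the moment of a linear form in the auxiliary
    variables, with coefficients \<open>b\<close> linear in \<open>Y\<close>.\<close>
  define d where "d = sqrt k * \<bar>c\<bar>"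
  have d2: "d\<^sup>2 = k * c\<^sup>2" using k by (simp add: d_def power_mult_distrib)
  define b where "b n s \<omega> = complex_of_real (2 * d) * (\<Sum>t\<in>J. cnj (A s t) * Y n t \<omega>)" for n s \<omega>
  \<comment> \<open>The same double sum read as a linear form in \<open>Y\<close>, which allows
    \<open>Y\<close> to be integrated out with the auxiliary variables fixed.\<close>
  define g where "g x n t = complex_of_real (2 * d) * (\<Sum>s\<in>J. cnj (A s t) * x n s)" for x :: "nat \<Rightarrow> 'j \<Rightarrow> complex" and n t
  have inner: "(\<integral>\<^sup>+\<omega>'. ennreal (exp (c * Re (\<Sum>n<N. 2 * sesq J A (\<lambda>s. Y n s \<omega>') (\<lambda>t. Y n t \<omega>)))) \<partial>M)
      \<le> (\<integral>\<^sup>+x. ennreal (exp (Re (\<Sum>n<N. \<Sum>s\<in>J. b n s \<omega> * x n s))) \<partial>G)" for \<omega>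
  proof -
    define a where "a n s = complex_of_real (2 * c) * (\<Sum>t\<in>J. A s t * cnj (Y n t \<omega>))" for n s
    have l: "complex_of_real c * (\<Sum>n<N. 2 * sesq J A (\<lambda>s. Y n s \<omega>') (\<lambda>t. Y n t \<omega>)) = lin a \<omega>'" for \<omega>'
      by (simp add: lin_def a_def sesq_def sum_distrib_left sum_distrib_right mult_ac)
    have "(\<integral>\<^sup>+\<omega>'. ennreal (exp (c * Re (\<Sum>n<N. 2 * sesq J A (\<lambda>s. Y n s \<omega>') (\<lambda>t. Y n t \<omega>)))) \<partial>M)
        = (\<integral>\<^sup>+\<omega>'. ennreal (exp (Re (lin a \<omega>'))) \<partial>M)"
      unfolding l[symmetric] Re_of_real_mult ..
    also have "\<dots> = ennreal (exp (var a / 4))" by (rule mgf_lin)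
    also have "\<dots> \<le> ennreal (exp ((\<Sum>n<N. \<Sum>s\<in>J. (cmod (b n s \<omega>))\<^sup>2) / 4))"
    proof -
      have "cmod (\<Sum>t\<in>J. A s t * cnj (Y n t \<omega>)) = cmod (\<Sum>t\<in>J. cnj (A s t) * Y n t \<omega>)" for n s
      proof -
        have "(\<Sum>t\<in>J. A s t * cnj (Y n t \<omega>)) = cnj (\<Sum>t\<in>J. cnj (A s t) * Y n t \<omega>)" by simp
        then show ?thesis by (simp only: complex_mod_cnj)
      qed
      then have "k * (cmod (a n s))\<^sup>2 = (cmod (b n s \<omega>))\<^sup>2" for n s
        by (simp add: a_def b_def norm_mult power_mult_distrib d2)
      then have "k * (\<Sum>n<N. \<Sum>s\<in>J. (cmod (a n s))\<^sup>2) = (\<Sum>n<N. \<Sum>s\<in>J. (cmod (b n s \<omega>))\<^sup>2)"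
        by (simp only: sum_distrib_left)
      then show ?thesis using var_le[of a] by (intro ennreal_leI) simp
    qed
    also have "\<dots> = (\<integral>\<^sup>+x. ennreal (exp (Re (\<Sum>n<N. \<Sum>s\<in>J. b n s \<omega> * x n s))) \<partial>G)"
      by (rule mgfG[symmetric])
    finally show ?thesis .
  qed
  have swap: "(\<Sum>n<N. \<Sum>s\<in>J. b n s \<omega> * x n s) = lin (g x) \<omega>" for \<omega> x
  proof -
    have "(\<Sum>s\<in>J. b n s \<omega> * x n s) = (\<Sum>t\<in>J. g x n t * Y n t \<omega>)" for n
      unfolding b_def g_def sum_distrib_left sum_distrib_right
      by (subst sum.swap) (simp add: mult_ac)
    then show ?thesis by (simp add: lin_def)
  qed
  have [measurable]: "(\<lambda>p. \<Sum>n<N. \<Sum>s\<in>J. b n s (fst p) * snd p n s) \<in> borel_measurable (M \<Otimes>\<^sub>M G)"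
    unfolding b_def
    by (intro borel_measurable_times borel_measurable_const borel_measurable_sum measurable_compose[OF measurable_snd Gm]
        measurable_compose[OF measurable_fst Y_measurable])
  have gm: "(\<lambda>p. ennreal (exp (Re (lin (g (snd p)) (fst p))))) \<in> borel_measurable (M \<Otimes>\<^sub>M G)"
    unfolding swap[symmetric] by measurable
  have "(\<integral>\<^sup>+\<omega>. ennreal (exp (c * (Re (qform A \<omega>) - Re (expectation (qform A))))) \<partial>M)
      \<le> (\<integral>\<^sup>+\<omega>. \<integral>\<^sup>+\<omega>'. ennreal (exp (c * Re (qform A \<omega> - qform A \<omega>'))) \<partial>M \<partial>M)"
    by (rule centred_le_symmetrised)
  also have "\<dots> = (\<integral>\<^sup>+\<omega>. \<integral>\<^sup>+\<omega>'. ennreal (exp (c * Re (\<Sum>n<N. 2 * sesq J A (\<lambda>s. Y n s \<omega>') (\<lambda>t. Y n t \<omega>)))) \<partial>M \<partial>M)"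
    by (rule decoupling[OF A])
  also have "\<dots> \<le> (\<integral>\<^sup>+\<omega>. \<integral>\<^sup>+x. ennreal (exp (Re (lin (g x) \<omega>))) \<partial>G \<partial>M)"
    using inner unfolding swap by (intro nn_integral_mono)
  also have "\<dots> = (\<integral>\<^sup>+x. \<integral>\<^sup>+\<omega>. ennreal (exp (Re (lin (g x) \<omega>))) \<partial>M \<partial>G)"
    using gm by (intro MG.Fubini'[symmetric]) (simp add: case_prod_beta)
  also have "\<dots> = (\<integral>\<^sup>+x. ennreal (exp (var (g x) / 4)) \<partial>G)"
    by (simp only: mgf_lin)
  also have "\<dots> \<le> (\<integral>\<^sup>+x. (\<Prod>n<N. ennreal (exp (c\<^sup>2 * k\<^sup>2 * (\<Sum>t\<in>J. (cmod (\<Sum>s\<in>J. cnj (A s t) * x n s))\<^sup>2)))) \<partial>G)"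
  proof (intro nn_integral_mono)
    fix x
    have "var (g x) / 4 \<le> (\<Sum>n<N. c\<^sup>2 * k\<^sup>2 * (\<Sum>t\<in>J. (cmod (\<Sum>s\<in>J. cnj (A s t) * x n s))\<^sup>2))"
    proof -
      \<comment> \<open>One factor \<open>k\<close> comes from \<open>d\<^sup>2\<close>, the other
        from the second use of the variance bound.\<close>
      have "k * (cmod (g x n t))\<^sup>2 = 4 * (c\<^sup>2 * k\<^sup>2 * (cmod (\<Sum>s\<in>J. cnj (A s t) * x n s))\<^sup>2)" for n t
        by (simp add: g_def norm_mult power_mult_distrib d2) (simp add: power2_eq_square)
      then have "k * (\<Sum>n<N. \<Sum>t\<in>J. (cmod (g x n t))\<^sup>2) =
          4 * (\<Sum>n<N. c\<^sup>2 * k\<^sup>2 * (\<Sum>t\<in>J. (cmod (\<Sum>s\<in>J. cnj (A s t) * x n s))\<^sup>2))"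
        by (simp only: sum_distrib_left)
      then show ?thesis using var_le[of "g x"] by simp
    qed
    then show "ennreal (exp (var (g x) / 4)) \<le>
        (\<Prod>n<N. ennreal (exp (c\<^sup>2 * k\<^sup>2 * (\<Sum>t\<in>J. (cmod (\<Sum>s\<in>J. cnj (A s t) * x n s))\<^sup>2))))"
      by (subst prod_ennreal_exp) (auto intro!: ennreal_leI)
  qed
  also have "\<dots> = (\<Prod>n<N. \<integral>\<^sup>+y. ennreal (exp (c\<^sup>2 * k\<^sup>2 * (\<Sum>t\<in>J. (cmod (\<Sum>s\<in>J. cnj (A s t) * y s))\<^sup>2))) \<partial>iid_complex_gaussian J)"
    unfolding G_def by (intro pG.product_nn_integral_prod) auto
  also have "\<dots> \<le> (\<Prod>n<N. ennreal (exp (2 * (c\<^sup>2 * k\<^sup>2 * (\<Sum>t\<in>J. \<Sum>s\<in>J. (cmod (cnj (A s t)))\<^sup>2)))))"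
    unfolding prod_constant
    using F by (intro power_mono_ennreal iid_complex_gaussian_exp_sum_squares_le[OF finite_J]) auto
  also have "\<dots> = ennreal (exp (real N * (2 * (c\<^sup>2 * k\<^sup>2 * (\<Sum>t\<in>J. \<Sum>s\<in>J. (cmod (A s t))\<^sup>2)))))"
    by (subst prod_ennreal_exp) auto
  finally show ?thesis .
qed

text \<open>Chernoff's bound with the sign of \<open>c\<close> left open: a negative
  \<open>c\<close> turns it into a bound for the lower tail.\<close>

lemma qform_upper_tail:
  fixes c a :: real
  assumes A: "\<And>s t. A t s = cnj (A s t)" and k: "k \<ge> 0"
    and F: "c\<^sup>2 * k\<^sup>2 * (\<Sum>t\<in>J. \<Sum>s\<in>J. (cmod (A s t))\<^sup>2) \<le> 1 / 2"
  defines "m \<equiv> Re (expectation (qform A))"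
  shows "prob {\<omega> \<in> space M. c * (Re (qform A \<omega>) - m) > a}
    \<le> exp (real N * (2 * (c\<^sup>2 * k\<^sup>2 * (\<Sum>t\<in>J. \<Sum>s\<in>J. (cmod (A s t))\<^sup>2))) - a)"
proof -
  let ?E = "{\<omega> \<in> space M. c * (Re (qform A \<omega>) - m) > a}"
  let ?b = "real N * (2 * (c\<^sup>2 * k\<^sup>2 * (\<Sum>t\<in>J. \<Sum>s\<in>J. (cmod (A s t))\<^sup>2)))"
  have "emeasure M ?E = (\<integral>\<^sup>+\<omega>. indicator ?E \<omega> \<partial>M)" by simp
  also have "\<dots> \<le> (\<integral>\<^sup>+\<omega>. ennreal (exp (- a)) * ennreal (exp (c * (Re (qform A \<omega>) - m))) \<partial>M)"
  proof (intro nn_integral_mono)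
    fix \<omega>
    have "1 \<le> exp (- a) * exp (c * (Re (qform A \<omega>) - m))" if "\<omega> \<in> ?E"
      using that by (simp add: exp_add[symmetric])
    then show "indicator ?E \<omega> \<le> ennreal (exp (- a)) * ennreal (exp (c * (Re (qform A \<omega>) - m)))"
      by (auto simp: indicator_def ennreal_mult[symmetric])
  qed
  also have "\<dots> = ennreal (exp (- a)) * (\<integral>\<^sup>+\<omega>. ennreal (exp (c * (Re (qform A \<omega>) - m))) \<partial>M)"
    by (rule nn_integral_cmult) measurable
  also have "\<dots> \<le> ennreal (exp (- a)) * ennreal (exp ?b)"
    unfolding m_def by (intro mult_left_mono qform_mgf_le A k F) auto
  also have "\<dots> = ennreal (exp (?b - a))"
    by (simp add: ennreal_mult[symmetric] exp_add[symmetric])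
  finally show ?thesis by (simp add: emeasure_eq_measure)
qed

lemma qform_tail:
  fixes c a :: real
  assumes A: "\<And>s t. A t s = cnj (A s t)" and k: "k \<ge> 0" and c: "c > 0"
    and F: "c\<^sup>2 * k\<^sup>2 * (\<Sum>t\<in>J. \<Sum>s\<in>J. (cmod (A s t))\<^sup>2) \<le> 1 / 2"
  defines "m \<equiv> Re (expectation (qform A))"
  shows "prob {\<omega> \<in> space M. \<bar>Re (qform A \<omega>) - m\<bar> > a}
    \<le> 2 * exp (real N * (2 * (c\<^sup>2 * k\<^sup>2 * (\<Sum>t\<in>J. \<Sum>s\<in>J. (cmod (A s t))\<^sup>2))) - c * a)"
proof -
  let ?b = "real N * (2 * (c\<^sup>2 * k\<^sup>2 * (\<Sum>t\<in>J. \<Sum>s\<in>J. (cmod (A s t))\<^sup>2)))"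
  let ?U = "{\<omega> \<in> space M. c * (Re (qform A \<omega>) - m) > c * a}"
  let ?L = "{\<omega> \<in> space M. (- c) * (Re (qform A \<omega>) - m) > c * a}"
  have "{\<omega> \<in> space M. \<bar>Re (qform A \<omega>) - m\<bar> > a} \<subseteq> ?U \<union> ?L"
  proof
    fix \<omega> assume w: "\<omega> \<in> {\<omega> \<in> space M. \<bar>Re (qform A \<omega>) - m\<bar> > a}"
    then have "Re (qform A \<omega>) - m > a \<or> - (Re (qform A \<omega>) - m) > a" by auto
    then have "c * (Re (qform A \<omega>) - m) > c * a \<or> c * (- (Re (qform A \<omega>) - m)) > c * a"
      using c by (simp only: mult_less_cancel_left_pos)
    with w show "\<omega> \<in> ?U \<union> ?L" by (auto simp: algebra_simps)
  qed
  then have "prob {\<omega> \<in> space M. \<bar>Re (qform A \<omega>) - m\<bar> > a} \<le> prob (?U \<union> ?L)"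
    by (intro finite_measure_mono) measurable
  also have "\<dots> \<le> prob ?U + prob ?L"
    by (intro measure_Un_le) measurable
  also have "\<dots> \<le> exp (?b - c * a) + exp (?b - c * a)"
    using qform_upper_tail[OF A k F, where a = "c * a"] qform_upper_tail[OF A k, where c = "- c" and a = "c * a"] F
    unfolding m_def by (intro add_mono) simp_all
  finally show ?thesis by simp
qed

end

section \<open>The observation model as a Gaussian array\<close>

text \<open>Serves as an integrable majorant only, so the constant does not matter.\<close>

lemma cmod_mult_le_squares: "cmod (z * w) \<le> (cmod z)\<^sup>2 + (cmod w)\<^sup>2"
proof -
  have "2 * (cmod z * cmod w) \<le> (cmod z)\<^sup>2 + (cmod w)\<^sup>2"
    using sum_squares_bound[of "cmod z" "cmod w"] by simp
  then show ?thesis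
    by (smt (verit) norm_mult mult_nonneg_nonneg norm_ge_zero)
qed

context stationary_circular_gaussian_process
begin

definition lcomb :: "int set \<Rightarrow> (int \<Rightarrow> complex) \<Rightarrow> 'a \<Rightarrow> complex" where
  "lcomb F g \<omega> = (\<Sum>t\<in>F. g t * X t \<omega>)"

lemma lcomb_measurable [measurable]: "lcomb F g \<in> borel_measurable M"
  unfolding lcomb_def by measurable

lemma Re_lcomb_gaussian:
  assumes "finite F"
  obtains m s where "distr M borel (\<lambda>\<omega>. Re (lcomb F g \<omega>)) = real_gaussian m s"
    "integrable M (\<lambda>\<omega>. Re (lcomb F g \<omega>))" "expectation (\<lambda>\<omega>. Re (lcomb F g \<omega>)) = m"
    "integrable M (\<lambda>\<omega>. (Re (lcomb F g \<omega>))\<^sup>2)" "expectation (\<lambda>\<omega>. (Re (lcomb F g \<omega>))\<^sup>2) = m\<^sup>2 + s\<^sup>2"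
proof -
  obtain m s where D: "distr M borel (\<lambda>\<omega>. Re (lcomb F g \<omega>)) = real_gaussian m s"
    using gaussian[OF assms, of g] unfolding lcomb_def by auto
  have d: "integrable (distr M borel (\<lambda>\<omega>. Re (lcomb F g \<omega>))) f = integrable M (\<lambda>\<omega>. f (Re (lcomb F g \<omega>)))"
    "(\<integral>x. f x \<partial>distr M borel (\<lambda>\<omega>. Re (lcomb F g \<omega>))) = expectation (\<lambda>\<omega>. f (Re (lcomb F g \<omega>)))"
    if [measurable]: "f \<in> borel_measurable borel" for f :: "real \<Rightarrow> real"
    by (subst integrable_distr_eq; simp) (subst integral_distr; simp)
  note m = real_gaussian_moments[of m s, folded D]
  show ?thesis
  proof (rule that[OF D])
    show "integrable M (\<lambda>\<omega>. Re (lcomb F g \<omega>))" "expectation (\<lambda>\<omega>. Re (lcomb F g \<omega>)) = m"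
      using m(1,2) by (simp_all add: d)
    show "integrable M (\<lambda>\<omega>. (Re (lcomb F g \<omega>))\<^sup>2)" "expectation (\<lambda>\<omega>. (Re (lcomb F g \<omega>))\<^sup>2) = m\<^sup>2 + s\<^sup>2"
      using m(3,4) by (simp_all add: d)
  qed
qed

lemma lcomb_scale: "lcomb F (\<lambda>t. c * g t) \<omega> = c * lcomb F g \<omega>"
  by (simp add: lcomb_def sum_distrib_left mult_ac)

lemma Re_lcomb_square_integrable: "finite F \<Longrightarrow> integrable M (\<lambda>\<omega>. (Re (lcomb F g \<omega>))\<^sup>2)"
  by (rule Re_lcomb_gaussian)

lemma Im_lcomb: "Im (lcomb F g \<omega>) = Re (lcomb F (\<lambda>t. - \<i> * g t) \<omega>)"
  by (simp only: lcomb_scale) simp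

lemma cmod_lcomb_square_integrable: "finite F \<Longrightarrow> integrable M (\<lambda>\<omega>. (cmod (lcomb F g \<omega>))\<^sup>2)"
  unfolding cmod_power2 Im_lcomb by (intro Bochner_Integration.integrable_add Re_lcomb_square_integrable)

lemma lcomb_single: "lcomb {t} (\<lambda>_. 1) \<omega> = X t \<omega>"
  by (simp add: lcomb_def)

lemma X_integrable: "integrable M (X t)"
proof -
  have "integrable M (\<lambda>\<omega>. Re (lcomb {t} (\<lambda>_. 1) \<omega>))" "integrable M (\<lambda>\<omega>. Im (lcomb {t} (\<lambda>_. 1) \<omega>))"
    unfolding Im_lcomb by (rule Re_lcomb_gaussian; simp)+
  then have "integrable M (\<lambda>\<omega>. complex_of_real (Re (X t \<omega>)) + \<i> * complex_of_real (Im (X t \<omega>)))"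
    unfolding lcomb_single by (intro Bochner_Integration.integrable_add integrable_mult_right integrable_of_real)
  then show ?thesis by (simp add: complex_eq[symmetric])
qed

lemma X_product_integrable: "integrable M (\<lambda>\<omega>. X s \<omega> * cnj (X t \<omega>))"
proof (rule Bochner_Integration.integrable_bound)
  show "integrable M (\<lambda>\<omega>. (cmod (X s \<omega>))\<^sup>2 + (cmod (X t \<omega>))\<^sup>2)"
    using cmod_lcomb_square_integrable[of "{s}" "\<lambda>_. 1"] cmod_lcomb_square_integrable[of "{t}" "\<lambda>_. 1"]
    by (simp add: lcomb_single)
  show "AE \<omega> in M. norm (X s \<omega> * cnj (X t \<omega>)) \<le> norm ((cmod (X s \<omega>))\<^sup>2 + (cmod (X t \<omega>))\<^sup>2)"
    using cmod_mult_le_squares[of "X s _" "cnj (X t _)"] by auto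
qed measurable

lemma Re_lcomb_mean: "finite F \<Longrightarrow> expectation (\<lambda>\<omega>. Re (lcomb F g \<omega>)) = 0"
proof -
  assume F: "finite F"
  have "expectation (lcomb F g) = 0"
    unfolding lcomb_def[abs_def]
    by (subst Bochner_Integration.integral_sum) (auto simp: X_integrable zero_mean)
  moreover have "integrable M (lcomb F g)"
    unfolding lcomb_def[abs_def] by (intro Bochner_Integration.integrable_sum integrable_mult_right X_integrable)
  ultimately show ?thesis by simp
qed

text \<open>Circularity at the angle \<open>- pi / 2\<close> multiplies the process by
  \<open>- \<i>\<close>, which turns the real part of the combination into its imaginary
  part.\<close>

lemma Im_lcomb_square_eq: "finite F \<Longrightarrow>
  expectation (\<lambda>\<omega>. (Im (lcomb F g \<omega>))\<^sup>2) = expectation (\<lambda>\<omega>. (Re (lcomb F g \<omega>))\<^sup>2)"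
proof -
  assume F: "finite F"
  define f where "f x = (Re (\<Sum>t\<in>F. g t * x t))\<^sup>2" for x :: "int \<Rightarrow> complex"
  have [measurable]: "f \<in> borel_measurable (\<Pi>\<^sub>M t\<in>UNIV. borel)"
    unfolding f_def by measurable
  have [measurable]: "(\<lambda>\<omega> t. c * X t \<omega>) \<in> measurable M (\<Pi>\<^sub>M t\<in>UNIV. borel)" "(\<lambda>\<omega> t. X t \<omega>) \<in> measurable M (\<Pi>\<^sub>M t\<in>UNIV. borel)" for c
    by (rule measurable_PiM_single'; simp)+
  have d: "(\<integral>x. f x \<partial>process_law M (\<lambda>t \<omega>. c * X t \<omega>)) = expectation (\<lambda>\<omega>. f (\<lambda>t. c * X t \<omega>))" for c
    unfolding process_law_def by (rule integral_distr) measurable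
  have "(\<integral>x. f x \<partial>process_law M (\<lambda>t \<omega>. cis (- pi / 2) * X t \<omega>)) = (\<integral>x. f x \<partial>process_law M (\<lambda>t \<omega>. 1 * X t \<omega>))"
    unfolding circular by simp
  then have "expectation (\<lambda>\<omega>. f (\<lambda>t. cis (- pi / 2) * X t \<omega>)) = expectation (\<lambda>\<omega>. f (\<lambda>t. X t \<omega>))"
    unfolding d by simp
  moreover have "f (\<lambda>t. cis (- pi / 2) * X t \<omega>) = (Im (lcomb F g \<omega>))\<^sup>2" for \<omega>
  proof -
    have "(\<Sum>t\<in>F. g t * (cis (- pi / 2) * X t \<omega>)) = - \<i> * lcomb F g \<omega>"
      unfolding lcomb_def sum_distrib_left by (intro sum.cong refl) (simp add: cis.ctr complex_eq_iff)
    then show ?thesis by (simp add: f_def)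
  qed
  ultimately show ?thesis by (simp add: f_def lcomb_def)
qed

text \<open>By circularity the real part, a centred Gaussian variable, has half of the variance of
  the combination; the exponent thus depends on \<open>E |lcomb|\<^sup>2\<close> alone.\<close>

lemma char_lcomb:
  assumes F: "finite F"
  shows "expectation (\<lambda>\<omega>. iexp (Re (lcomb F g \<omega>))) = complex_of_real (exp (- expectation (\<lambda>\<omega>. (cmod (lcomb F g \<omega>))\<^sup>2) / 4))"
proof -
  obtain m s where D: "distr M borel (\<lambda>\<omega>. Re (lcomb F g \<omega>)) = real_gaussian m s"
    and m: "expectation (\<lambda>\<omega>. Re (lcomb F g \<omega>)) = m"
    and s: "expectation (\<lambda>\<omega>. (Re (lcomb F g \<omega>))\<^sup>2) = m\<^sup>2 + s\<^sup>2"
    using Re_lcomb_gaussian[OF F] by metis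
  have m0: "m = 0" using m Re_lcomb_mean[OF F] by simp
  have "expectation (\<lambda>\<omega>. (cmod (lcomb F g \<omega>))\<^sup>2) =
      expectation (\<lambda>\<omega>. (Re (lcomb F g \<omega>))\<^sup>2) + expectation (\<lambda>\<omega>. (Im (lcomb F g \<omega>))\<^sup>2)"
    unfolding cmod_power2 using F
    by (intro Bochner_Integration.integral_add) (auto simp only: Im_lcomb Re_lcomb_square_integrable)
  then have v: "expectation (\<lambda>\<omega>. (cmod (lcomb F g \<omega>))\<^sup>2) = 2 * s\<^sup>2"
    using s m0 Im_lcomb_square_eq[OF F] by simp
  have "expectation (\<lambda>\<omega>. iexp (Re (lcomb F g \<omega>))) = (\<integral>x. iexp (1 * x) \<partial>distr M borel (\<lambda>\<omega>. Re (lcomb F g \<omega>)))"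
    by (subst integral_distr) auto
  also have "\<dots> = complex_of_real (exp (- (2 * s\<^sup>2) / 4))"
    unfolding D real_gaussian_char by (simp add: m0)
  finally show ?thesis unfolding v .
qed

lemma char_lcomb_cov_form:
  assumes F: "finite F"
  shows "expectation (\<lambda>\<omega>. iexp (Re (\<Sum>t\<in>F. g t * X t \<omega>))) =
    complex_of_real (exp (- cov_form F (\<lambda>s t. expectation (\<lambda>\<omega>. X s \<omega> * cnj (X t \<omega>))) g / 4))"
proof -
  have "complex_of_real (expectation (\<lambda>\<omega>. (cmod (lcomb F g \<omega>))\<^sup>2)) =
      expectation (\<lambda>\<omega>. complex_of_real ((cmod (lcomb F g \<omega>))\<^sup>2))"
    by (rule integral_complex_of_real[symmetric])
  also have "\<dots> = expectation (\<lambda>\<omega>. \<Sum>s\<in>F. \<Sum>t\<in>F. g s * cnj (g t) * (X s \<omega> * cnj (X t \<omega>)))"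
    unfolding complex_norm_square lcomb_def cnj_sum sum_product complex_cnj_mult
    by (simp only: mult_ac)
  also have "\<dots> = (\<Sum>s\<in>F. \<Sum>t\<in>F. g s * cnj (g t) * expectation (\<lambda>\<omega>. X s \<omega> * cnj (X t \<omega>)))"
    by (simp add: Bochner_Integration.integral_sum X_product_integrable)
  finally have "expectation (\<lambda>\<omega>. (cmod (lcomb F g \<omega>))\<^sup>2) = cov_form F (\<lambda>s t. expectation (\<lambda>\<omega>. X s \<omega> * cnj (X t \<omega>))) g"
    unfolding cov_form_def by (metis Re_complex_of_real)
  then show ?thesis using char_lcomb[OF F, of g] by (simp add: lcomb_def)
qed

end

text \<open>Schur's test: \<open>2 * |g s| * |g t| \<le> |g s|\<^sup>2 + |g t|\<^sup>2\<close>, and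
  by symmetry of the moduli both halves give the same sum over rows.\<close>

lemma cov_form_le_row_sums:
  assumes J: "finite J" and herm: "\<And>s t. S t s = cnj (S s t)"
    and row: "\<And>s. s \<in> J \<Longrightarrow> (\<Sum>t\<in>J. cmod (S s t)) \<le> k"
  shows "cov_form J S g \<le> k * (\<Sum>t\<in>J. (cmod (g t))\<^sup>2)"
proof -
  have sym: "cmod (S t s) = cmod (S s t)" for s t by (subst herm) simp
  have "cov_form J S g \<le> cmod (\<Sum>s\<in>J. \<Sum>t\<in>J. g s * cnj (g t) * S s t)"
    unfolding cov_form_def by (rule complex_Re_le_cmod)
  also have "\<dots> \<le> (\<Sum>s\<in>J. \<Sum>t\<in>J. cmod (g s) * cmod (g t) * cmod (S s t))"
    by (intro sum_norm_le) (simp add: norm_mult)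
  also have "\<dots> \<le> (\<Sum>s\<in>J. \<Sum>t\<in>J. ((cmod (g s))\<^sup>2 / 2 + (cmod (g t))\<^sup>2 / 2) * cmod (S s t))"
  proof (intro sum_mono mult_right_mono)
    show "cmod (g s) * cmod (g t) \<le> (cmod (g s))\<^sup>2 / 2 + (cmod (g t))\<^sup>2 / 2" for s t
      using sum_squares_bound[of "cmod (g s)" "cmod (g t)"] by simp
  qed simp
  also have "\<dots> = (\<Sum>s\<in>J. \<Sum>t\<in>J. (cmod (g s))\<^sup>2 / 2 * cmod (S s t)) + (\<Sum>s\<in>J. \<Sum>t\<in>J. (cmod (g t))\<^sup>2 / 2 * cmod (S s t))"
    by (simp add: distrib_right sum.distrib)
  also have "(\<Sum>s\<in>J. \<Sum>t\<in>J. (cmod (g t))\<^sup>2 / 2 * cmod (S s t)) = (\<Sum>s\<in>J. \<Sum>t\<in>J. (cmod (g s))\<^sup>2 / 2 * cmod (S s t))"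
    by (subst sum.swap) (simp add: sym)
  also have "(\<Sum>s\<in>J. \<Sum>t\<in>J. (cmod (g s))\<^sup>2 / 2 * cmod (S s t)) + (\<Sum>s\<in>J. \<Sum>t\<in>J. (cmod (g s))\<^sup>2 / 2 * cmod (S s t))
      = (\<Sum>s\<in>J. (cmod (g s))\<^sup>2 * (\<Sum>t\<in>J. cmod (S s t)))"
    by (simp add: sum.distrib[symmetric] sum_distrib_left) (simp add: mult.commute)
  also have "\<dots> \<le> (\<Sum>s\<in>J. (cmod (g s))\<^sup>2 * k)"
    by (intro sum_mono mult_left_mono row) auto
  finally show ?thesis by (simp add: sum_distrib_left mult.commute)
qed

lemma cov_form_add: "cov_form J (\<lambda>s t. S s t + S' s t) g = cov_form J S g + cov_form J S' g"
  by (simp add: cov_form_def distrib_left sum.distrib)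

lemma cov_form_diag:
  assumes "finite J"
  shows "cov_form J (\<lambda>s t. if s = t then complex_of_real v else 0) g = (\<Sum>t\<in>J. v * (cmod (g t))\<^sup>2)"
proof -
  have "(\<Sum>t\<in>J. g s * cnj (g t) * (if s = t then complex_of_real v else 0)) = complex_of_real (v * (cmod (g s))\<^sup>2)"
    if "s \<in> J" for s
  proof -
    have "(\<Sum>t\<in>J. g s * cnj (g t) * (if s = t then complex_of_real v else 0)) =
        (\<Sum>t\<in>J. if s = t then g s * cnj (g s) * complex_of_real v else 0)"
      by (intro sum.cong refl) auto
    also have "\<dots> = g s * cnj (g s) * complex_of_real v" using assms that by simp
    finally show ?thesis by (simp add: complex_norm_square mult.commute flip: complex_norm_square)
  qed
  then have "(\<Sum>s\<in>J. \<Sum>t\<in>J. g s * cnj (g t) * (if s = t then complex_of_real v else 0)) =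
      complex_of_real (\<Sum>s\<in>J. v * (cmod (g s))\<^sup>2)"
    by simp
  then show ?thesis unfolding cov_form_def by (simp only: Re_complex_of_real)
qed

context ar_observation_model
begin

text \<open>Set to 0 off the observed window, where the model does not fix the measurability of
  \<open>h\<close> or \<open>w\<close>; an array must be measurable at all indices.\<close>

definition obs :: "nat \<Rightarrow> int \<Rightarrow> 'a \<Rightarrow> complex" where
  "obs n t \<omega> = (if n < N \<and> t \<in> {0..<int T} then h n t \<omega> + w n t \<omega> else 0)"

definition obs_cov :: "(int \<Rightarrow> complex) \<Rightarrow> int \<Rightarrow> int \<Rightarrow> complex" where
  "obs_cov r s t = complex_of_real vx * r (s - t) + (if s = t then complex_of_real vw else 0)"

lemma char_h:
  assumes "\<And>n t k. n < N \<Longrightarrow> expectation (\<lambda>\<omega>. h n t \<omega> * cnj (h n (t - k) \<omega>)) = complex_of_real vx * r k"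
    and F: "finite F"
  shows "expectation (\<lambda>\<omega>. iexp (Re (\<Sum>n<N. \<Sum>t\<in>F. g n t * h n t \<omega>))) =
    complex_of_real (exp (- (\<Sum>n<N. cov_form F (\<lambda>s t. complex_of_real vx * r (s - t)) (g n)) / 4))"
proof -
  define f where "f n x = iexp (Re (\<Sum>t\<in>F. g n t * x t))" for n and x :: "int \<Rightarrow> complex"
  have fm: "f n \<in> borel_measurable (\<Pi>\<^sub>M t\<in>UNIV. borel)" for n
    unfolding f_def by measurable
  have ind: "indep_vars (\<lambda>_. borel) (\<lambda>n \<omega>. f n (\<lambda>t. h n t \<omega>)) {..<N}"
    by (rule indep_vars_compose2[OF h_indep fm])
  have int: "integrable M (\<lambda>\<omega>. f n (\<lambda>t. h n t \<omega>))" if "n \<in> {..<N}" for n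
  proof (rule integrable_const_bound[of _ 1])
    show "(\<lambda>\<omega>. f n (\<lambda>t. h n t \<omega>)) \<in> borel_measurable M"
      using ind that by (auto simp: indep_vars_def)
  qed (simp add: f_def)
  have "expectation (\<lambda>\<omega>. iexp (Re (\<Sum>n<N. \<Sum>t\<in>F. g n t * h n t \<omega>))) =
      expectation (\<lambda>\<omega>. \<Prod>n<N. f n (\<lambda>t. h n t \<omega>))"
    unfolding f_def Re_sum by (simp add: exp_sum sum_distrib_left)
  also have "\<dots> = (\<Prod>n<N. expectation (\<lambda>\<omega>. f n (\<lambda>t. h n t \<omega>)))"
    by (rule indep_vars_lebesgue_integral[OF _ ind int]) auto
  also have "\<dots> = (\<Prod>n<N. complex_of_real (exp (- cov_form F (\<lambda>s t. complex_of_real vx * r (s - t)) (g n) / 4)))"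
  proof (intro prod.cong refl)
    fix n assume "n \<in> {..<N}"
    then have n: "n < N" by simp
    interpret X: stationary_circular_gaussian_process M "h n" by (rule process[OF n])
    have "expectation (\<lambda>\<omega>. h n s \<omega> * cnj (h n t \<omega>)) = complex_of_real vx * r (s - t)" for s t
      using assms(1)[OF n, of s "s - t"] by simp
    then show "expectation (\<lambda>\<omega>. f n (\<lambda>t. h n t \<omega>)) =
        complex_of_real (exp (- cov_form F (\<lambda>s t. complex_of_real vx * r (s - t)) (g n) / 4))"
      unfolding f_def using X.char_lcomb_cov_form[OF F, of "g n"] by simp
  qed
  also have "\<dots> = complex_of_real (exp (- (\<Sum>n<N. cov_form F (\<lambda>s t. complex_of_real vx * r (s - t)) (g n)) / 4))"
    by (simp add: exp_sum[symmetric] sum_negf sum_divide_distrib flip: of_real_prod)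
  finally show ?thesis .
qed

lemma char_w:
  assumes vw: "vw \<ge> 0"
  shows "expectation (\<lambda>\<omega>. iexp (Re (\<Sum>n<N. \<Sum>t\<in>{0..<int T}. g n t * w n t \<omega>))) =
    complex_of_real (exp (- (\<Sum>n<N. \<Sum>t\<in>{0..<int T}. vw * (cmod (g n t))\<^sup>2) / 4))"
proof -
  define I where "I = {..<N} \<times> {0..<int T}"
  define f where "f i z = iexp (Re (g (fst i) (snd i) * z))" for i z
  have fm: "f i \<in> borel_measurable borel" for i unfolding f_def by measurable
  have ind: "indep_vars (\<lambda>_. borel) (\<lambda>i \<omega>. f i (w (fst i) (snd i) \<omega>)) I"
    using indep_vars_compose2[OF w_indep fm] by (simp add: I_def case_prod_beta)
  have wm: "w (fst i) (snd i) \<in> borel_measurable M" if "i \<in> I" for i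
    using w_indep that by (auto simp: indep_vars_def I_def)
  have int: "integrable M (\<lambda>\<omega>. f i (w (fst i) (snd i) \<omega>))" if "i \<in> I" for i
  proof (rule integrable_const_bound[of _ 1])
    show "(\<lambda>\<omega>. f i (w (fst i) (snd i) \<omega>)) \<in> borel_measurable M"
      using ind that by (auto simp: indep_vars_def)
  qed (simp add: f_def)
  have dblr: "(\<Sum>n<N. \<Sum>t\<in>{0..<int T}. F n t) = (\<Sum>i\<in>I. F (fst i) (snd i))" for F :: "nat \<Rightarrow> int \<Rightarrow> real"
    unfolding I_def by (simp add: sum.cartesian_product case_prod_beta)
  have "expectation (\<lambda>\<omega>. iexp (Re (\<Sum>n<N. \<Sum>t\<in>{0..<int T}. g n t * w n t \<omega>))) =
      expectation (\<lambda>\<omega>. \<Prod>i\<in>I. f i (w (fst i) (snd i) \<omega>))"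
  proof -
    have I: "finite I" by (simp add: I_def)
    have "(\<Prod>i\<in>I. f i (w (fst i) (snd i) \<omega>)) = iexp (Re (\<Sum>i\<in>I. g (fst i) (snd i) * w (fst i) (snd i) \<omega>))" for \<omega>
      unfolding f_def using I by (simp add: exp_sum[symmetric] sum_distrib_left)
    then show ?thesis unfolding I_def by (simp add: sum.cartesian_product case_prod_beta)
  qed
  also have "\<dots> = (\<Prod>i\<in>I. expectation (\<lambda>\<omega>. f i (w (fst i) (snd i) \<omega>)))"
    by (rule indep_vars_lebesgue_integral[OF _ ind int]) (auto simp: I_def)
  also have "\<dots> = (\<Prod>i\<in>I. complex_of_real (exp (- vw * (cmod (g (fst i) (snd i)))\<^sup>2 / 4)))"
  proof (intro prod.cong refl)
    fix i assume i: "i \<in> I"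
    have "expectation (\<lambda>\<omega>. f i (w (fst i) (snd i) \<omega>)) = (\<integral>z. f i z \<partial>distr M borel (w (fst i) (snd i)))"
      using wm[OF i] fm by (subst integral_distr) auto
    also have "distr M borel (w (fst i) (snd i)) = complex_gaussian vw"
      using i by (intro w_law) (auto simp: I_def)
    also have "(\<integral>z. f i z \<partial>complex_gaussian vw) = complex_of_real (exp (- vw * (cmod (g (fst i) (snd i)))\<^sup>2 / 4))"
      unfolding f_def by (rule complex_gaussian_char[OF vw])
    finally show "expectation (\<lambda>\<omega>. f i (w (fst i) (snd i) \<omega>)) =
      complex_of_real (exp (- vw * (cmod (g (fst i) (snd i)))\<^sup>2 / 4))" .
  qed
  also have "\<dots> = complex_of_real (exp (- (\<Sum>n<N. \<Sum>t\<in>{0..<int T}. vw * (cmod (g n t))\<^sup>2) / 4))"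
    unfolding dblr by (simp add: I_def exp_sum[symmetric] sum_negf sum_divide_distrib flip: of_real_prod)
  finally show ?thesis .
qed

text \<open>The observed covariance matrix is Toeplitz. Up to the factor \<open>vx\<close>, each of
  its rows is a stretch of \<open>r\<close> with lags in \<open>{1 - T..T - 1}\<close>, and the
  noise adds \<open>vw\<close> on the diagonal; hence the row sum bound
  \<open>vx * K + vw\<close>.\<close>

lemma circular_gaussian_array_obs:
  assumes r: "\<And>n t k. n < N \<Longrightarrow> expectation (\<lambda>\<omega>. h n t \<omega> * cnj (h n (t - k) \<omega>)) = complex_of_real vx * r k"
    and N: "N > 0" and vx: "vx > 0" and vw: "vw \<ge> 0"
    and K: "(\<Sum>k\<in>{1 - int T..int T - 1}. cmod (r k)) \<le> K"
  shows "circular_gaussian_array M N {0..<int T} obs (obs_cov r) (vx * K + vw)"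
proof
  let ?J = "{0..<int T}"
  show "finite ?J" by simp
  have hm: "h n t \<in> borel_measurable M" if "n < N" for n t
    using process[OF that] by (rule stationary_circular_gaussian_process.measurable)
  have wm: "w n t \<in> borel_measurable M" if "n < N" "t \<in> ?J" for n t
    using w_indep that by (auto simp: indep_vars_def)
  show "obs n t \<in> borel_measurable M" for n t
    using hm[of n t] wm[of n t] by (cases "n < N \<and> t \<in> ?J") (auto simp: obs_def[abs_def])
  \<comment> \<open>Conjugation exchanges the two times. The covariance identity is used at time 0
    with lag \<open>- k\<close> and at time \<open>k\<close> with lag \<open>k\<close>, for sensor
    0, which exists by \<open>N > 0\<close>.\<close>
  have rh: "r (- k) = cnj (r k)" for k
  proof -
    have "complex_of_real vx * r (- k) = expectation (\<lambda>\<omega>. h 0 0 \<omega> * cnj (h 0 k \<omega>))"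
      using r[OF N, of 0 "- k"] by simp
    also have "\<dots> = cnj (expectation (\<lambda>\<omega>. h 0 k \<omega> * cnj (h 0 0 \<omega>)))"
      by (simp add: mult.commute flip: Bochner_Integration.integral_cnj)
    also have "expectation (\<lambda>\<omega>. h 0 k \<omega> * cnj (h 0 0 \<omega>)) = complex_of_real vx * r k"
      using r[OF N, of k k] by simp
    finally show ?thesis using vx by simp
  qed
  show herm: "obs_cov r t s = cnj (obs_cov r s t)" for s t
    using rh[of "s - t"] by (simp add: obs_cov_def)
  show "expectation (\<lambda>\<omega>. iexp (Re (\<Sum>n<N. \<Sum>t\<in>?J. g n t * obs n t \<omega>))) =
      complex_of_real (exp (- (\<Sum>n<N. cov_form ?J (obs_cov r) (g n)) / 4))" for g
  proof -
    define f where "f x = iexp (Re (\<Sum>n<N. \<Sum>t\<in>?J. g n t * x (n, t)))" for x :: "nat \<times> int \<Rightarrow> complex"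
    \<comment> \<open>Needed for two index sets: the noise array lives on the window, the processes
      on all integers.\<close>
    have fm: "f \<in> borel_measurable (\<Pi>\<^sub>M i\<in>{..<N} \<times> U. borel)" if "?J \<subseteq> U" for U
    proof -
      have [measurable]: "(\<lambda>x. \<Sum>n<N. \<Sum>t\<in>?J. g n t * x (n, t)) \<in> borel_measurable (\<Pi>\<^sub>M i\<in>{..<N} \<times> U. (borel :: complex measure))"
        using that by (intro borel_measurable_sum borel_measurable_times borel_measurable_const measurable_component_singleton) auto
      show ?thesis unfolding f_def by measurable
    qed
    let ?W = "\<lambda>\<omega>. f (\<lambda>i\<in>{..<N} \<times> ?J. w (fst i) (snd i) \<omega>)"
    let ?H = "\<lambda>\<omega>. f (\<lambda>i\<in>{..<N} \<times> UNIV. h (fst i) (snd i) \<omega>)"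
    have fw: "?W \<omega> = iexp (Re (\<Sum>n<N. \<Sum>t\<in>?J. g n t * w n t \<omega>))" for \<omega>
      unfolding f_def by (intro arg_cong[of _ _ iexp] arg_cong[of _ _ Re] sum.cong refl) auto
    have fh: "?H \<omega> = iexp (Re (\<Sum>n<N. \<Sum>t\<in>?J. g n t * h n t \<omega>))" for \<omega>
      unfolding f_def by (intro arg_cong[of _ _ iexp] arg_cong[of _ _ Re] sum.cong refl) auto
    have ind: "indep_var borel ?W borel ?H"
      using indep_var_compose[OF w_indep_h fm[OF order_refl] fm[OF subset_UNIV]] by (simp add: comp_def)
    have iW: "integrable M ?W"
      by (rule integrable_const_bound[of _ 1]) (use indep_var_rv1[OF ind] in \<open>auto simp: f_def\<close>)
    have iH: "integrable M ?H"
      by (rule integrable_const_bound[of _ 1]) (use indep_var_rv2[OF ind] in \<open>auto simp: f_def\<close>)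
    have "iexp (Re (\<Sum>n<N. \<Sum>t\<in>?J. g n t * obs n t \<omega>)) = ?W \<omega> * ?H \<omega>" for \<omega>
    proof -
      have "(\<Sum>n<N. \<Sum>t\<in>?J. g n t * obs n t \<omega>) = (\<Sum>n<N. \<Sum>t\<in>?J. g n t * w n t \<omega>) + (\<Sum>n<N. \<Sum>t\<in>?J. g n t * h n t \<omega>)"
        unfolding sum.distrib[symmetric] by (intro sum.cong refl) (auto simp: obs_def algebra_simps)
      then show ?thesis unfolding fw fh by (simp only: plus_complex.sel of_real_add distrib_left exp_add)
    qed
    then have "expectation (\<lambda>\<omega>. iexp (Re (\<Sum>n<N. \<Sum>t\<in>?J. g n t * obs n t \<omega>))) = expectation ?W * expectation ?H"
      by (simp only: indep_var_lebesgue_integral[OF ind iW iH])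
    also have "\<dots> = complex_of_real (exp (- (\<Sum>n<N. \<Sum>t\<in>?J. vw * (cmod (g n t))\<^sup>2) / 4)) *
        complex_of_real (exp (- (\<Sum>n<N. cov_form ?J (\<lambda>s t. complex_of_real vx * r (s - t)) (g n)) / 4))"
      unfolding fw fh by (simp only: char_w[OF vw] char_h[OF r finite_atLeastLessThan_int])
    also have "\<dots> = complex_of_real (exp (- (\<Sum>n<N. cov_form ?J (obs_cov r) (g n)) / 4))"
    proof -
      have "cov_form ?J (obs_cov r) (g n) = cov_form ?J (\<lambda>s t. complex_of_real vx * r (s - t)) (g n)
          + (\<Sum>t\<in>?J. vw * (cmod (g n t))\<^sup>2)" for n
        unfolding obs_cov_def[abs_def] cov_form_add by (simp add: cov_form_diag)
      then have "(\<Sum>n<N. cov_form ?J (obs_cov r) (g n)) = (\<Sum>n<N. \<Sum>t\<in>?J. vw * (cmod (g n t))\<^sup>2) +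
        (\<Sum>n<N. cov_form ?J (\<lambda>s t. complex_of_real vx * r (s - t)) (g n))"
        by (simp add: sum.distrib)
      then show ?thesis
        unfolding of_real_mult[symmetric] exp_add[symmetric] by (simp add: add_divide_distrib)
    qed
    finally show ?thesis .
  qed
  show "cov_form ?J (obs_cov r) g \<le> (vx * K + vw) * (\<Sum>t\<in>?J. (cmod (g t))\<^sup>2)" for g
  proof (rule cov_form_le_row_sums[OF _ herm])
    fix s assume s: "s \<in> ?J"
    have "(\<Sum>t\<in>?J. cmod (obs_cov r s t)) \<le> (\<Sum>t\<in>?J. vx * cmod (r (s - t)) + (if s = t then vw else 0))"
      using vx vw unfolding obs_cov_def
      by (intro sum_mono order_trans[OF norm_triangle_ineq]) (auto simp: norm_mult)
    also have "\<dots> = vx * (\<Sum>t\<in>?J. cmod (r (s - t))) + vw"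
      using s by (simp add: sum.distrib sum_distrib_left)
    also have "(\<Sum>t\<in>?J. cmod (r (s - t))) = (\<Sum>k\<in>(\<lambda>t. s - t) ` ?J. cmod (r k))"
      by (subst sum.reindex) (auto simp: inj_on_def)
    also have "\<dots> \<le> (\<Sum>k\<in>{1 - int T..int T - 1}. cmod (r k))"
      using s by (intro sum_mono2) auto
    also note K
    finally show "(\<Sum>t\<in>?J. cmod (obs_cov r s t)) \<le> vx * K + vw" using vx by simp
  qed simp
qed

end

section \<open>Toeplitz matrices and their symbols\<close>

text \<open>The grid has \<open>2 T\<close> points rather than \<open>T\<close> because the lags in \<open>{1 - T..T - 1}\<close> must stay
  distinct modulo the grid size.\<close>

definition fourier_char :: "nat \<Rightarrow> nat \<Rightarrow> int \<Rightarrow> complex" where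
  "fourier_char T m k = cis (- (pi * real m * real_of_int k / real T))"

lemma cmod_fourier_char [simp]: "cmod (fourier_char T m k) = 1"
  by (simp add: fourier_char_def)

lemma fourier_char_add: "fourier_char T m (k + l) = fourier_char T m k * fourier_char T m l"
  by (simp add: fourier_char_def cis_mult add_divide_distrib algebra_simps)

lemma cnj_fourier_char: "cnj (fourier_char T m k) = fourier_char T m (- k)"
  by (simp add: fourier_char_def cis_cnj)

lemma fourier_char_0 [simp]: "fourier_char T m 0 = 1"
  by (simp add: fourier_char_def)

lemma sum_fourier_char:
  assumes T: "T \<ge> 1" and k: "\<bar>k\<bar> < 2 * int T"
  shows "(\<Sum>m<2 * T. fourier_char T m k) = (if k = 0 then of_nat (2 * T) else 0)"
proof (cases "k = 0")
  case False
  define z where "z = cis (- (pi * real_of_int k / real T))"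
  have e: "fourier_char T m k = z ^ m" for m
  proof -
    have "z ^ m = cis (real m * - (pi * real_of_int k / real T))" unfolding z_def by (rule Complex.DeMoivre)
    then show ?thesis by (simp add: fourier_char_def mult_ac)
  qed
  have "z \<noteq> 1"
  proof
    assume "z = 1"
    then have "cos (pi * real_of_int k / real T) = 1"
      unfolding z_def by (metis cis.sel(1) cos_minus one_complex.sel(1))
    then obtain n :: int where n: "pi * real_of_int k / real T = n * 2 * pi"
      using cos_one_2pi_int by auto
    then have "real_of_int k = real_of_int (2 * n * int T)" using T by (simp add: field_simps)
    then have kn: "k = 2 * n * int T" by (simp only: of_int_eq_iff)
    with False have "n \<noteq> 0" by auto
    then have "\<bar>n\<bar> \<ge> 1" by simp
    then have "2 * int T \<le> 2 * \<bar>n\<bar> * int T" using T by (simp add: mult_le_cancel_right1)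
    also have "\<dots> = \<bar>k\<bar>" by (simp add: kn abs_mult)
    finally show False using k by simp
  qed
  moreover have "z ^ (2 * T) = 1"
  proof -
    have "z ^ (2 * T) = cis (- (2 * pi * real_of_int k))"
      unfolding z_def Complex.DeMoivre using T by (simp add: field_simps)
    also have "\<dots> = cis (2 * pi * real_of_int (- k))" by simp
    also have "\<dots> = 1" by (rule cis_multiple_2pi) simp
    finally show ?thesis .
  qed
  ultimately show ?thesis
    using False by (simp add: e geometric_sum)
qed simp

definition dft :: "nat \<Rightarrow> nat \<Rightarrow> (nat \<Rightarrow> complex) \<Rightarrow> nat \<Rightarrow> complex" where
  "dft T p x m = (\<Sum>i<p. fourier_char T m (int i) * x i)"

text \<open>\<open>x\<close> is padded with zeros up to the grid size. Differences of indices stay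
  below \<open>T\<close> in modulus, so only the diagonal terms survive the sum over the
  grid.\<close>

lemma parseval_dft:
  assumes T: "T \<ge> 1" and p: "p \<le> T"
  shows "(\<Sum>m<2 * T. (cmod (dft T p x m))\<^sup>2) = 2 * real T * (\<Sum>i<p. (cmod (x i))\<^sup>2)"
proof -
  have "complex_of_real (\<Sum>m<2 * T. (cmod (dft T p x m))\<^sup>2) =
      (\<Sum>m<2 * T. \<Sum>i<p. \<Sum>j<p. fourier_char T m (int i - int j) * (x i * cnj (x j)))"
    unfolding of_real_sum complex_norm_square dft_def cnj_sum sum_product
    by (intro sum.cong refl)
      (simp add: cnj_fourier_char fourier_char_add[of T _ _ "- _", simplified] mult_ac)
  also have "\<dots> = (\<Sum>i<p. \<Sum>j<p. (\<Sum>m<2 * T. fourier_char T m (int i - int j)) * (x i * cnj (x j)))"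
    unfolding sum_distrib_right by (subst sum.swap, rule sum.cong[OF refl], rule sum.swap)
  also have "\<dots> = (\<Sum>i<p. \<Sum>j<p. if i = j then of_nat (2 * T) * (x i * cnj (x i)) else 0)"
    using p by (intro sum.cong refl) (subst sum_fourier_char[OF T], auto)
  also have "\<dots> = (\<Sum>i<p. of_nat (2 * T) * (x i * cnj (x i)))" by simp
  also have "\<dots> = complex_of_real (2 * real T * (\<Sum>i<p. (cmod (x i))\<^sup>2))"
    unfolding sum_distrib_left of_real_sum of_real_mult complex_norm_square by simp
  finally show ?thesis by (simp only: of_real_eq_iff)
qed

text \<open>The matrix is a corner of a circulant matrix of size \<open>2 * T\<close> built from all
  lags in \<open>{1 - T..T - 1}\<close>, whose eigenvalues are the values of the symbol on the grid.
  The same circulant serves every \<open>p \<le> T\<close>.\<close>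

lemma toeplitz_form_eq_dft:
  assumes T: "T \<ge> 1" and p: "p \<le> T"
  shows "(\<Sum>i<p. \<Sum>j<p. cnj (y i) * d (int i - int j) * v j) =
    (\<Sum>m<2 * T. (\<Sum>k\<in>{1 - int T..int T - 1}. d k * fourier_char T m k) * (cnj (dft T p y m) * dft T p v m)) / of_nat (2 * T)"
proof -
  let ?K = "{1 - int T..int T - 1}"
  define f where "f m = (\<Sum>k\<in>?K. d k * fourier_char T m k)" for m
  have inv: "(\<Sum>m<2 * T. f m * fourier_char T m (int j - int i)) = of_nat (2 * T) * d (int i - int j)"
    if ij: "i < p" "j < p" for i j
  proof -
    have "(\<Sum>m<2 * T. f m * fourier_char T m (int j - int i)) =
        (\<Sum>k\<in>?K. d k * (\<Sum>m<2 * T. fourier_char T m (k + (int j - int i))))"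
      unfolding f_def fourier_char_add sum_distrib_right sum_distrib_left by (subst sum.swap) (simp add: mult_ac)
    also have "\<dots> = (\<Sum>k\<in>?K. if k = int i - int j then of_nat (2 * T) * d k else 0)"
      using ij p by (intro sum.cong refl) (subst sum_fourier_char[OF T], auto)
    also have "\<dots> = of_nat (2 * T) * d (int i - int j)"
      using ij p by simp
    finally show ?thesis .
  qed
  have "(\<Sum>m<2 * T. f m * (cnj (dft T p y m) * dft T p v m)) =
    (\<Sum>m<2 * T. \<Sum>i<p. \<Sum>j<p. cnj (y i) * v j * (f m * fourier_char T m (int j - int i)))"
    unfolding dft_def cnj_sum sum_product
    unfolding sum_distrib_left
    by (intro sum.cong refl)
      (simp add: cnj_fourier_char fourier_char_add[of T _ _ "- _", simplified] mult_ac)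
  also have "\<dots> = (\<Sum>i<p. \<Sum>j<p. cnj (y i) * v j * (\<Sum>m<2 * T. f m * fourier_char T m (int j - int i)))"
    unfolding sum_distrib_left[of "cnj _ * _"] by (subst sum.swap, rule sum.cong[OF refl], rule sum.swap)
  also have "\<dots> = (\<Sum>i<p. \<Sum>j<p. of_nat (2 * T) * (cnj (y i) * d (int i - int j) * v j))"
    by (intro sum.cong refl) (subst inv; simp add: mult_ac)
  also have "\<dots> = of_nat (2 * T) * (\<Sum>i<p. \<Sum>j<p. cnj (y i) * d (int i - int j) * v j)"
    by (simp only: sum_distrib_left)
  finally show ?thesis using T by (simp add: f_def)
qed

text \<open>Cauchy-Schwarz on the frequency side; the two factors \<open>sqrt (2 * T)\<close> from
  Parseval cancel the normalisation.\<close>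

lemma toeplitz_form_le:
  assumes T: "T \<ge> 1" and p: "p \<le> T" and B: "B \<ge> 0"
    and bound: "\<And>m. m < 2 * T \<Longrightarrow> cmod (\<Sum>k\<in>{1 - int T..int T - 1}. d k * fourier_char T m k) \<le> B"
  shows "cmod (\<Sum>i<p. \<Sum>j<p. cnj (y i) * d (int i - int j) * v j) \<le>
    B * (L2_set (\<lambda>i. cmod (y i)) {..<p} * L2_set (\<lambda>i. cmod (v i)) {..<p})"
proof -
  let ?f = "\<lambda>m. \<Sum>k\<in>{1 - int T..int T - 1}. d k * fourier_char T m k"
  have L2: "L2_set (\<lambda>m. cmod (dft T p x m)) {..<2 * T} = sqrt (2 * real T) * L2_set (\<lambda>i. cmod (x i)) {..<p}" for x
    unfolding L2_set_def parseval_dft[OF T p] by (simp add: real_sqrt_mult)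
  have "cmod (\<Sum>m<2 * T. ?f m * (cnj (dft T p y m) * dft T p v m)) \<le>
      (\<Sum>m<2 * T. B * (cmod (dft T p y m) * cmod (dft T p v m)))"
    using bound by (intro sum_norm_le) (auto simp: norm_mult intro!: mult_right_mono)
  also have "\<dots> \<le> B * (L2_set (\<lambda>m. cmod (dft T p y m)) {..<2 * T} * L2_set (\<lambda>m. cmod (dft T p v m)) {..<2 * T})"
    unfolding sum_distrib_left[symmetric]
    using B L2_set_mult_ineq[of "\<lambda>m. cmod (dft T p y m)" "\<lambda>m. cmod (dft T p v m)" "{..<2 * T}"]
    by (intro mult_left_mono) auto
  also have "\<dots> = 2 * real T * (B * (L2_set (\<lambda>i. cmod (y i)) {..<p} * L2_set (\<lambda>i. cmod (v i)) {..<p}))"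
    unfolding L2 by (simp add: mult_ac)
  finally show ?thesis
    unfolding toeplitz_form_eq_dft[OF T p] using T by (simp add: norm_divide norm_mult divide_simps mult_ac)
qed

text \<open>The bilinear bound is tested against the image vector \<open>y\<close> of
  \<open>v\<close> itself, which gives \<open>|y|\<^sup>2 \<le> B * |y|\<close>. This covers
  matrices that are not Hermitian as well.\<close>

theorem spectral_norm_toeplitz_le:
  assumes T: "T \<ge> 1" and p: "p \<in> {1..T}"
    and bound: "\<And>m. m < 2 * T \<Longrightarrow> cmod (\<Sum>k\<in>{1 - int T..int T - 1}. d k * fourier_char T m k) \<le> B"
  shows "spectral_norm (toeplitz p d) \<le> B"
proof -
  have pT: "p \<le> T" and p1: "p \<ge> 1" using p by auto
  have B: "B \<ge> 0"
    using order_trans[OF norm_ge_zero bound[of 0]] T by simp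
  have dims: "dim_col (toeplitz p d) = p" "dim_row (toeplitz p d) = p" by (simp_all add: toeplitz_def)
  have "l2_norm_vec (toeplitz p d *\<^sub>v v) \<le> B" if v: "v \<in> carrier_vec p" and v1: "l2_norm_vec v = 1" for v
  proof -
    define x where "x i = vec_index v i" for i
    define y where "y i = (\<Sum>j<p. d (int i - int j) * x j)" for i
    have y: "vec_index (toeplitz p d *\<^sub>v v) i = y i" if "i < p" for i
      using that v by (auto simp: toeplitz_def scalar_prod_def y_def x_def atLeast0LessThan intro!: sum.cong)
    have ly: "l2_norm_vec (toeplitz p d *\<^sub>v v) = L2_set (\<lambda>i. cmod (y i)) {..<p}"
    proof -
      have "dim_vec (toeplitz p d *\<^sub>v v) = p" by (simp add: dims)
      then show ?thesis
        unfolding l2_norm_vec_def by (intro L2_set_cong) (simp_all only: lessThan_iff y)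
    qed
    have lx: "L2_set (\<lambda>i. cmod (x i)) {..<p} = 1"
      using v v1 by (auto simp: l2_norm_vec_def x_def)
    define l where "l = L2_set (\<lambda>i. cmod (y i)) {..<p}"
    have l0: "l \<ge> 0" by (simp add: l_def L2_set_nonneg)
    have "complex_of_real (l\<^sup>2) = (\<Sum>i<p. cnj (y i) * y i)"
      unfolding l_def L2_set_def by (simp add: sum_nonneg complex_norm_square mult.commute flip: of_real_power)
    also have "\<dots> = (\<Sum>i<p. \<Sum>j<p. cnj (y i) * d (int i - int j) * x j)"
      by (subst (2) y_def) (simp add: sum_distrib_left mult_ac)
    finally have "l\<^sup>2 = cmod (\<Sum>i<p. \<Sum>j<p. cnj (y i) * d (int i - int j) * x j)"
      by (metis norm_of_real abs_of_nonneg zero_le_power2)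
    also have "\<dots> \<le> B * l"
      using toeplitz_form_le[OF T pT B bound, of y x] lx by (simp add: l_def)
    finally have "l * l \<le> B * l" by (simp add: power2_eq_square)
    then have "l \<le> B" using l0 B by (cases "l = 0") (auto simp: mult_le_cancel_right)
    then show ?thesis by (simp add: ly l_def)
  qed
  \<comment> \<open>The supremum needs a nonempty set of unit vectors, which
    \<open>p \<ge> 1\<close> provides.\<close>
  moreover have "\<exists>v. v \<in> carrier_vec p \<and> l2_norm_vec v = 1"
  proof (intro exI conjI)
    have "L2_set (\<lambda>i. cmod (unit_vec p 0 $ i)) {..<p} = L2_set (\<lambda>i. if i = 0 then 1 else 0) {..<p}"
      by (intro L2_set_cong) (auto simp: unit_vec_def)
    also have "\<dots> = 1" using p1 by (simp add: L2_set_def if_distrib[of "\<lambda>z. z\<^sup>2"] sum.delta cong: if_cong)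
    finally show "l2_norm_vec (unit_vec p 0 :: complex vec) = 1"
      by (simp add: l2_norm_vec_def)
  qed simp
  ultimately show ?thesis
    unfolding spectral_norm_def dims by (intro cSUP_least) auto
qed

lemma toeplitz_diff: "toeplitz p d - toeplitz p e = toeplitz p (\<lambda>k. d k - e k)"
  by (auto simp: toeplitz_def)

section \<open>Concentration of the estimates\<close>

lemma sum_lag_reindex:
  fixes G :: "int \<Rightarrow> int \<Rightarrow> int \<Rightarrow> 'b :: comm_monoid_add"
  shows "(\<Sum>k\<in>{1 - int T..int T - 1}. \<Sum>t | t \<in> {0..<int T} \<and> t + k \<in> {0..<int T}. G (t + k) t k) =
    (\<Sum>s\<in>{0..<int T}. \<Sum>t\<in>{0..<int T}. G s t (s - t))"
proof -
  have fin: "finite {t. t \<in> {0..<int T} \<and> t + k \<in> {0..<int T}}" for k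
    by (rule finite_subset[of _ "{0..<int T}"]) auto
  have "(\<Sum>k\<in>{1 - int T..int T - 1}. \<Sum>t | t \<in> {0..<int T} \<and> t + k \<in> {0..<int T}. G (t + k) t k) =
     (\<Sum>(k, t)\<in>Sigma {1 - int T..int T - 1} (\<lambda>k. {t. t \<in> {0..<int T} \<and> t + k \<in> {0..<int T}}). G (t + k) t k)"
    using fin by (subst sum.Sigma) auto
  also have "\<dots> = (\<Sum>(s, t)\<in>{0..<int T} \<times> {0..<int T}. G s t (s - t))"
    by (rule sum.reindex_bij_witness[where i = "\<lambda>(s, t). (s - t, t)" and j = "\<lambda>(k, t). (t + k, t)"]) auto
  also have "\<dots> = (\<Sum>s\<in>{0..<int T}. \<Sum>t\<in>{0..<int T}. G s t (s - t))"
    by (rule sum.cartesian_product[symmetric])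
  finally show ?thesis .
qed

lemma card_lag:
  assumes "k \<in> {1 - int T..int T - 1}"
  shows "real (card {t. t \<in> {0..<int T} \<and> t + k \<in> {0..<int T}}) = real T - \<bar>real_of_int k\<bar>"
proof (cases "k \<ge> 0")
  case True
  then have "{t. t \<in> {0..<int T} \<and> t + k \<in> {0..<int T}} = {0..<int T - k}" by auto
  then show ?thesis using True assms by simp
next
  case False
  then have "{t. t \<in> {0..<int T} \<and> t + k \<in> {0..<int T}} = {- k..<int T}" by auto
  then show ?thesis using False assms by simp
qed

text \<open>Used for the complex expected symbol and for the real sum of squared weights, hence the
  general \<open>real_vector\<close>.\<close>

lemma sum_diff_eq_sum_lag:
  fixes g :: "int \<Rightarrow> 'b :: real_vector"
  shows "(\<Sum>s\<in>{0..<int T}. \<Sum>t\<in>{0..<int T}. g (s - t)) =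
    (\<Sum>k\<in>{1 - int T..int T - 1}. (real T - \<bar>real_of_int k\<bar>) *\<^sub>R g k)"
  unfolding sum_lag_reindex[of "\<lambda>_ _ k. g k", symmetric]
  by (intro sum.cong refl) (simp only: sum_constant_scaleR card_lag)

text \<open>Both estimates, with lag weights \<open>\<nu> k = 1 / T\<close> and \<open>\<nu> k = 1 / (T - |k|)\<close>. The two agree at
  \<open>k = 0\<close>.\<close>

definition cov_est :: "(int \<Rightarrow> real) \<Rightarrow> real \<Rightarrow> real \<Rightarrow> nat \<Rightarrow> nat \<Rightarrow> (nat \<Rightarrow> int \<Rightarrow> complex) \<Rightarrow> int \<Rightarrow> complex" where
  "cov_est \<nu> vx vw N T y k = complex_of_real (\<nu> k / (vx * real N)) * lag_sum N T y k
     - (if k = 0 then complex_of_real (vw / vx) else 0)"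

lemma lag_sum_0: "lag_sum N T y 0 = complex_of_real (\<Sum>n<N. \<Sum>t\<in>{0..<int T}. (cmod (y n t))\<^sup>2)"
proof -
  have "{t. t \<in> {0..<int T} \<and> t + 0 \<in> {0..<int T}} = {0..<int T}" by auto
  then show ?thesis unfolding lag_sum_def of_real_sum complex_norm_square by simp
qed

lemma cov_est_biased_eq: "cov_est_biased vx vw N T y = cov_est (\<lambda>_. 1 / real T) vx vw N T y"
  by (rule ext) (simp add: cov_est_biased_def cov_est_def cov_est_zero_def lag_sum_0 mult_ac)

lemma cov_est_unbiased_eq:
  "cov_est_unbiased vx vw N T y = cov_est (\<lambda>k. 1 / (real T - \<bar>real_of_int k\<bar>)) vx vw N T y"
  by (rule ext) (simp add: cov_est_unbiased_def cov_est_def cov_est_zero_def lag_sum_0 mult_ac)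

text \<open>The noise correction sits at lag 0 only, so it shifts the symbol by the same constant at
  all frequencies and leaves the quadratic form untouched.\<close>

lemma symbol_cov_est:
  assumes T: "T \<ge> 1"
  shows "(\<Sum>k\<in>{1 - int T..int T - 1}. cov_est \<nu> vx vw N T y k * fourier_char T m k) =
    (\<Sum>n<N. \<Sum>s\<in>{0..<int T}. \<Sum>t\<in>{0..<int T}.
      complex_of_real (\<nu> (s - t) / vx) * fourier_char T m (s - t) * (y n s * cnj (y n t))) / of_nat N
    - complex_of_real (vw / vx)"
proof -
  let ?K = "{1 - int T..int T - 1}"
  define g where "g k = complex_of_real (\<nu> k / vx) * fourier_char T m k" for k
  have "(\<Sum>k\<in>?K. cov_est \<nu> vx vw N T y k * fourier_char T m k) =
    (\<Sum>k\<in>?K. g k * lag_sum N T y k / of_nat N) - (\<Sum>k\<in>?K. if k = 0 then complex_of_real (vw / vx) else 0)"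
    unfolding sum_subtractf[symmetric]
    by (intro sum.cong refl) (simp add: cov_est_def g_def left_diff_distrib mult_ac)
  also have "(\<Sum>k\<in>?K. if k = 0 then complex_of_real (vw / vx) else 0) = complex_of_real (vw / vx)"
    using T by simp
  also have "(\<Sum>k\<in>?K. g k * lag_sum N T y k / of_nat N) = (\<Sum>k\<in>?K. g k * lag_sum N T y k) / of_nat N"
    by (simp only: sum_divide_distrib)
  also have "(\<Sum>k\<in>?K. g k * lag_sum N T y k) = (\<Sum>n<N. \<Sum>k\<in>?K. \<Sum>t | t \<in> {0..<int T} \<and> t + k \<in> {0..<int T}.
      g k * (y n (t + k) * cnj (y n t)))"
    unfolding lag_sum_def sum_distrib_left by (rule sum.swap)
  also have "\<dots> = (\<Sum>n<N. \<Sum>s\<in>{0..<int T}. \<Sum>t\<in>{0..<int T}. g (s - t) * (y n s * cnj (y n t)))"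
    by (simp only: sum_lag_reindex[of "\<lambda>s t k. g k * (y _ s * cnj (y _ t))"])
  finally show ?thesis by (simp only: g_def)
qed

text \<open>Makes the modulus of the complex fluctuation of the symbol the absolute value of a real
  variable, to which the two-sided tail bound applies.\<close>

lemma (in circular_gaussian_array) qform_hermitian_real:
  assumes A: "\<And>s t. A t s = cnj (A s t)"
  shows "complex_of_real (Re (qform A \<omega>)) = qform A \<omega>"
    "complex_of_real (Re (expectation (qform A))) = expectation (qform A)"
proof -
  have q: "qform A \<omega> = complex_of_real (Re (qform A \<omega>))" for \<omega>
  proof -
    have "qform A \<omega> = (\<Sum>n<N. sesq J A (\<lambda>s. Y n s \<omega>) (\<lambda>s. Y n s \<omega>))"
      by (simp add: qform_def sesq_def)
    moreover have "cnj \<dots> = \<dots>" unfolding cnj_sum by (intro sum.cong refl sesq_herm[OF A, symmetric])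
    ultimately have "cnj (qform A \<omega>) = qform A \<omega>" by simp
    then have "Im (qform A \<omega>) = 0" by (simp add: complex_eq_iff)
    then show ?thesis by (simp add: complex_eq_iff)
  qed
  show "complex_of_real (Re (qform A \<omega>)) = qform A \<omega>" using q by simp
  have "expectation (qform A) = expectation (\<lambda>\<omega>. complex_of_real (Re (qform A \<omega>)))"
    using q by simp
  also have "\<dots> = complex_of_real (expectation (\<lambda>\<omega>. Re (qform A \<omega>)))"
    by (rule integral_complex_of_real)
  finally show "complex_of_real (Re (expectation (qform A))) = expectation (qform A)" by simp
qed

context ar_observation_model
begin

text \<open>Shared by both estimates. \<open>\<sigma>\<close> is the Chernoff parameter after
  \<open>vx\<close> and the covariance bound have been scaled out, \<open>L\<close> bounds the
  squared Frobenius norm of the weights, and the deterministic bias bound \<open>b\<close> is taken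
  off \<open>\<epsilon>\<close>. The factor \<open>4 * T\<close> counts two tails at each of
  \<open>2 * T\<close> frequencies.\<close>

lemma spectral_norm_cov_est_tail:
  assumes r: "\<And>n t k. n < N \<Longrightarrow> expectation (\<lambda>\<omega>. h n t \<omega> * cnj (h n (t - k) \<omega>)) = complex_of_real vx * r k"
    and N: "N > 0" and T: "T \<ge> 1" and vx: "vx > 0" and vw: "vw \<ge> 0"
    and K: "(\<Sum>k\<in>{1 - int T..int T - 1}. cmod (r k)) \<le> K" and \<kappa>: "K + vw / vx > 0"
    and \<nu>_even: "\<And>k. \<nu> (- k) = \<nu> k" and \<nu>0: "real T * \<nu> 0 = 1"
    and L: "(\<Sum>s\<in>{0..<int T}. \<Sum>t\<in>{0..<int T}. (\<nu> (s - t))\<^sup>2) \<le> L"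
    and \<sigma>: "\<sigma> > 0" "\<sigma>\<^sup>2 * L \<le> 1 / 2"
    and b: "(\<Sum>k\<in>{1 - int T..int T - 1}. \<bar>(real T - \<bar>real_of_int k\<bar>) * \<nu> k - 1\<bar> * cmod (r k)) \<le> b"
    and p: "p \<in> {1..T}"
  shows "prob {\<omega> \<in> space M. spectral_norm
      (toeplitz p (cov_est \<nu> vx vw N T (\<lambda>n t. h n t \<omega> + w n t \<omega>)) - toeplitz p r) > \<epsilon>}
    \<le> 4 * real T * exp (- real N * (\<sigma> * ((\<epsilon> - b) / (K + vw / vx)) - 2 * (\<sigma>\<^sup>2 * L)))"
proof -
  let ?J = "{0..<int T}" and ?K = "{1 - int T..int T - 1}"
  define \<kappa> where "\<kappa> = K + vw / vx"
  have \<kappa>0: "\<kappa> > 0" using \<kappa> by (simp add: \<kappa>_def)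
  have k: "vx * K + vw = vx * \<kappa>" using vx by (simp add: \<kappa>_def distrib_left)
  interpret Y: circular_gaussian_array M N ?J obs "obs_cov r" "vx * \<kappa>"
    using circular_gaussian_array_obs[OF r N vx vw K] unfolding k .
  define A where "A m s t = complex_of_real (\<nu> (s - t) / vx) * fourier_char T m (s - t)" for m s t
  have A: "A m t s = cnj (A m s t)" for m s t
    using \<nu>_even[of "s - t"] by (simp add: A_def cnj_fourier_char)
  \<comment> \<open>Lag \<open>k\<close> occurs \<open>T - |k|\<close> times. The noise contributes
    at lag 0 only, with total weight \<open>T * \<nu> 0 = 1\<close>, which is exactly the
    \<open>vw / vx\<close> that the estimate subtracts.\<close>
  have EQ: "expectation (Y.qform (A m)) / of_nat N =
      (\<Sum>k\<in>?K. complex_of_real ((real T - \<bar>real_of_int k\<bar>) * \<nu> k) * r k * fourier_char T m k) + complex_of_real (vw / vx)" for m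
  proof -
    define g where "g k = complex_of_real (\<nu> k) * r k * fourier_char T m k +
        (if k = 0 then complex_of_real (\<nu> 0 * vw / vx) else 0)" for k
    have "expectation (Y.qform (A m)) / of_nat N = (\<Sum>s\<in>?J. \<Sum>t\<in>?J. A m s t * obs_cov r s t)"
      using N by (simp add: Y.qform_expectation)
    also have "\<dots> = (\<Sum>s\<in>?J. \<Sum>t\<in>?J. g (s - t))"
      using vx by (intro sum.cong refl) (auto simp: g_def A_def obs_cov_def field_simps)
    also have "\<dots> = (\<Sum>k\<in>?K. complex_of_real ((real T - \<bar>real_of_int k\<bar>) * \<nu> k) * r k * fourier_char T m k
        + (if k = 0 then complex_of_real (real T * \<nu> 0 * (vw / vx)) else 0))"
      unfolding sum_diff_eq_sum_lag
      by (intro sum.cong refl) (auto simp: g_def scaleR_conv_of_real algebra_simps)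
    also have "\<dots> = (\<Sum>k\<in>?K. complex_of_real ((real T - \<bar>real_of_int k\<bar>) * \<nu> k) * r k * fourier_char T m k)
        + complex_of_real (vw / vx)"
      using T \<nu>0 by (simp add: sum.distrib)
    finally show ?thesis .
  qed
  let ?y = "\<lambda>\<omega> n t. h n t \<omega> + w n t \<omega>"
  define d where "d \<omega> k = cov_est \<nu> vx vw N T (?y \<omega>) k - r k" for \<omega> k
  have symb: "cmod (\<Sum>k\<in>?K. d \<omega> k * fourier_char T m k) \<le>
      \<bar>Re (Y.qform (A m) \<omega>) - Re (expectation (Y.qform (A m)))\<bar> / real N + b" for m \<omega>
  proof -
    have q: "Y.qform (A m) \<omega> = (\<Sum>n<N. \<Sum>s\<in>?J. \<Sum>t\<in>?J. complex_of_real (\<nu> (s - t) / vx) * fourier_char T m (s - t)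
        * (?y \<omega> n s * cnj (?y \<omega> n t)))"
      unfolding Y.qform_def A_def by (intro sum.cong refl) (simp add: obs_def)
    define D where "D = Y.qform (A m) \<omega> - expectation (Y.qform (A m))"
    \<comment> \<open>The bias of the symbol: its lag \<open>k\<close> is off by the factor
      \<open>(T - |k|) * \<nu> k - 1\<close>.\<close>
    define R where "R = (\<Sum>k\<in>?K. complex_of_real ((real T - \<bar>real_of_int k\<bar>) * \<nu> k - 1) * r k * fourier_char T m k)"
    have R: "R = expectation (Y.qform (A m)) / of_nat N - complex_of_real (vw / vx) - (\<Sum>k\<in>?K. r k * fourier_char T m k)"
      unfolding EQ R_def by (simp add: left_diff_distrib sum_subtractf)
    have "(\<Sum>k\<in>?K. d \<omega> k * fourier_char T m k) =
      (\<Sum>k\<in>?K. cov_est \<nu> vx vw N T (?y \<omega>) k * fourier_char T m k) - (\<Sum>k\<in>?K. r k * fourier_char T m k)"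
      by (simp add: d_def left_diff_distrib sum_subtractf)
    then have "(\<Sum>k\<in>?K. d \<omega> k * fourier_char T m k) = D / of_nat N + R"
      unfolding symbol_cov_est[OF T] q[symmetric] R D_def by (simp add: diff_divide_distrib)
    then have "cmod (\<Sum>k\<in>?K. d \<omega> k * fourier_char T m k) \<le> cmod (D / of_nat N) + cmod R"
      by (simp only: norm_triangle_ineq)
    moreover have "cmod R \<le> (\<Sum>k\<in>?K. \<bar>(real T - \<bar>real_of_int k\<bar>) * \<nu> k - 1\<bar> * cmod (r k))"
      unfolding R_def
      by (intro sum_norm_le) (simp only: norm_mult norm_of_real cmod_fourier_char mult_1_right order_refl)
    moreover have "cmod (D / of_nat N) = \<bar>Re (Y.qform (A m) \<omega>) - Re (expectation (Y.qform (A m)))\<bar> / real N"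
    proof -
      have "complex_of_real (Re D) = D"
        using Y.qform_hermitian_real[where A = "A m", OF A] by (simp add: D_def)
      then have "cmod D = \<bar>Re D\<bar>" by (metis norm_of_real)
      then show ?thesis by (simp add: norm_divide D_def)
    qed
    ultimately show ?thesis using b by linarith
  qed
  define E where "E m = {\<omega> \<in> space M. \<bar>Re (Y.qform (A m) \<omega>) - Re (expectation (Y.qform (A m)))\<bar> > real N * (\<epsilon> - b)}" for m
  have Em: "E m \<in> events" for m unfolding E_def by measurable
  have F: "(\<Sum>t\<in>?J. \<Sum>s\<in>?J. (cmod (A m s t))\<^sup>2) = (\<Sum>s\<in>?J. \<Sum>t\<in>?J. (\<nu> (s - t))\<^sup>2) / vx\<^sup>2" for m
    unfolding A_def norm_mult cmod_fourier_char norm_of_real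
    by (subst sum.swap) (simp add: power_divide sum_divide_distrib)
  \<comment> \<open>\<open>vx\<close> cancels: the weights carry \<open>1 / vx\<close> and the
    covariance bound carries \<open>vx\<close>.\<close>
  have F': "(\<sigma> / \<kappa>)\<^sup>2 * (vx * \<kappa>)\<^sup>2 * (\<Sum>t\<in>?J. \<Sum>s\<in>?J. (cmod (A m s t))\<^sup>2) = \<sigma>\<^sup>2 * (\<Sum>s\<in>?J. \<Sum>t\<in>?J. (\<nu> (s - t))\<^sup>2)" for m
    unfolding F using vx \<kappa>0 by (simp add: power_divide power_mult_distrib)
  have Fle: "\<sigma>\<^sup>2 * (\<Sum>s\<in>?J. \<Sum>t\<in>?J. (\<nu> (s - t))\<^sup>2) \<le> \<sigma>\<^sup>2 * L"
    using L by (intro mult_left_mono) auto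
  have tail: "prob (E m) \<le> 2 * exp (- real N * (\<sigma> * ((\<epsilon> - b) / \<kappa>) - 2 * (\<sigma>\<^sup>2 * L)))" for m
  proof -
    have "prob (E m) \<le> 2 * exp (real N * (2 * (\<sigma>\<^sup>2 * (\<Sum>s\<in>?J. \<Sum>t\<in>?J. (\<nu> (s - t))\<^sup>2))) - \<sigma> / \<kappa> * (real N * (\<epsilon> - b)))"
      using Y.qform_tail[of "A m" "\<sigma> / \<kappa>" "real N * (\<epsilon> - b)", OF A] vx \<kappa>0 \<sigma> Fle
      unfolding F' E_def by simp
    also have "\<dots> \<le> 2 * exp (real N * (2 * (\<sigma>\<^sup>2 * L)) - \<sigma> / \<kappa> * (real N * (\<epsilon> - b)))"
      using Fle by (simp add: mult_left_mono)
    also have "\<dots> = 2 * exp (- real N * (\<sigma> * ((\<epsilon> - b) / \<kappa>) - 2 * (\<sigma>\<^sup>2 * L)))"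
      by (simp add: algebra_simps diff_divide_distrib)
    finally show ?thesis .
  qed
  \<comment> \<open>Monotonicity of the measure asks for measurability of the covering union, so the
    spectral norm itself is never treated as a random variable.\<close>
  have "{\<omega> \<in> space M. spectral_norm (toeplitz p (cov_est \<nu> vx vw N T (?y \<omega>)) - toeplitz p r) > \<epsilon>} \<subseteq> (\<Union>m<2 * T. E m)"
  proof
    fix \<omega> assume \<omega>: "\<omega> \<in> {\<omega> \<in> space M. spectral_norm (toeplitz p (cov_est \<nu> vx vw N T (?y \<omega>)) - toeplitz p r) > \<epsilon>}"
    show "\<omega> \<in> (\<Union>m<2 * T. E m)"
    proof (rule ccontr)
      assume "\<omega> \<notin> (\<Union>m<2 * T. E m)"
      then have le: "\<bar>Re (Y.qform (A m) \<omega>) - Re (expectation (Y.qform (A m)))\<bar> \<le> real N * (\<epsilon> - b)" if "m < 2 * T" for m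
        using that \<omega> by (auto simp: E_def not_less)
      have "cmod (\<Sum>k\<in>?K. d \<omega> k * fourier_char T m k) \<le> \<epsilon>" if "m < 2 * T" for m
      proof -
        have "\<bar>Re (Y.qform (A m) \<omega>) - Re (expectation (Y.qform (A m)))\<bar> / real N \<le> \<epsilon> - b"
          using le[OF that] N by (simp add: divide_le_eq mult.commute)
        with symb[of \<omega> m] show ?thesis by simp
      qed
      then have "spectral_norm (toeplitz p (d \<omega>)) \<le> \<epsilon>"
        by (rule spectral_norm_toeplitz_le[OF T p])
      then show False using \<omega> unfolding toeplitz_diff d_def by simp
    qed
  qed
  then have "prob {\<omega> \<in> space M. spectral_norm (toeplitz p (cov_est \<nu> vx vw N T (?y \<omega>)) - toeplitz p r) > \<epsilon>}
      \<le> prob (\<Union>m<2 * T. E m)"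
    using Em by (intro finite_measure_mono) auto
  also have "\<dots> \<le> (\<Sum>m<2 * T. prob (E m))"
    using Em by (intro measure_UNION_le) auto
  also have "\<dots> \<le> (\<Sum>m<2 * T. 2 * exp (- real N * (\<sigma> * ((\<epsilon> - b) / \<kappa>) - 2 * (\<sigma>\<^sup>2 * L))))"
    by (intro sum_mono tail)
  finally show ?thesis by (simp add: \<kappa>_def)
qed

end

text \<open>The bias of the biased estimate. Lags beyond a fixed \<open>m\<close> are controlled by
  the tail of a convergent sum, since \<open>|k| / T \<le> 1\<close>; the lags below
  \<open>m\<close> carry the factor \<open>m / T\<close>.\<close>

lemma weighted_lag_sum_tendsto_0:
  fixes u :: "int \<Rightarrow> real"
  assumes u: "\<And>k. u k \<ge> 0" and K: "\<And>T. T \<ge> 1 \<Longrightarrow> (\<Sum>k\<in>{1 - int T..int T - 1}. u k) \<le> K"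
  shows "(\<lambda>T. \<Sum>k\<in>{1 - int T..int T - 1}. \<bar>real_of_int k\<bar> / real T * u k) \<longlonglongrightarrow> 0"
proof (rule LIMSEQ_I)
  fix \<eta> :: real assume \<eta>: "\<eta> > 0"
  define S where "S T = (\<Sum>k\<in>{1 - int T..int T - 1}. u k)" for T
  have S_mono: "S m \<le> S n" if "m \<le> n" for m n
    unfolding S_def using that u by (intro sum_mono2) auto
  have S0: "S n \<ge> 0" for n unfolding S_def using u by (intro sum_nonneg) auto
  have SK: "S n \<le> K" for n
    using K[of n] K[of 1] S0[of 1] u by (cases "n = 0") (auto simp: S_def intro: order_trans)
  have "Bseq S" by (rule BseqI'[of _ K]) (use S0 SK in auto)
  then have "convergent S" using S_mono by (intro Bseq_mono_convergent) auto
  then have "Cauchy S" by (rule convergent_Cauchy)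
  then obtain m where m: "\<And>n. n \<ge> m \<Longrightarrow> dist (S n) (S m) < \<eta> / 2"
    unfolding Cauchy_def using \<eta> by (metis half_gt_zero order_refl)
  obtain n0 :: nat where n0: "real m * K / (\<eta> / 2) < real n0"
    using reals_Archimedean2 by blast
  show "\<exists>no. \<forall>n\<ge>no. norm ((\<Sum>k\<in>{1 - int n..int n - 1}. \<bar>real_of_int k\<bar> / real n * u k) - 0) < \<eta>"
  proof (intro exI allI impI)
    fix n assume n: "n \<ge> max (max m n0) 1"
    let ?A = "{1 - int m..int m - 1}" and ?B = "{1 - int n..int n - 1}"
    have AB: "?A \<subseteq> ?B" using n by auto
    have n1: "real n > 0" using n by simp
    have "(\<Sum>k\<in>?B. \<bar>real_of_int k\<bar> / real n * u k) =
        (\<Sum>k\<in>?B - ?A. \<bar>real_of_int k\<bar> / real n * u k) + (\<Sum>k\<in>?A. \<bar>real_of_int k\<bar> / real n * u k)"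
      using AB by (intro sum.subset_diff) auto
    also have "\<dots> \<le> (\<Sum>k\<in>?B - ?A. 1 * u k) + (\<Sum>k\<in>?A. real m / real n * u k)"
      using n1 u by (intro add_mono sum_mono mult_right_mono) (auto simp: divide_simps)
    also have "(\<Sum>k\<in>?B - ?A. 1 * u k) = S n - S m"
      using AB by (simp add: S_def sum_diff)
    also have "(\<Sum>k\<in>?A. real m / real n * u k) = real m / real n * S m"
      by (simp add: S_def sum_distrib_left)
    also have "S n - S m < \<eta> / 2" 
    proof -
      have "m \<le> n" using n by simp
      from m[OF this] show ?thesis unfolding dist_real_def by linarith
    qed
    also have "real m / real n * S m \<le> real m * K / real n"
      using SK[of m] n1 by (simp add: divide_right_mono mult_left_mono)
    also have "\<dots> \<le> \<eta> / 2"
    proof -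
      have "real m * K / (\<eta> / 2) < real n" using n0 n by (smt (verit) of_nat_le_iff max.boundedE)
      then have "real m * K < real n * (\<eta> / 2)" using \<eta> by (simp add: divide_less_eq)
      then show ?thesis using n1 by (simp add: divide_le_eq mult.commute)
    qed
    finally have "(\<Sum>k\<in>?B. \<bar>real_of_int k\<bar> / real n * u k) < \<eta>" by simp
    moreover have "(\<Sum>k\<in>?B. \<bar>real_of_int k\<bar> / real n * u k) \<ge> 0"
      using u by (intro sum_nonneg) simp
    ultimately show "norm ((\<Sum>k\<in>?B. \<bar>real_of_int k\<bar> / real n * u k) - 0) < \<eta>" by simp
  qed
qed

text \<open>Lag \<open>k\<close> occurs \<open>T - |k|\<close> times with the square of its inverse
  as weight, which leaves one harmonic sum for each sign of the lag. This is the source of the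
  logarithm in the unbiased rate.\<close>

lemma unbiased_weights_square_sum_le:
  assumes T: "T \<ge> 1"
  shows "(\<Sum>s\<in>{0..<int T}. \<Sum>t\<in>{0..<int T}. (1 / (real T - \<bar>real_of_int (s - t)\<bar>))\<^sup>2) \<le> 2 * (1 + ln (real T))"
proof -
  let ?g = "\<lambda>k. 1 / (real T - \<bar>real_of_int k\<bar>)"
  have harm: "harm T = (\<Sum>i\<in>{1..int T}. 1 / real_of_int i)"
    unfolding harm_def
    by (rule sum.reindex_bij_witness[where i = nat and j = int]) (auto simp: inverse_eq_divide)
  have "(\<Sum>s\<in>{0..<int T}. \<Sum>t\<in>{0..<int T}. (?g (s - t))\<^sup>2) =
      (\<Sum>k\<in>{1 - int T..int T - 1}. (real T - \<bar>real_of_int k\<bar>) *\<^sub>R (?g k)\<^sup>2)"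
    by (rule sum_diff_eq_sum_lag)
  also have "\<dots> = (\<Sum>k\<in>{1 - int T..int T - 1}. ?g k)"
    by (intro sum.cong refl) (auto simp: power2_eq_square)
  \<comment> \<open>Lag 0 is counted in both halves, which only enlarges the bound.\<close>
  also have "{1 - int T..int T - 1} = {1 - int T..0} \<union> {0..int T - 1}" using T by auto
  also have "(\<Sum>k\<in>{1 - int T..0} \<union> {0..int T - 1}. ?g k) \<le> (\<Sum>k\<in>{1 - int T..0}. ?g k) + (\<Sum>k\<in>{0..int T - 1}. ?g k)"
    by (subst sum_Un) (auto intro!: sum_nonneg)
  also have "(\<Sum>k\<in>{1 - int T..0}. ?g k) = harm T"
    unfolding harm by (rule sum.reindex_bij_witness[where i = "\<lambda>i. i - int T" and j = "\<lambda>k. k + int T"]) auto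
  also have "(\<Sum>k\<in>{0..int T - 1}. ?g k) = harm T"
    unfolding harm by (rule sum.reindex_bij_witness[where i = "\<lambda>i. int T - i" and j = "\<lambda>k. int T - k"]) auto
  also have "harm T + harm T \<le> 2 * (1 + ln (real T))"
    \<comment> \<open>\<open>harm T - ln T\<close> decreases from its value 1 at
      \<open>T = 1\<close>.\<close>
    using euler_mascheroni_sequence_decreasing[of 1 T] T by (simp add: harm_expand)
  finally show ?thesis .
qed

text \<open>Here \<open>u\<close> is \<open>\<epsilon>\<close> in units of the covariance bound. Half of it is given up to the bias, and a
  factor 2 is kept on the right for the passage from \<open>N T\<close> to \<open>c / 2 * T\<close>.\<close>

lemma sub_exponential_optimum:
  fixes u :: real
  assumes u: "u > 0"
  obtains \<sigma> where "\<sigma> > 0" "\<sigma>\<^sup>2 * 1 \<le> 1 / 2" "\<sigma> * (u / 2) - 2 * (\<sigma>\<^sup>2 * 1) \<ge> 2 * (u / 16 - ln (1 + u / 16))"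
proof (cases "u \<le> 4")
  \<comment> \<open>\<open>u / 8\<close> is the unconstrained maximiser of
    \<open>\<sigma> * u / 2 - 2 * \<sigma>\<^sup>2\<close>. Both sides of the claim are quadratic in
    this range.\<close>
  case True
  have "ln (1 + u / 16) \<ge> u / 16 - (u / 16)\<^sup>2"
    using u True by (intro ln_one_plus_pos_lower_bound) auto
  then have "2 * (u / 16 - ln (1 + u / 16)) \<le> 2 * (u / 16)\<^sup>2" by simp
  also have "\<dots> \<le> u / 8 * (u / 2) - 2 * ((u / 8)\<^sup>2 * 1)"
    using u by (simp add: power2_eq_square field_simps)
  finally show ?thesis
    using u True power_mono[of "u / 8" "1 / 2" 2] by (intro that[of "u / 8"]) (auto simp: power2_eq_square)
next
  \<comment> \<open>The maximiser would exceed 1/2, so \<open>\<sigma>\<close> stops there. The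
    value \<open>u / 4 - 1 / 2\<close> is at least \<open>u / 8\<close>, and the logarithm is simply
    dropped.\<close>
  case False
  have ln: "ln (1 + u / 16) \<ge> 0" using u by simp
  have "2 * (u / 16 - l) \<le> 1 / 2 * (u / 2) - 2 * ((1 / 2)\<^sup>2 * 1)" if "l \<ge> 0" for l
    using that False by (simp add: power2_eq_square)
  from this[OF ln] have "2 * (u / 16 - ln (1 + u / 16)) \<le> 1 / 2 * (u / 2) - 2 * ((1 / 2)\<^sup>2 * 1)" .
  then show ?thesis by (intro that[of "1 / 2"]) (auto simp: power2_eq_square)
qed

text \<open>The sequences \<open>C\<close> and \<open>C'\<close> are realised by constants;
  boundedness of \<open>1 / C'\<close> keeps the second rate from degenerating.
  \<open>\<delta>\<close> and \<open>\<delta>'\<close> are chosen after \<open>\<epsilon>\<close>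
  but before \<open>T\<close> and \<open>p\<close>, so the bounds are uniform in
  \<open>p\<close>.\<close>

theorem lemma2:
  fixes M :: "nat \<Rightarrow> 'a measure"
    and N :: "nat \<Rightarrow> nat"
    and q :: nat
    and a :: "nat \<Rightarrow> real"
    and vx vw c K :: real
    and h x w :: "nat \<Rightarrow> nat \<Rightarrow> int \<Rightarrow> 'a \<Rightarrow> complex"
    and r :: "int \<Rightarrow> complex"
  assumes "q \<ge> 1" and "vx > 0" and "vw \<ge> 0"
    and model: "\<And>T. T \<ge> 1 \<Longrightarrow>
      ar_observation_model (M T) (N T) T q a vx vw (h T) (x T) (w T)"
    and r_def: "\<And>T n t k. T \<ge> 1 \<Longrightarrow> n < N T \<Longrightarrow>
      r k = (\<integral>\<omega>. h T n t \<omega> * cnj (h T n (t - k) \<omega>) \<partial>M T) / complex_of_real vx"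
    and r_bound: "\<And>T. T \<ge> 1 \<Longrightarrow> (\<Sum>k\<in>{1 - int T..int T - 1}. cmod (r k)) \<le> K"
    and c_pos: "c > 0"
    and regime: "(\<lambda>T. real (N T) / real T) \<longlonglongrightarrow> c"
  shows "\<exists>C C' :: nat \<Rightarrow> real.
    (\<forall>T. C T > 0) \<and> (\<forall>T. C' T > 0) \<and> Bseq C \<and> Bseq C' \<and> Bseq (\<lambda>T. 1 / C' T) \<and>
    (\<forall>\<epsilon>>0. \<exists>\<delta> \<delta>' :: nat \<Rightarrow> real. \<delta> \<longlonglongrightarrow> 0 \<and> \<delta>' \<longlonglongrightarrow> 0 \<and>
      (\<forall>T\<ge>1. \<forall>p\<in>{1..T}.
        measure (M T) {\<omega> \<in> space (M T).
            spectral_norm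
              (toeplitz p (cov_est_biased vx vw (N T) T (\<lambda>n t. h T n t \<omega> + w T n t \<omega>))
               - toeplitz p r) > \<epsilon>}
          \<le> exp (- c * real T * (\<epsilon> / C T - ln (1 + \<epsilon> / C T) + \<delta> T)) \<and>
        measure (M T) {\<omega> \<in> space (M T).
            spectral_norm
              (toeplitz p (cov_est_unbiased vx vw (N T) T (\<lambda>n t. h T n t \<omega> + w T n t \<omega>))
               - toeplitz p r) > \<epsilon>}
          \<le> exp (- (C' T * real T * \<epsilon>\<^sup>2 / ln (real T)) * (1 + \<delta>' T))))"
proof -
  \<comment> \<open>The covariance bound divided by \<open>vx\<close>. Enlarging \<open>K\<close> to
    \<open>|K| + 1\<close> guarantees positivity for any \<open>r\<close>.\<close>
  define \<kappa> where "\<kappa> = \<bar>K\<bar> + 1 + vw / vx"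
  have \<kappa>: "\<kappa> > 0" using \<open>vx > 0\<close> \<open>vw \<ge> 0\<close> by (simp add: \<kappa>_def add_pos_nonneg)
  have rK: "(\<Sum>k\<in>{1 - int T..int T - 1}. cmod (r k)) \<le> \<bar>K\<bar> + 1" if "T \<ge> 1" for T
    using r_bound[OF that] by simp
  have prob: "prob_space (M T)" if "T \<ge> 1" for T
    using model[OF that] by (simp add: ar_observation_model_def)
  have cov: "(\<integral>\<omega>. h T n t \<omega> * cnj (h T n (t - k) \<omega>) \<partial>M T) = complex_of_real vx * r k"
    if "T \<ge> 1" "n < N T" for T n t k
    using r_def[OF that, of k t] \<open>vx > 0\<close> by simp
  \<comment> \<open>Half of the limiting ratio is enough: the loss goes into \<open>C\<close> and
    \<open>C'\<close>, and no rate of convergence of \<open>N T / T\<close> is involved.\<close>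
  have N_large: "\<forall>\<^sub>F T in sequentially. T \<ge> 1 \<and> real (N T) \<ge> c / 2 * real T \<and> N T > 0"
  proof -
    have "\<forall>\<^sub>F T in sequentially. real (N T) / real T > c / 2"
      using regime c_pos by (intro order_tendstoD) auto
    then show ?thesis using eventually_ge_at_top[of "1 :: nat"]
    proof eventually_elim
      case (elim T)
      then have "real (N T) > c / 2 * real T" by (simp add: less_divide_eq)
      moreover have "c / 2 * real T > 0" using c_pos elim by simp
      ultimately have "real (N T) > 0" by linarith
      with \<open>real (N T) > c / 2 * real T\<close> elim show ?case by simp
    qed
  qed
  \<comment> \<open>The 16 is the scaling in \<open>sub_exponential_optimum\<close> with
    \<open>u = \<epsilon> / \<kappa>\<close>. In \<open>C'\<close> the 64 is the product of 8 from
    Chernoff's optimum, 4 from \<open>L \<le> 4 * ln T\<close> and 2 from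
    \<open>N T \<ge> c / 2 * T\<close>.\<close>
  define C where "C = 16 * \<kappa>"
  define C' where "C' = c / (64 * \<kappa>\<^sup>2)"
  have C: "C > 0" "C' > 0" using \<kappa> c_pos by (simp_all add: C_def C'_def)
  have *: "\<exists>\<delta> \<delta>' :: nat \<Rightarrow> real. \<delta> \<longlonglongrightarrow> 0 \<and> \<delta>' \<longlonglongrightarrow> 0 \<and>
      (\<forall>T\<ge>1. \<forall>p\<in>{1..T}.
        measure (M T) {\<omega> \<in> space (M T).
            spectral_norm
              (toeplitz p (cov_est_biased vx vw (N T) T (\<lambda>n t. h T n t \<omega> + w T n t \<omega>))
               - toeplitz p r) > \<epsilon>}
          \<le> exp (- c * real T * (\<epsilon> / C - ln (1 + \<epsilon> / C) + \<delta> T)) \<and>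
        measure (M T) {\<omega> \<in> space (M T).
            spectral_norm
              (toeplitz p (cov_est_unbiased vx vw (N T) T (\<lambda>n t. h T n t \<omega> + w T n t \<omega>))
               - toeplitz p r) > \<epsilon>}
          \<le> exp (- (C' * real T * \<epsilon>\<^sup>2 / ln (real T)) * (1 + \<delta>' T)))"
    if \<epsilon>: "\<epsilon> > 0" for \<epsilon>
  proof -
    define f where "f = \<epsilon> / C - ln (1 + \<epsilon> / C)"
    define b where "b T = (\<Sum>k\<in>{1 - int T..int T - 1}. \<bar>real_of_int k\<bar> / real T * cmod (r k))" for T
    define good where "good T \<longleftrightarrow> (T \<ge> 1 \<and> real (N T) \<ge> c / 2 * real T \<and> N T > 0) \<and> b T \<le> \<epsilon> / 2" for T
    \<comment> \<open>\<open>1 \<le> ln T\<close> excludes a vanishing denominator and lets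
      \<open>L\<close> be at most \<open>4 * ln T\<close>; the other condition makes the optimal
      \<open>\<sigma>\<close> admissible.\<close>
    define good' where "good' T \<longleftrightarrow> (T \<ge> 1 \<and> real (N T) \<ge> c / 2 * real T \<and> N T > 0) \<and>
      (1 \<le> ln (real T) \<and> \<epsilon>\<^sup>2 / (16 * \<kappa>\<^sup>2) \<le> ln (real T))" for T
    \<comment> \<open>In the good case the correction absorbs the prefactor \<open>4 * T\<close>.
      For the remaining \<open>T\<close>, finitely many, the exponent becomes 0 and the bound is the
      trivial 1.\<close>
    define \<delta> where "\<delta> T = (if good T then - ln (4 * real T) / (c * real T) else - f)" for T
    define \<delta>' where "\<delta>' T = (if good' T then - (ln (4 * real T) * ln (real T) / (C' * real T * \<epsilon>\<^sup>2)) else - 1)" for T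
    have "eventually good sequentially"
    proof -
      have "b \<longlonglongrightarrow> 0" unfolding b_def by (rule weighted_lag_sum_tendsto_0[OF _ r_bound]) auto
      then have "\<forall>\<^sub>F T in sequentially. b T < \<epsilon> / 2" using \<epsilon> by (intro order_tendstoD) auto
      with N_large show ?thesis unfolding good_def by eventually_elim simp
    qed
    then have ev: "\<forall>\<^sub>F T in sequentially. - ln (4 * real T) / (c * real T) = \<delta> T"
      by eventually_elim (simp add: \<delta>_def)
    have "(\<lambda>T. - ln (4 * real T) / (c * real T)) \<longlonglongrightarrow> 0"
      using c_pos by real_asymp
    then have \<delta>_lim: "\<delta> \<longlonglongrightarrow> 0" using ev by (rule Lim_transform_eventually)
    have "eventually good' sequentially"
    proof -
      have "filterlim (\<lambda>T. ln (real T)) at_top sequentially" by real_asymp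
      then have "\<forall>\<^sub>F T in sequentially. max 1 (\<epsilon>\<^sup>2 / (16 * \<kappa>\<^sup>2)) \<le> ln (real T)"
        by (rule filterlim_at_top[THEN iffD1, rule_format])
      with N_large show ?thesis unfolding good'_def by eventually_elim simp
    qed
    then have ev': "\<forall>\<^sub>F T in sequentially. - (ln (4 * real T) * ln (real T) / (C' * real T * \<epsilon>\<^sup>2)) = \<delta>' T"
      by eventually_elim (simp add: \<delta>'_def)
    have "(\<lambda>T. - (ln (4 * real T) * ln (real T) / (C' * real T * \<epsilon>\<^sup>2))) \<longlonglongrightarrow> 0"
      using C \<epsilon> by real_asymp
    then have \<delta>'_lim: "\<delta>' \<longlonglongrightarrow> 0" using ev' by (rule Lim_transform_eventually)
    have biased: "measure (M T) {\<omega> \<in> space (M T).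
            spectral_norm
              (toeplitz p (cov_est_biased vx vw (N T) T (\<lambda>n t. h T n t \<omega> + w T n t \<omega>))
               - toeplitz p r) > \<epsilon>} \<le> exp (- c * real T * (f + \<delta> T))"
      if T: "T \<ge> 1" and p: "p \<in> {1..T}" for T p
    proof (cases "good T")
      case False
      then show ?thesis using prob_space.prob_le_1[OF prob[OF T]] by (simp add: \<delta>_def)
    next
      case True
      interpret ar_observation_model "M T" "N T" T q a vx vw "h T" "x T" "w T" by (rule model[OF T])
      have NT: "N T > 0" "real (N T) \<ge> c / 2 * real T" and bT: "b T \<le> \<epsilon> / 2" using True by (auto simp: good_def)
      obtain \<sigma> where \<sigma>: "\<sigma> > 0" "\<sigma>\<^sup>2 * 1 \<le> 1 / 2"
        "\<sigma> * (\<epsilon> / \<kappa> / 2) - 2 * (\<sigma>\<^sup>2 * 1) \<ge> 2 * (\<epsilon> / \<kappa> / 16 - ln (1 + \<epsilon> / \<kappa> / 16))"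
        using sub_exponential_optimum[of "\<epsilon> / \<kappa>"] \<epsilon> \<kappa> by (metis divide_pos_pos)
      have L: "(\<Sum>s\<in>{0..<int T}. \<Sum>t\<in>{0..<int T}. (1 / real T)\<^sup>2) \<le> 1"
        using T by (simp add: power2_eq_square)
      have bb: "(\<Sum>k\<in>{1 - int T..int T - 1}. \<bar>(real T - \<bar>real_of_int k\<bar>) * (1 / real T) - 1\<bar> * cmod (r k)) \<le> b T"
        unfolding b_def using T by (intro eq_refl sum.cong refl) (auto simp: diff_divide_distrib)
      have "2 * f \<le> \<sigma> * ((\<epsilon> / 2) / \<kappa>) - 2 * (\<sigma>\<^sup>2 * 1)" using \<sigma>(3) by (simp add: f_def C_def mult_ac)
      also have "\<dots> \<le> \<sigma> * ((\<epsilon> - b T) / \<kappa>) - 2 * (\<sigma>\<^sup>2 * 1)"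
        using \<sigma>(1) \<kappa> bT by (intro diff_right_mono mult_left_mono divide_right_mono) auto
      finally have ff: "2 * f \<le> \<sigma> * ((\<epsilon> - b T) / \<kappa>) - 2 * (\<sigma>\<^sup>2 * 1)" .
      have f0: "f \<ge> 0" unfolding f_def using \<epsilon> C by (simp add: ln_add_one_self_le_self)
      have "prob {\<omega> \<in> space (M T). spectral_norm
              (toeplitz p (cov_est_biased vx vw (N T) T (\<lambda>n t. h T n t \<omega> + w T n t \<omega>)) - toeplitz p r) > \<epsilon>}
          \<le> 4 * real T * exp (- real (N T) * (\<sigma> * ((\<epsilon> - b T) / \<kappa>) - 2 * (\<sigma>\<^sup>2 * 1)))"
        unfolding cov_est_biased_eq \<kappa>_def
        by (rule spectral_norm_cov_est_tail[OF cov[OF T] NT(1) T \<open>vx > 0\<close> \<open>vw \<ge> 0\<close> rK[OF T]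
              \<kappa>[unfolded \<kappa>_def] refl _ L \<sigma>(1,2) bb p]) (use T in auto)
      also have "\<dots> \<le> 4 * real T * exp (- (c * real T * f))"
      proof -
        have "c * real T * f = (c / 2 * real T) * (2 * f)" by simp
        also have "\<dots> \<le> real (N T) * (\<sigma> * ((\<epsilon> - b T) / \<kappa>) - 2 * (\<sigma>\<^sup>2 * 1))"
          using NT ff f0 by (intro mult_mono) auto
        finally show ?thesis by (intro mult_left_mono) auto
      qed
      also have "\<dots> = exp (- c * real T * (f + \<delta> T))"
      proof -
        have "- c * real T * (f + \<delta> T) = ln (4 * real T) - c * real T * f"
          using True T c_pos by (simp add: \<delta>_def field_simps)
        then show ?thesis using T by (simp add: exp_diff exp_minus divide_inverse)
      qed
      finally show ?thesis .
    qed
    have unbiased: "measure (M T) {\<omega> \<in> space (M T).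
            spectral_norm
              (toeplitz p (cov_est_unbiased vx vw (N T) T (\<lambda>n t. h T n t \<omega> + w T n t \<omega>))
               - toeplitz p r) > \<epsilon>} \<le> exp (- (C' * real T * \<epsilon>\<^sup>2 / ln (real T)) * (1 + \<delta>' T))"
      if T: "T \<ge> 1" and p: "p \<in> {1..T}" for T p
    proof (cases "good' T")
      case False
      then show ?thesis using prob_space.prob_le_1[OF prob[OF T]] by (simp add: \<delta>'_def)
    next
      case True
      interpret ar_observation_model "M T" "N T" T q a vx vw "h T" "x T" "w T" by (rule model[OF T])
      have NT: "N T > 0" "real (N T) \<ge> c / 2 * real T"
        and lnT: "1 \<le> ln (real T)" "\<epsilon>\<^sup>2 / (16 * \<kappa>\<^sup>2) \<le> ln (real T)" using True by (auto simp: good'_def)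
      define L where "L = 2 * (1 + ln (real T))"
      have Lpos: "L > 0" and L4: "L \<le> 4 * ln (real T)" using lnT by (simp_all add: L_def)
      \<comment> \<open>The maximiser of
        \<open>\<sigma> * \<epsilon> / \<kappa> - 2 * \<sigma>\<^sup>2 * L\<close>, with maximum
        \<open>\<epsilon>\<^sup>2 / (8 * \<kappa>\<^sup>2 * L)\<close>.\<close>
      define \<sigma> where "\<sigma> = \<epsilon> / (4 * \<kappa> * L)"
      have \<sigma>: "\<sigma> > 0" using \<epsilon> \<kappa> Lpos by (simp add: \<sigma>_def)
      have s2: "\<sigma>\<^sup>2 * L = \<epsilon>\<^sup>2 / (16 * \<kappa>\<^sup>2) / L"
        using Lpos by (simp add: \<sigma>_def power2_eq_square)
      have "\<epsilon>\<^sup>2 / (16 * \<kappa>\<^sup>2) \<le> 1 / 2 * L" using lnT by (simp add: L_def)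
      then have \<sigma>2: "\<sigma>\<^sup>2 * L \<le> 1 / 2"
        unfolding s2 using Lpos by (simp only: pos_divide_le_eq)
      \<comment> \<open>The unbiased weights compensate the number of terms at each lag exactly, so
        all of \<open>\<epsilon>\<close> is available for the fluctuation.\<close>
      have bb: "(\<Sum>k\<in>{1 - int T..int T - 1}. \<bar>(real T - \<bar>real_of_int k\<bar>) * (1 / (real T - \<bar>real_of_int k\<bar>)) - 1\<bar> * cmod (r k)) \<le> 0"
        by (intro sum_nonpos) auto
      have "prob {\<omega> \<in> space (M T). spectral_norm
              (toeplitz p (cov_est_unbiased vx vw (N T) T (\<lambda>n t. h T n t \<omega> + w T n t \<omega>)) - toeplitz p r) > \<epsilon>}
          \<le> 4 * real T * exp (- real (N T) * (\<sigma> * ((\<epsilon> - 0) / \<kappa>) - 2 * (\<sigma>\<^sup>2 * L)))"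
        unfolding cov_est_unbiased_eq \<kappa>_def
        by (rule spectral_norm_cov_est_tail[OF cov[OF T] NT(1) T \<open>vx > 0\<close> \<open>vw \<ge> 0\<close> rK[OF T]
              \<kappa>[unfolded \<kappa>_def] _ _ unbiased_weights_square_sum_le[OF T, folded L_def] \<sigma> \<sigma>2 bb p])
          (use T in auto)
      also have "\<sigma> * ((\<epsilon> - 0) / \<kappa>) - 2 * (\<sigma>\<^sup>2 * L) = \<epsilon>\<^sup>2 / (8 * \<kappa>\<^sup>2) / L"
        unfolding s2 using \<kappa> Lpos by (simp add: \<sigma>_def power2_eq_square field_simps)
      also have "4 * real T * exp (- real (N T) * (\<epsilon>\<^sup>2 / (8 * \<kappa>\<^sup>2) / L)) \<le>
          4 * real T * exp (- (C' * real T * \<epsilon>\<^sup>2 / ln (real T)))"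
      proof -
        have "C' * real T * \<epsilon>\<^sup>2 / ln (real T) = (c / 2 * real T) * (\<epsilon>\<^sup>2 / (8 * \<kappa>\<^sup>2) / (4 * ln (real T)))"
          using \<kappa> lnT by (simp add: C'_def)
        also have "\<dots> \<le> real (N T) * (\<epsilon>\<^sup>2 / (8 * \<kappa>\<^sup>2) / L)"
          using NT L4 Lpos c_pos lnT by (intro mult_mono divide_left_mono mult_pos_pos) auto
        finally show ?thesis by (intro mult_left_mono) auto
      qed
      also have "\<dots> = exp (- (C' * real T * \<epsilon>\<^sup>2 / ln (real T)) * (1 + \<delta>' T))"
      proof -
        define X where "X = C' * real T * \<epsilon>\<^sup>2 / ln (real T)"
        define Y where "Y = ln (4 * real T) * ln (real T) / (C' * real T * \<epsilon>\<^sup>2)"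
        have "T \<noteq> Suc 0" using lnT by auto
        then have XY: "X * Y = ln (4 * real T)"
          using T C \<epsilon> by (simp add: X_def Y_def field_simps)
        have "\<delta>' T = - Y" using True by (simp only: \<delta>'_def Y_def if_True)
        then have "- X * (1 + \<delta>' T) = ln (4 * real T) - X"
          unfolding XY[symmetric] by (simp add: algebra_simps)
        then show ?thesis unfolding X_def[symmetric]
          using T by (simp add: exp_diff exp_minus divide_inverse)
      qed
      finally show ?thesis .
    qed
    show ?thesis
      using \<delta>_lim \<delta>'_lim biased[unfolded f_def] unbiased
      by (intro exI[of _ \<delta>] exI[of _ \<delta>'] conjI allI impI ballI) auto
  qed
  show ?thesis
    by (rule exI[of _ "\<lambda>_. C"], rule exI[of _ "\<lambda>_. C'"]) (use C * in auto)
qed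

end
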